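(* Let $\mathcal{A}$ be a locally noetherian Grothendieck category, let $U$ be an open subset of $\mathrm{ASpec}\,\mathcal{A}$ such that $\Gamma_U$ preserves injective objects, and let $M$ be an object of $\mathcal{A}$. Then $\mathrm{AAss}(M/\Gamma_U(M))\subseteq\mathrm{AAss}(M)$.
   Context: A nonzero object $H$ of $\mathcal{A}$ is monoform if for every nonzero subobject $N$ of $H$, no nonzero subobject of $H$ is isomorphic to a subobject of $H/N$. Two monoform objects are atom-equivalent if they have isomorphic nonzero subobjects (this is an equivalence relation); the class of $H$ is denoted $\overline{H}$ and called an atom; $\mathrm{ASpec}\,\mathcal{A}$ is the set of atoms. For an object $M$, $\mathrm{ASupp}(M)$ is the set of atoms $\alpha$ such that some $H\in\alpha$ is a subquotient of $M$, and $\mathrm{AAss}(M)$ is the set of atoms $\alpha$ such that some $H\in\alpha$ is a subobject of $M$. A subset $\Phi\subseteq\mathrm{ASpec}\,\mathcal{A}$ is open if for every $\alpha\in\Phi$ there is $H\in\alpha$ with $\mathrm{ASupp}(H)\subseteq\Phi$. For an open subset $U$, the section functor $\Gamma_U$ assigns to $M$ the largest subobject $\Gamma_U(M)$ of $M$ with $\mathrm{ASupp}(\Gamma_U(M))\subseteq U$. *)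

theory Defs
  imports "HOL-Algebra.Group"
begin

unbundle cardinal_syntax

section \<open>Small sets\<close>

text \<open>
  HOL has no distinction between sets and classes, so smallness is taken relative to a
  Grothendieck universe. Only cardinalities matter here, so the universe is represented by an
  uncountable strongly inaccessible cardinal \<open>\<kappa>\<close>: a set (over any type) is small iff it has
  fewer than \<open>\<kappa>\<close> elements. Small index sets may then always be taken inside the type that
  carries \<open>\<kappa>\<close>.
\<close>

definition inaccessible :: "'u rel \<Rightarrow> bool" where
  "inaccessible \<kappa> \<longleftrightarrow> Card_order \<kappa> \<and> natLeq <o \<kappa> \<and> regularCard \<kappa> \<and>
     (\<forall>A :: 'u set. |A| <o \<kappa> \<longrightarrow> |Pow A| <o \<kappa>)"

definition small :: "'u rel \<Rightarrow> 'b set \<Rightarrow> bool" where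
  "small \<kappa> A \<longleftrightarrow> |A| <o \<kappa>"


section \<open>Preadditive categories\<close>

record ('o, 'm) precat =
  Ob :: "'o set"
  Arr :: "'m set"
  Dom :: "'m \<Rightarrow> 'o"
  Cod :: "'m \<Rightarrow> 'o"
  Id :: "'o \<Rightarrow> 'm"
  Comp :: "'m \<Rightarrow> 'm \<Rightarrow> 'm" (infixl "\<cdot>\<index>" 70)
  Add :: "'m \<Rightarrow> 'm \<Rightarrow> 'm" (infixl "\<boxplus>\<index>" 65)
  Zero :: "'o \<Rightarrow> 'o \<Rightarrow> 'm"

definition Hom :: "('o, 'm) precat \<Rightarrow> 'o \<Rightarrow> 'o \<Rightarrow> 'm set" where
  "Hom C X Y = {f \<in> Arr C. Dom C f = X \<and> Cod C f = Y}"

definition Hom_group :: "('o, 'm) precat \<Rightarrow> 'o \<Rightarrow> 'o \<Rightarrow> 'm monoid" where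
  "Hom_group C X Y = \<lparr>carrier = Hom C X Y, monoid.mult = Add C, one = Zero C X Y\<rparr>"

locale category =
  fixes C :: "('o, 'm) precat" (structure)
  assumes Dom_in_Ob: "f \<in> Arr C \<Longrightarrow> Dom C f \<in> Ob C"
    and Cod_in_Ob: "f \<in> Arr C \<Longrightarrow> Cod C f \<in> Ob C"
    and Id_in_Hom: "X \<in> Ob C \<Longrightarrow> Id C X \<in> Hom C X X"
    and Comp_in_Hom: "f \<in> Hom C X Y \<Longrightarrow> g \<in> Hom C Y Z \<Longrightarrow> g \<cdot> f \<in> Hom C X Z"
    and Comp_Id: "f \<in> Hom C X Y \<Longrightarrow> f \<cdot> Id C X = f"
    and Id_Comp: "f \<in> Hom C X Y \<Longrightarrow> Id C Y \<cdot> f = f"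
    and Comp_assoc: "f \<in> Hom C W X \<Longrightarrow> g \<in> Hom C X Y \<Longrightarrow> h \<in> Hom C Y Z \<Longrightarrow>
      (h \<cdot> g) \<cdot> f = h \<cdot> (g \<cdot> f)"

locale preadditive_category = category C for C :: "('o, 'm) precat" (structure) +
  assumes Hom_comm_group: "X \<in> Ob C \<Longrightarrow> Y \<in> Ob C \<Longrightarrow> comm_group (Hom_group C X Y)"
    and Comp_Add: "f \<in> Hom C X Y \<Longrightarrow> g \<in> Hom C Y Z \<Longrightarrow> g' \<in> Hom C Y Z \<Longrightarrow>
      (g \<boxplus> g') \<cdot> f = g \<cdot> f \<boxplus> g' \<cdot> f"
    and Add_Comp: "f \<in> Hom C X Y \<Longrightarrow> f' \<in> Hom C X Y \<Longrightarrow> g \<in> Hom C Y Z \<Longrightarrow>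
      g \<cdot> (f \<boxplus> f') = g \<cdot> f \<boxplus> g \<cdot> f'"


section \<open>Basic notions in a category\<close>

context
  fixes C :: "('o, 'm) precat" (structure)
begin

definition mono_arr :: "'m \<Rightarrow> bool" where
  "mono_arr f \<longleftrightarrow> f \<in> Arr C \<and>
     (\<forall>W. \<forall>g\<in>Hom C W (Dom C f). \<forall>h\<in>Hom C W (Dom C f). f \<cdot> g = f \<cdot> h \<longrightarrow> g = h)"

definition epi_arr :: "'m \<Rightarrow> bool" where
  "epi_arr f \<longleftrightarrow> f \<in> Arr C \<and>
     (\<forall>Z. \<forall>g\<in>Hom C (Cod C f) Z. \<forall>h\<in>Hom C (Cod C f) Z. g \<cdot> f = h \<cdot> f \<longrightarrow> g = h)"

definition isomorphic :: "'o \<Rightarrow> 'o \<Rightarrow> bool" where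
  "isomorphic X Y \<longleftrightarrow> X \<in> Ob C \<and> Y \<in> Ob C \<and>
     (\<exists>f\<in>Hom C X Y. \<exists>g\<in>Hom C Y X. g \<cdot> f = Id C X \<and> f \<cdot> g = Id C Y)"

definition zero_object :: "'o \<Rightarrow> bool" where
  "zero_object X \<longleftrightarrow> X \<in> Ob C \<and>
     (\<forall>Y\<in>Ob C. (\<exists>!f. f \<in> Hom C X Y) \<and> (\<exists>!f. f \<in> Hom C Y X))"

definition nonzero :: "'o \<Rightarrow> bool" where
  "nonzero X \<longleftrightarrow> X \<in> Ob C \<and> \<not> zero_object X"

definition is_kernel :: "'m \<Rightarrow> 'm \<Rightarrow> bool" where
  "is_kernel f k \<longleftrightarrow> f \<in> Arr C \<and> k \<in> Arr C \<and> Cod C k = Dom C f \<and>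
     f \<cdot> k = Zero C (Dom C k) (Cod C f) \<and>
     (\<forall>W. \<forall>h\<in>Hom C W (Dom C f). f \<cdot> h = Zero C W (Cod C f) \<longrightarrow>
        (\<exists>!u. u \<in> Hom C W (Dom C k) \<and> k \<cdot> u = h))"

definition is_cokernel :: "'m \<Rightarrow> 'm \<Rightarrow> bool" where
  "is_cokernel f q \<longleftrightarrow> f \<in> Arr C \<and> q \<in> Arr C \<and> Dom C q = Cod C f \<and>
     q \<cdot> f = Zero C (Dom C f) (Cod C q) \<and>
     (\<forall>Z. \<forall>h\<in>Hom C (Cod C f) Z. h \<cdot> f = Zero C (Dom C f) Z \<longrightarrow>
        (\<exists>!u. u \<in> Hom C (Cod C q) Z \<and> u \<cdot> q = h))"

definition short_exact :: "'m \<Rightarrow> 'm \<Rightarrow> bool" where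
  "short_exact f g \<longleftrightarrow> is_kernel g f \<and> is_cokernel f g"

definition is_biproduct :: "'o \<Rightarrow> 'o \<Rightarrow> 'o \<Rightarrow> bool" where
  "is_biproduct X Y S \<longleftrightarrow> S \<in> Ob C \<and>
     (\<exists>i\<in>Hom C X S. \<exists>j\<in>Hom C Y S. \<exists>p\<in>Hom C S X. \<exists>q\<in>Hom C S Y.
        p \<cdot> i = Id C X \<and> q \<cdot> j = Id C Y \<and> p \<cdot> j = Zero C Y X \<and> q \<cdot> i = Zero C X Y \<and>
        i \<cdot> p \<boxplus> j \<cdot> q = Id C S)"

definition is_coproduct :: "'i set \<Rightarrow> ('i \<Rightarrow> 'o) \<Rightarrow> 'o \<Rightarrow> ('i \<Rightarrow> 'm) \<Rightarrow> bool" where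
  "is_coproduct I X S \<iota> \<longleftrightarrow> S \<in> Ob C \<and> (\<forall>i\<in>I. \<iota> i \<in> Hom C (X i) S) \<and>
     (\<forall>Y\<in>Ob C. \<forall>f. (\<forall>i\<in>I. f i \<in> Hom C (X i) Y) \<longrightarrow>
        (\<exists>!h. h \<in> Hom C S Y \<and> (\<forall>i\<in>I. h \<cdot> \<iota> i = f i)))"

definition direct_system ::
    "'i set \<Rightarrow> 'i rel \<Rightarrow> ('i \<Rightarrow> 'o) \<Rightarrow> ('i \<Rightarrow> 'i \<Rightarrow> 'm) \<Rightarrow> bool" where
  "direct_system I r X t \<longleftrightarrow>
     (\<forall>i\<in>I. X i \<in> Ob C \<and> t i i = Id C (X i)) \<and>
     (\<forall>i j. (i, j) \<in> r \<longrightarrow> t i j \<in> Hom C (X i) (X j)) \<and>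
     (\<forall>i j k. (i, j) \<in> r \<longrightarrow> (j, k) \<in> r \<longrightarrow> t j k \<cdot> t i j = t i k)"

definition is_direct_limit ::
    "'i set \<Rightarrow> 'i rel \<Rightarrow> ('i \<Rightarrow> 'o) \<Rightarrow> ('i \<Rightarrow> 'i \<Rightarrow> 'm) \<Rightarrow> 'o \<Rightarrow> ('i \<Rightarrow> 'm) \<Rightarrow> bool" where
  "is_direct_limit I r X t L \<iota> \<longleftrightarrow> L \<in> Ob C \<and>
     (\<forall>i\<in>I. \<iota> i \<in> Hom C (X i) L) \<and>
     (\<forall>i j. (i, j) \<in> r \<longrightarrow> \<iota> j \<cdot> t i j = \<iota> i) \<and>
     (\<forall>Y\<in>Ob C. \<forall>f. (\<forall>i\<in>I. f i \<in> Hom C (X i) Y) \<and> (\<forall>i j. (i, j) \<in> r \<longrightarrow> f j \<cdot> t i j = f i) \<longrightarrow>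
        (\<exists>!h. h \<in> Hom C L Y \<and> (\<forall>i\<in>I. h \<cdot> \<iota> i = f i)))"

definition injective_object :: "'o \<Rightarrow> bool" where
  "injective_object E \<longleftrightarrow> E \<in> Ob C \<and>
     (\<forall>i. mono_arr i \<longrightarrow> (\<forall>f\<in>Hom C (Dom C i) E. \<exists>g\<in>Hom C (Cod C i) E. g \<cdot> i = f))"

text \<open>Subobjects of \<open>M\<close> are represented by monomorphisms \<open>i\<close> with codomain \<open>M\<close>.\<close>

definition subobj :: "'m \<Rightarrow> 'o \<Rightarrow> bool" where
  "subobj i M \<longleftrightarrow> mono_arr i \<and> Cod C i = M"

definition sub_le :: "'m \<Rightarrow> 'm \<Rightarrow> bool" where
  "sub_le i j \<longleftrightarrow> (\<exists>u\<in>Hom C (Dom C i) (Dom C j). j \<cdot> u = i)"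

text \<open>The quotient of \<open>Cod C i\<close> by the subobject \<open>i\<close>.\<close>

definition quotient_object :: "'m \<Rightarrow> 'o" where
  "quotient_object i = Cod C (SOME q. is_cokernel i q)"

definition noetherian_object :: "'o \<Rightarrow> bool" where
  "noetherian_object M \<longleftrightarrow> M \<in> Ob C \<and>
     (\<forall>i :: nat \<Rightarrow> 'm. (\<forall>n. subobj (i n) M \<and> sub_le (i n) (i (Suc n))) \<longrightarrow>
        (\<exists>n. \<forall>m\<ge>n. sub_le (i m) (i n)))"

definition generating :: "'o set \<Rightarrow> bool" where
  "generating \<G> \<longleftrightarrow> \<G> \<subseteq> Ob C \<and>
     (\<forall>X Y. \<forall>f\<in>Hom C X Y. \<forall>g\<in>Hom C X Y. f \<noteq> g \<longrightarrow>
        (\<exists>G\<in>\<G>. \<exists>h\<in>Hom C G X. f \<cdot> h \<noteq> g \<cdot> h))"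

end

definition directed_preorder :: "'i set \<Rightarrow> 'i rel \<Rightarrow> bool" where
  "directed_preorder I r \<longleftrightarrow> I \<noteq> {} \<and> preorder_on I r \<and>
     (\<forall>i\<in>I. \<forall>j\<in>I. \<exists>k\<in>I. (i, k) \<in> r \<and> (j, k) \<in> r)"


section \<open>Locally noetherian Grothendieck categories\<close>

locale abelian_category = preadditive_category C for C :: "('o, 'm) precat" (structure) +
  assumes ex_zero_object: "\<exists>X. zero_object C X"
    and ex_biproduct: "X \<in> Ob C \<Longrightarrow> Y \<in> Ob C \<Longrightarrow> \<exists>S. is_biproduct C X Y S"
    and ex_kernel: "f \<in> Arr C \<Longrightarrow> \<exists>k. is_kernel C f k"
    and ex_cokernel: "f \<in> Arr C \<Longrightarrow> \<exists>q. is_cokernel C f q"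
    and mono_is_kernel: "mono_arr C f \<Longrightarrow> \<exists>g. is_kernel C g f"
    and epi_is_cokernel: "epi_arr C f \<Longrightarrow> \<exists>g. is_cokernel C g f"

text \<open>
  Direct limits of small directed systems exist because they are cokernels of maps between
  coproducts; hence only their exactness is assumed.
\<close>

locale grothendieck_category = abelian_category C
  for \<kappa> :: "'u rel" and C :: "('o, 'm) precat" (structure) +
  assumes locally_small: "X \<in> Ob C \<Longrightarrow> Y \<in> Ob C \<Longrightarrow> small \<kappa> (Hom C X Y)"
    and ex_coproduct: "\<And>(I :: 'u set) X. small \<kappa> I \<Longrightarrow> (\<forall>i\<in>I. X i \<in> Ob C) \<Longrightarrow>
      \<exists>S \<iota>. is_coproduct C I X S \<iota>"
    and direct_limits_exact: "\<And>(I :: 'u set) r X s Y t Z u f g LX \<iota> LY \<iota>' LZ \<iota>'' \<phi> \<psi>.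
      small \<kappa> I \<Longrightarrow> directed_preorder I r \<Longrightarrow>
      direct_system C I r X s \<Longrightarrow> direct_system C I r Y t \<Longrightarrow> direct_system C I r Z u \<Longrightarrow>
      (\<forall>i\<in>I. f i \<in> Hom C (X i) (Y i) \<and> g i \<in> Hom C (Y i) (Z i) \<and> short_exact C (f i) (g i)) \<Longrightarrow>
      (\<forall>i j. (i, j) \<in> r \<longrightarrow> t i j \<cdot> f i = f j \<cdot> s i j \<and> u i j \<cdot> g i = g j \<cdot> t i j) \<Longrightarrow>
      is_direct_limit C I r X s LX \<iota> \<Longrightarrow>
      is_direct_limit C I r Y t LY \<iota>' \<Longrightarrow>
      is_direct_limit C I r Z u LZ \<iota>'' \<Longrightarrow>
      \<phi> \<in> Hom C LX LY \<Longrightarrow> (\<forall>i\<in>I. \<phi> \<cdot> \<iota> i = \<iota>' i \<cdot> f i) \<Longrightarrow>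
      \<psi> \<in> Hom C LY LZ \<Longrightarrow> (\<forall>i\<in>I. \<psi> \<cdot> \<iota>' i = \<iota>'' i \<cdot> g i) \<Longrightarrow>
      short_exact C \<phi> \<psi>"
    and ex_generator: "\<exists>G. generating C {G}"

locale locally_noetherian_grothendieck_category = grothendieck_category \<kappa> C
  for \<kappa> :: "'u rel" and C :: "('o, 'm) precat" (structure) +
  assumes ex_noetherian_generating:
    "\<exists>\<G>. small \<kappa> \<G> \<and> generating C \<G> \<and> (\<forall>G\<in>\<G>. noetherian_object C G)"


section \<open>Atoms\<close>

context
  fixes C :: "('o, 'm) precat" (structure)
begin

definition monoform :: "'o \<Rightarrow> bool" where
  "monoform H \<longleftrightarrow> nonzero C H \<and>
     (\<forall>i. subobj C i H \<and> nonzero C (Dom C i) \<longrightarrow>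
        \<not> (\<exists>j k. subobj C j H \<and> nonzero C (Dom C j) \<and>
               subobj C k (quotient_object C i) \<and> isomorphic C (Dom C j) (Dom C k)))"

definition atom_equiv :: "'o rel" where
  "atom_equiv = {(H, H'). monoform H \<and> monoform H' \<and>
     (\<exists>i j. subobj C i H \<and> subobj C j H' \<and>
        nonzero C (Dom C i) \<and> nonzero C (Dom C j) \<and> isomorphic C (Dom C i) (Dom C j))}"

text \<open>An atom is the set of all monoform objects in one equivalence class.\<close>

definition ASpec :: "'o set set" where
  "ASpec = {H. monoform H} // atom_equiv"

definition subquotient :: "'o \<Rightarrow> 'o \<Rightarrow> bool" where
  "subquotient H M \<longleftrightarrow> (\<exists>i q. subobj C i M \<and> epi_arr C q \<and> Dom C q = Dom C i \<and> Cod C q = H)"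

definition ASupp :: "'o \<Rightarrow> 'o set set" where
  "ASupp M = {\<alpha> \<in> ASpec. \<exists>H\<in>\<alpha>. subquotient H M}"

definition AAss :: "'o \<Rightarrow> 'o set set" where
  "AAss M = {\<alpha> \<in> ASpec. \<exists>H\<in>\<alpha>. \<exists>i. subobj C i M \<and> Dom C i = H}"

definition atom_open :: "'o set set \<Rightarrow> bool" where
  "atom_open \<Phi> \<longleftrightarrow> \<Phi> \<subseteq> ASpec \<and> (\<forall>\<alpha>\<in>\<Phi>. \<exists>H\<in>\<alpha>. ASupp H \<subseteq> \<Phi>)"

text \<open>
  The largest subobject of \<open>M\<close> with atom support in \<open>U\<close>, as an inclusion into \<open>M\<close>. It is
  determined up to isomorphism of subobjects; the section functor sends \<open>M\<close> to its domain.
\<close>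

definition is_section_inclusion :: "'o set set \<Rightarrow> 'o \<Rightarrow> 'm \<Rightarrow> bool" where
  "is_section_inclusion U M i \<longleftrightarrow> subobj C i M \<and> ASupp (Dom C i) \<subseteq> U \<and>
     (\<forall>j. subobj C j M \<and> ASupp (Dom C j) \<subseteq> U \<longrightarrow> sub_le C j i)"

definition section_inclusion :: "'o set set \<Rightarrow> 'o \<Rightarrow> 'm" where
  "section_inclusion U M = (SOME i. is_section_inclusion U M i)"

definition section_object :: "'o set set \<Rightarrow> 'o \<Rightarrow> 'o" where
  "section_object U M = Dom C (section_inclusion U M)"

definition section_preserves_injectives :: "'o set set \<Rightarrow> bool" where
  "section_preserves_injectives U \<longleftrightarrow>
     (\<forall>E. injective_object C E \<longrightarrow> injective_object C (section_object U E))"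

end

end

theory Submission
  imports Defs
begin

text \<open>
  Let \<open>H\<close> be a monoform subobject of \<open>M / \<Gamma>(M)\<close> and \<open>P\<close> its preimage in \<open>M\<close>. If some nonzero subobject of \<open>P\<close>
  meets \<open>\<Gamma>(M)\<close> trivially, it embeds in \<open>H\<close> and shows that the atom of \<open>H\<close> is associated to \<open>M\<close>. Otherwise
  \<open>\<Gamma>(M)\<close> is essential in \<open>P\<close>. Embed \<open>\<Gamma>(M)\<close> in an injective object \<open>E\<close>; the image lies in \<open>\<Gamma>(E)\<close>, which is again
  injective, so \<open>\<Gamma>(M) \<rightarrow> \<Gamma>(E)\<close> extends to \<open>P\<close>, and the extension is monic by essentiality. Hence the support of
  \<open>P\<close> lies in \<open>U\<close>, so \<open>P\<close> is contained in \<open>\<Gamma>(M)\<close> and \<open>H = 0\<close>, which is absurd. Injective envelopes are not needed.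

  Since noetherian objects are small with respect to chains, embeddings into injectives are colimits of
  countable towers of pushouts.
\<close>

section \<open>Preadditive categories\<close>

text \<open>Two existence results carry the argument: embeddings into injectives, and the largest
  subobject with support in \<open>U\<close>, which is defined only by choice. Both rest on one
  infinite input, exactness of direct limits, turned once into \<open>directed_span_null\<close>:
  the preimage of a directed union is the union of the preimages. That statement reduces infinitely
  many relations to finitely many, embeds each stage of a tower in its colimit, supplies the chain
  condition for Zorn's lemma in Baer's criterion, and finds a subquotient of a directed union in one
  member. Objects have no elements, so membership is expressed by arrows: \<open>x\<close> lies in a
  sum of images iff every arrow killing the images kills \<open>x\<close>, and preimages are chosen
  after composing with an epimorphism. Smallness is the other obstacle: the axioms speak of index
  sets in one type only, so families are cut down through a generator and transported along
  injections. The tower extends partial maps from a single generator \<open>G\<close>; the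
  noetherian condition is put on their domains, because \<open>G\<close> is a coproduct of possibly
  infinitely many noetherian generators.\<close>

context category
begin

lemma Hom_iff [simp]: "f \<in> Hom C X Y \<longleftrightarrow> f \<in> Arr C \<and> Dom C f = X \<and> Cod C f = Y"
  by (simp add: Hom_def)

declare Dom_in_Ob [simp] Cod_in_Ob [simp]

lemma Id_arr [simp]:
  assumes "X \<in> Ob C"
  shows "Id C X \<in> Arr C" "Dom C (Id C X) = X" "Cod C (Id C X) = X"
  using Id_in_Hom[OF assms] by simp_all

lemma Comp_arr [simp]:
  assumes "f \<in> Arr C" "g \<in> Arr C" "Dom C g = Cod C f"
  shows "g \<cdot> f \<in> Arr C" "Dom C (g \<cdot> f) = Dom C f" "Cod C (g \<cdot> f) = Cod C g"
  using Comp_in_Hom[of f "Dom C f" "Cod C f" g "Cod C g"] assms by simp_all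

lemma Comp_Id_simps [simp]:
  assumes "f \<in> Arr C"
  shows "Dom C f = X \<Longrightarrow> f \<cdot> Id C X = f" "Cod C f = Y \<Longrightarrow> Id C Y \<cdot> f = f"
  using Comp_Id[of f "Dom C f" "Cod C f"] Id_Comp[of f "Dom C f" "Cod C f"] assms by auto

lemma Comp_assoc_simp [simp]:
  assumes "f \<in> Arr C" "g \<in> Arr C" "h \<in> Arr C" "Dom C g = Cod C f" "Dom C h = Cod C g"
  shows "(h \<cdot> g) \<cdot> f = h \<cdot> (g \<cdot> f)"
  using Comp_assoc[of f "Dom C f" "Cod C f" g "Cod C g" h "Cod C h"] assms by simp

text \<open>The simplifier nests composites to the right, where a known
  \<open>g \<cdot> f = h\<close> no longer occurs as a subterm; this restores its use.\<close>

lemma Comp_eq_Comp: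
  assumes "g \<cdot> f = h" "x \<in> Arr C" "f \<in> Arr C" "g \<in> Arr C" "Dom C g = Cod C f" "Dom C f = Cod C x"
  shows "g \<cdot> (f \<cdot> x) = h \<cdot> x"
  using assms Comp_assoc_simp by metis

end

context preadditive_category
begin

lemma Hom_group_simps [simp]:
  "carrier (Hom_group C X Y) = Hom C X Y"
  "f \<otimes>\<^bsub>Hom_group C X Y\<^esub> g = f \<boxplus> g"
  "\<one>\<^bsub>Hom_group C X Y\<^esub> = Zero C X Y"
  by (simp_all add: Hom_group_def)

definition Neg :: "'m \<Rightarrow> 'm" where
  "Neg f = inv\<^bsub>Hom_group C (Dom C f) (Cod C f)\<^esub> f"

definition Sub :: "'m \<Rightarrow> 'm \<Rightarrow> 'm" where
  "Sub f g = f \<boxplus> Neg g"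

text \<open>A predicate instead of an equation with \<open>Zero\<close>, so that vanishing
  statements do not mention end objects and pass through composition in the simplifier.\<close>

definition null :: "'m \<Rightarrow> bool" where
  "null f \<longleftrightarrow> f = Zero C (Dom C f) (Cod C f)"

lemma Hom_group: "X \<in> Ob C \<Longrightarrow> Y \<in> Ob C \<Longrightarrow> group (Hom_group C X Y)"
  using Hom_comm_group comm_group.axioms(2) by blast

lemma Zero_arr [simp]:
  assumes "X \<in> Ob C" "Y \<in> Ob C"
  shows "Zero C X Y \<in> Arr C" "Dom C (Zero C X Y) = X" "Cod C (Zero C X Y) = Y"
proof -
  interpret group "Hom_group C X Y" using assms by (rule Hom_group)
  show "Zero C X Y \<in> Arr C" "Dom C (Zero C X Y) = X" "Cod C (Zero C X Y) = Y"
    using one_closed by simp_all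
qed

lemma Add_arr [simp]:
  assumes "f \<in> Arr C" "g \<in> Arr C" "Dom C g = Dom C f" "Cod C g = Cod C f"
  shows "f \<boxplus> g \<in> Arr C" "Dom C (f \<boxplus> g) = Dom C f" "Cod C (f \<boxplus> g) = Cod C f"
proof -
  interpret group "Hom_group C (Dom C f) (Cod C f)" using assms by (simp add: Hom_group)
  show "f \<boxplus> g \<in> Arr C" "Dom C (f \<boxplus> g) = Dom C f" "Cod C (f \<boxplus> g) = Cod C f"
    using m_closed[of f g] assms by simp_all
qed

lemma Neg_arr [simp]:
  assumes "f \<in> Arr C"
  shows "Neg f \<in> Arr C" "Dom C (Neg f) = Dom C f" "Cod C (Neg f) = Cod C f"
proof -
  interpret group "Hom_group C (Dom C f) (Cod C f)" using assms by (simp add: Hom_group)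
  show "Neg f \<in> Arr C" "Dom C (Neg f) = Dom C f" "Cod C (Neg f) = Cod C f"
    using inv_closed[of f] assms by (simp_all add: Neg_def)
qed

lemma Add_Zero [simp]:
  assumes "f \<in> Arr C"
  shows "Dom C f = X \<Longrightarrow> Cod C f = Y \<Longrightarrow> f \<boxplus> Zero C X Y = f"
    and "Dom C f = X \<Longrightarrow> Cod C f = Y \<Longrightarrow> Zero C X Y \<boxplus> f = f"
proof -
  interpret group "Hom_group C (Dom C f) (Cod C f)" using assms by (simp add: Hom_group)
  show "Dom C f = X \<Longrightarrow> Cod C f = Y \<Longrightarrow> f \<boxplus> Zero C X Y = f"
    using r_one[of f] assms by simp
  show "Dom C f = X \<Longrightarrow> Cod C f = Y \<Longrightarrow> Zero C X Y \<boxplus> f = f"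
    using l_one[of f] assms by simp
qed

lemma Add_null:
  assumes "f \<in> Arr C" "g \<in> Arr C" "Dom C g = Dom C f" "Cod C g = Cod C f"
  shows "null g \<Longrightarrow> f \<boxplus> g = f" "null g \<Longrightarrow> g \<boxplus> f = f"
  using assms Add_Zero[of f] by (auto simp: null_def)

lemma Add_Neg [simp]: "f \<in> Arr C \<Longrightarrow> f \<boxplus> Neg f = Zero C (Dom C f) (Cod C f)"
proof -
  assume f: "f \<in> Arr C"
  interpret group "Hom_group C (Dom C f) (Cod C f)" using f by (simp add: Hom_group)
  show ?thesis using r_inv[of f] f by (simp add: Neg_def)
qed

lemma Neg_unique:
  assumes "f \<in> Arr C" "g \<in> Arr C" "Dom C g = Dom C f" "Cod C g = Cod C f" "null (f \<boxplus> g)"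
  shows "g = Neg f"
proof -
  interpret comm_group "Hom_group C (Dom C f) (Cod C f)" using assms by (simp add: Hom_comm_group)
  have "g \<otimes>\<^bsub>Hom_group C (Dom C f) (Cod C f)\<^esub> f = \<one>\<^bsub>Hom_group C (Dom C f) (Cod C f)\<^esub>"
    using assms m_comm[of f g] by (simp add: null_def)
  then show ?thesis
    unfolding Neg_def using assms by (metis inv_equality Hom_group_simps(1) Hom_iff)
qed

lemma Neg_Neg [simp]: "f \<in> Arr C \<Longrightarrow> Neg (Neg f) = f"
proof -
  assume f: "f \<in> Arr C"
  interpret group "Hom_group C (Dom C f) (Cod C f)" using f by (simp add: Hom_group)
  show ?thesis using inv_inv[of f] f by (simp add: Neg_def[of "Neg f"]) (simp add: Neg_def)
qed

text \<open>Cancel \<open>f\<close> in its hom group. Distributivity makes a composite with a zero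
  arrow equal to its own double, so such composites vanish.\<close>

lemma idem_null:
  assumes "f \<in> Arr C" "f \<boxplus> f = f"
  shows "null f"
proof -
  interpret group "Hom_group C (Dom C f) (Cod C f)" using assms by (simp add: Hom_group)
  show ?thesis using assms r_cancel_one[of f f] by (simp add: null_def)
qed

lemma null_Zero [simp]: "X \<in> Ob C \<Longrightarrow> Y \<in> Ob C \<Longrightarrow> null (Zero C X Y)"
  by (simp add: null_def)

lemma null_comp1 [simp]:
  assumes "null g" "f \<in> Arr C" "g \<in> Arr C" "Dom C g = Cod C f"
  shows "null (g \<cdot> f)"
proof (rule idem_null)
  have "g \<boxplus> g = g" using assms Add_null by metis
  then show "g \<cdot> f \<boxplus> g \<cdot> f = g \<cdot> f"
    using Comp_Add[of f "Dom C f" "Cod C f" g "Cod C g" g] assms by simp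
qed (use assms in simp)

lemma null_comp2 [simp]:
  assumes "null f" "f \<in> Arr C" "g \<in> Arr C" "Dom C g = Cod C f"
  shows "null (g \<cdot> f)"
proof (rule idem_null)
  have "f \<boxplus> f = f" using assms Add_null by metis
  then show "g \<cdot> f \<boxplus> g \<cdot> f = g \<cdot> f"
    using Add_Comp[of f "Dom C f" "Cod C f" f g "Cod C g"] assms by simp
qed (use assms in simp)

lemma null_comp3 [simp]:
  assumes "null (g \<cdot> f)" "f \<in> Arr C" "g \<in> Arr C" "Dom C g = Cod C f" "x \<in> Arr C" "Dom C f = Cod C x"
  shows "null (g \<cdot> (f \<cdot> x))"
proof -
  have "null ((g \<cdot> f) \<cdot> x)"
    by (rule null_comp1[OF assms(1)]) (use assms in simp_all)
  then show ?thesis using assms by simp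
qed

lemma null_eq: "null f \<Longrightarrow> null g \<Longrightarrow> Dom C f = Dom C g \<Longrightarrow> Cod C f = Cod C g \<Longrightarrow> f = g"
  by (simp add: null_def)

lemma Zero_comp [simp]:
  assumes "f \<in> Arr C"
  shows "X \<in> Ob C \<Longrightarrow> Dom C f = Y \<Longrightarrow> f \<cdot> Zero C X Y = Zero C X (Cod C f)"
    and "Y \<in> Ob C \<Longrightarrow> Cod C f = X \<Longrightarrow> Zero C X Y \<cdot> f = Zero C (Dom C f) Y"
  using assms by (auto intro!: null_eq)

lemma Neg_comp1:
  assumes "f \<in> Arr C" "g \<in> Arr C" "Dom C g = Cod C f"
  shows "Neg g \<cdot> f = Neg (g \<cdot> f)"
proof (rule Neg_unique)
  have "g \<cdot> f \<boxplus> Neg g \<cdot> f = (g \<boxplus> Neg g) \<cdot> f"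
    using Comp_Add[of f "Dom C f" "Cod C f" g "Cod C g" "Neg g"] assms by simp
  then show "null (g \<cdot> f \<boxplus> Neg g \<cdot> f)" using assms by simp
qed (use assms in simp_all)

lemma Neg_comp2:
  assumes "f \<in> Arr C" "g \<in> Arr C" "Dom C g = Cod C f"
  shows "g \<cdot> Neg f = Neg (g \<cdot> f)"
proof (rule Neg_unique)
  have "g \<cdot> f \<boxplus> g \<cdot> Neg f = g \<cdot> (f \<boxplus> Neg f)"
    using Add_Comp[of f "Dom C f" "Cod C f" "Neg f" g "Cod C g"] assms by simp
  then show "null (g \<cdot> f \<boxplus> g \<cdot> Neg f)" using assms by simp
qed (use assms in simp_all)

lemma Sub_arr [simp]:
  assumes "f \<in> Arr C" "g \<in> Arr C" "Dom C g = Dom C f" "Cod C g = Cod C f"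
  shows "Sub f g \<in> Arr C" "Dom C (Sub f g) = Dom C f" "Cod C (Sub f g) = Cod C f"
  using assms by (simp_all add: Sub_def)

lemma Sub_comp:
  assumes "f \<in> Arr C" "g \<in> Arr C" "Dom C g = Dom C f" "Cod C g = Cod C f"
  shows "x \<in> Arr C \<Longrightarrow> Cod C x = Dom C f \<Longrightarrow> Sub f g \<cdot> x = Sub (f \<cdot> x) (g \<cdot> x)"
    and "h \<in> Arr C \<Longrightarrow> Dom C h = Cod C f \<Longrightarrow> h \<cdot> Sub f g = Sub (h \<cdot> f) (h \<cdot> g)"
  using assms Comp_Add[of x "Dom C x" "Cod C x" f "Cod C f" "Neg g"]
    Add_Comp[of f "Dom C f" "Cod C f" "Neg g" h "Cod C h"]
  by (simp_all add: Sub_def Neg_comp1 Neg_comp2)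

lemma null_Sub_iff [simp]:
  assumes "f \<in> Arr C" "g \<in> Arr C" "Dom C g = Dom C f" "Cod C g = Cod C f"
  shows "null (Sub f g) \<longleftrightarrow> f = g"
proof
  assume "null (Sub f g)"
  then have "Neg g = Neg f" using assms by (intro Neg_unique) (simp_all add: Sub_def)
  then show "f = g" using assms Neg_Neg by metis
next
  assume "f = g"
  then show "null (Sub f g)" using assms by (simp add: Sub_def)
qed

lemma Sub_null2:
  assumes "null g" "f \<in> Arr C" "g \<in> Arr C" "Dom C g = Dom C f" "Cod C g = Cod C f"
  shows "Sub f g = f"
proof -
  have "g = Neg g"
    using assms Add_null[of g g] by (intro Neg_unique) auto
  then have "null (Neg g)" using assms by simp
  then show ?thesis using assms by (simp add: Sub_def Add_null)
qed

lemma null_Sub_null: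
  assumes "null f" "null (Sub f g)" "f \<in> Arr C" "g \<in> Arr C" "Dom C g = Dom C f" "Cod C g = Cod C f"
  shows "null g"
  using assms by simp

text \<open>Bilinearity turns equality of two composites into vanishing of the composite with their
  difference.\<close>

lemma mono_arr_iff:
  "mono_arr C f \<longleftrightarrow> f \<in> Arr C \<and> (\<forall>x\<in>Arr C. Cod C x = Dom C f \<longrightarrow> null (f \<cdot> x) \<longrightarrow> null x)"
proof safe
  assume m: "mono_arr C f"
  then show f: "f \<in> Arr C" by (simp add: mono_arr_def)
  fix x assume x: "x \<in> Arr C" "Cod C x = Dom C f" "null (f \<cdot> x)"
  then have "f \<cdot> x = f \<cdot> Zero C (Dom C x) (Cod C x)" using f by (intro null_eq) simp_all
  then have "x = Zero C (Dom C x) (Cod C x)" using m x f by (simp add: mono_arr_def)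
  then show "null x" by (simp add: null_def)
next
  assume f: "f \<in> Arr C" and *: "\<forall>x\<in>Arr C. Cod C x = Dom C f \<longrightarrow> null (f \<cdot> x) \<longrightarrow> null x"
  show "mono_arr C f"
    unfolding mono_arr_def
  proof (intro conjI allI ballI impI f)
    fix W g h assume gh: "g \<in> Hom C W (Dom C f)" "h \<in> Hom C W (Dom C f)" "f \<cdot> g = f \<cdot> h"
    then have "null (f \<cdot> Sub g h)" using f by (simp add: Sub_comp)
    then have "null (Sub g h)" using * gh by simp
    then show "g = h" using gh by simp
  qed
qed

lemma epi_arr_iff:
  "epi_arr C f \<longleftrightarrow> f \<in> Arr C \<and> (\<forall>x\<in>Arr C. Dom C x = Cod C f \<longrightarrow> null (x \<cdot> f) \<longrightarrow> null x)"
proof safe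
  assume m: "epi_arr C f"
  then show f: "f \<in> Arr C" by (simp add: epi_arr_def)
  fix x assume x: "x \<in> Arr C" "Dom C x = Cod C f" "null (x \<cdot> f)"
  then have "x \<cdot> f = Zero C (Dom C x) (Cod C x) \<cdot> f" using f by (intro null_eq) simp_all
  then have "x = Zero C (Dom C x) (Cod C x)" using m x f by (simp add: epi_arr_def)
  then show "null x" by (simp add: null_def)
next
  assume f: "f \<in> Arr C" and *: "\<forall>x\<in>Arr C. Dom C x = Cod C f \<longrightarrow> null (x \<cdot> f) \<longrightarrow> null x"
  show "epi_arr C f"
    unfolding epi_arr_def
  proof (intro conjI allI ballI impI f)
    fix W g h assume gh: "g \<in> Hom C (Cod C f) W" "h \<in> Hom C (Cod C f) W" "g \<cdot> f = h \<cdot> f"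
    then have "null (Sub g h \<cdot> f)" using f by (simp add: Sub_comp)
    then have "null (Sub g h)" using * gh by simp
    then show "g = h" using gh by simp
  qed
qed

lemma mono_arrD: "mono_arr C f \<Longrightarrow> f \<in> Arr C"
  and epi_arrD: "epi_arr C f \<Longrightarrow> f \<in> Arr C"
  by (simp_all add: mono_arr_iff epi_arr_iff)

lemma mono_cancel:
  "f \<cdot> g = f \<cdot> h \<Longrightarrow> mono_arr C f \<Longrightarrow> g \<in> Arr C \<Longrightarrow> h \<in> Arr C \<Longrightarrow> Dom C g = Dom C h
    \<Longrightarrow> Cod C g = Dom C f \<Longrightarrow> Cod C h = Dom C f \<Longrightarrow> g = h"
  by (simp add: mono_arr_def)

lemma epi_cancel:
  "g \<cdot> f = h \<cdot> f \<Longrightarrow> epi_arr C f \<Longrightarrow> g \<in> Arr C \<Longrightarrow> h \<in> Arr C \<Longrightarrow> Cod C g = Cod C h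
    \<Longrightarrow> Dom C g = Cod C f \<Longrightarrow> Dom C h = Cod C f \<Longrightarrow> g = h"
  by (simp add: epi_arr_def)

lemma mono_null_iff:
  "mono_arr C f \<Longrightarrow> x \<in> Arr C \<Longrightarrow> Cod C x = Dom C f \<Longrightarrow> null (f \<cdot> x) \<longleftrightarrow> null x"
  using mono_arr_iff null_comp2 by metis

lemma epi_null_iff:
  "epi_arr C f \<Longrightarrow> x \<in> Arr C \<Longrightarrow> Dom C x = Cod C f \<Longrightarrow> null (x \<cdot> f) \<longleftrightarrow> null x"
  using epi_arr_iff null_comp1 by metis

lemma mono_Id [simp]: "X \<in> Ob C \<Longrightarrow> mono_arr C (Id C X)"
  and epi_Id [simp]: "X \<in> Ob C \<Longrightarrow> epi_arr C (Id C X)"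
  by (simp_all add: mono_arr_iff epi_arr_iff)

lemma mono_comp:
  assumes "mono_arr C f" "mono_arr C g" "Dom C g = Cod C f"
  shows "mono_arr C (g \<cdot> f)"
  unfolding mono_arr_iff
proof (intro conjI ballI impI)
  fix x assume x: "x \<in> Arr C" "Cod C x = Dom C (g \<cdot> f)" "null ((g \<cdot> f) \<cdot> x)"
  then show "null x" using assms by (simp add: mono_null_iff mono_arrD)
qed (use assms in \<open>simp add: mono_arrD\<close>)

lemma epi_comp:
  assumes "epi_arr C f" "epi_arr C g" "Dom C g = Cod C f"
  shows "epi_arr C (g \<cdot> f)"
  unfolding epi_arr_iff
proof (intro conjI ballI impI)
  fix x assume x: "x \<in> Arr C" "Dom C x = Cod C (g \<cdot> f)" "null (x \<cdot> (g \<cdot> f))"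
  then have "null ((x \<cdot> g) \<cdot> f)" using assms by (simp add: epi_arrD)
  then have "null (x \<cdot> g)" using assms x epi_null_iff[of f "x \<cdot> g"] by (simp add: epi_arrD del: Comp_assoc_simp)
  then show "null x" using assms x by (simp add: epi_null_iff epi_arrD)
qed (use assms in \<open>simp add: epi_arrD\<close>)

lemma mono_comp_right:
  assumes "mono_arr C (g \<cdot> f)" "f \<in> Arr C" "g \<in> Arr C" "Dom C g = Cod C f"
  shows "mono_arr C f"
  unfolding mono_arr_iff
proof (intro conjI ballI impI assms)
  fix x assume x: "x \<in> Arr C" "Cod C x = Dom C f" "null (f \<cdot> x)"
  then show "null x" using assms mono_null_iff[of "g \<cdot> f" x] by simp
qed

lemma epi_comp_left:
  assumes "epi_arr C (g \<cdot> f)" "f \<in> Arr C" "g \<in> Arr C" "Dom C g = Cod C f"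
  shows "epi_arr C g"
  unfolding epi_arr_iff
proof (intro conjI ballI impI assms)
  fix x assume x: "x \<in> Arr C" "Dom C x = Cod C g" "null (x \<cdot> g)"
  then have "null (x \<cdot> (g \<cdot> f))" using assms by simp
  then show "null x" using assms x epi_null_iff[of "g \<cdot> f" x] by simp
qed

lemma zero_object_iff: "zero_object C X \<longleftrightarrow> X \<in> Ob C \<and> null (Id C X)"
proof safe
  assume z: "zero_object C X"
  then show X: "X \<in> Ob C" by (simp add: zero_object_def)
  then have "Id C X \<in> Hom C X X" "Zero C X X \<in> Hom C X X" by simp_all
  then have "Id C X = Zero C X X" using z X unfolding zero_object_def by blast
  then show "null (Id C X)" using X by simp
next
  assume X: "X \<in> Ob C" "null (Id C X)"
  have 1: "null f" if "f \<in> Arr C" "Dom C f = X" for f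
    using null_comp2[of "Id C X" f] X that by simp
  have 2: "null f" if "f \<in> Arr C" "Cod C f = X" for f
    using null_comp1[of "Id C X" f] X that by simp
  show "zero_object C X"
    unfolding zero_object_def
  proof (intro conjI ballI X)
    fix Y assume Y: "Y \<in> Ob C"
    show "\<exists>!f. f \<in> Hom C X Y"
      by (rule ex1I[of _ "Zero C X Y"]) (use X Y in \<open>auto intro!: null_eq 1\<close>)
    show "\<exists>!f. f \<in> Hom C Y X"
      by (rule ex1I[of _ "Zero C Y X"]) (use X Y in \<open>auto intro!: null_eq 2\<close>)
  qed
qed

lemma nonzero_iff: "nonzero C X \<longleftrightarrow> X \<in> Ob C \<and> \<not> null (Id C X)"
  by (auto simp: nonzero_def zero_object_iff)

lemma nonzero_mono_iff:
  assumes "mono_arr C f"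
  shows "nonzero C (Dom C f) \<longleftrightarrow> \<not> null f"
  using assms mono_null_iff[of f "Id C (Dom C f)"] by (auto simp: nonzero_iff mono_arrD)

lemma nonzero_epi_iff:
  assumes "epi_arr C f"
  shows "nonzero C (Cod C f) \<longleftrightarrow> \<not> null f"
  using assms epi_null_iff[of f "Id C (Cod C f)"] by (auto simp: nonzero_iff epi_arrD)

lemma is_kernelD:
  assumes "is_kernel C f k"
  shows "f \<in> Arr C" "k \<in> Arr C" "Cod C k = Dom C f" "null (f \<cdot> k)" "mono_arr C k"
    and "x \<in> Arr C \<Longrightarrow> Cod C x = Dom C f \<Longrightarrow> null (f \<cdot> x) \<Longrightarrow>
      \<exists>u\<in>Arr C. Dom C u = Dom C x \<and> Cod C u = Dom C k \<and> k \<cdot> u = x"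
proof -
  show k: "f \<in> Arr C" "k \<in> Arr C" "Cod C k = Dom C f" "null (f \<cdot> k)"
    using assms by (auto simp: is_kernel_def)
  show "mono_arr C k"
    unfolding mono_arr_def
  proof (intro conjI allI ballI impI k)
    fix W g h assume gh: "g \<in> Hom C W (Dom C k)" "h \<in> Hom C W (Dom C k)" "k \<cdot> g = k \<cdot> h"
    have "null (f \<cdot> (k \<cdot> g))" by (rule null_comp3) (use k gh in simp_all)
    then have "f \<cdot> (k \<cdot> g) = Zero C W (Cod C f)" "k \<cdot> g \<in> Hom C W (Dom C f)"
      using k gh by (simp_all add: null_def)
    then have "\<exists>!u. u \<in> Hom C W (Dom C k) \<and> k \<cdot> u = k \<cdot> g"
      using assms unfolding is_kernel_def by blast
    then show "g = h" using gh by metis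
  qed
  assume x: "x \<in> Arr C" "Cod C x = Dom C f" "null (f \<cdot> x)"
  then have "f \<cdot> x = Zero C (Dom C x) (Cod C f)" "x \<in> Hom C (Dom C x) (Dom C f)"
    using k by (auto simp: null_def)
  then show "\<exists>u\<in>Arr C. Dom C u = Dom C x \<and> Cod C u = Dom C k \<and> k \<cdot> u = x"
    using assms unfolding is_kernel_def by (metis Hom_iff)
qed

lemma is_cokernelD:
  assumes "is_cokernel C f q"
  shows "f \<in> Arr C" "q \<in> Arr C" "Dom C q = Cod C f" "null (q \<cdot> f)" "epi_arr C q"
    and "x \<in> Arr C \<Longrightarrow> Dom C x = Cod C f \<Longrightarrow> null (x \<cdot> f) \<Longrightarrow>
      \<exists>u\<in>Arr C. Dom C u = Cod C q \<and> Cod C u = Cod C x \<and> u \<cdot> q = x"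
proof -
  show k: "f \<in> Arr C" "q \<in> Arr C" "Dom C q = Cod C f" "null (q \<cdot> f)"
    using assms by (auto simp: is_cokernel_def)
  show "epi_arr C q"
    unfolding epi_arr_def
  proof (intro conjI allI ballI impI k)
    fix W g h assume gh: "g \<in> Hom C (Cod C q) W" "h \<in> Hom C (Cod C q) W" "g \<cdot> q = h \<cdot> q"
    have "null (g \<cdot> (q \<cdot> f))" by (rule null_comp2) (use k gh in simp_all)
    then have "(g \<cdot> q) \<cdot> f = Zero C (Dom C f) W" "g \<cdot> q \<in> Hom C (Cod C f) W"
      using k gh by (auto simp: null_def)
    then have "\<exists>!u. u \<in> Hom C (Cod C q) W \<and> u \<cdot> q = g \<cdot> q"
      using assms unfolding is_cokernel_def by blast
    then show "g = h" using gh by metis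
  qed
  assume x: "x \<in> Arr C" "Dom C x = Cod C f" "null (x \<cdot> f)"
  then have "x \<cdot> f = Zero C (Dom C f) (Cod C x)" "x \<in> Hom C (Cod C f) (Cod C x)"
    using k by (auto simp: null_def)
  then show "\<exists>u\<in>Arr C. Dom C u = Cod C q \<and> Cod C u = Cod C x \<and> u \<cdot> q = x"
    using assms unfolding is_cokernel_def by (metis Hom_iff)
qed

lemma is_kernelI:
  assumes "f \<in> Arr C" "Cod C k = Dom C f" "null (f \<cdot> k)" "mono_arr C k"
    and ex: "\<And>x. x \<in> Arr C \<Longrightarrow> Cod C x = Dom C f \<Longrightarrow> null (f \<cdot> x) \<Longrightarrow>
      \<exists>u\<in>Arr C. Dom C u = Dom C x \<and> Cod C u = Dom C k \<and> k \<cdot> u = x"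
  shows "is_kernel C f k"
  unfolding is_kernel_def
proof (intro conjI allI ballI impI)
  show "k \<in> Arr C" using assms(4) by (rule mono_arrD)
  then show "f \<cdot> k = Zero C (Dom C k) (Cod C f)" using assms by (simp add: null_def)
  fix W x assume x: "x \<in> Hom C W (Dom C f)" "f \<cdot> x = Zero C W (Cod C f)"
  then obtain u where "u \<in> Arr C" "Dom C u = Dom C x" "Cod C u = Dom C k" "k \<cdot> u = x"
    using ex[of x] assms(1) by auto
  then show "\<exists>!u. u \<in> Hom C W (Dom C k) \<and> k \<cdot> u = x"
    using x mono_cancel[OF _ assms(4)] by (intro ex1I[of _ u]) auto
qed (use assms(1,2) in simp_all)

end

section \<open>Abelian categories\<close>

context abelian_category
begin

text \<open>The monomorphism \<open>a\<close> is the kernel of some \<open>g\<close>; this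
  \<open>g\<close> kills \<open>a\<close>, hence \<open>x\<close>. Testing against all arrows that
  kill \<open>a\<close> matches the definition of \<open>span\<close>.\<close>

lemma mono_factor:
  assumes a: "mono_arr C a" and x: "x \<in> Arr C" "Cod C x = Cod C a"
    and killed: "\<And>g. g \<in> Arr C \<Longrightarrow> Dom C g = Cod C a \<Longrightarrow> null (g \<cdot> a) \<Longrightarrow> null (g \<cdot> x)"
  obtains u where "u \<in> Arr C" "Dom C u = Dom C x" "Cod C u = Dom C a" "a \<cdot> u = x"
proof -
  obtain g where g: "is_kernel C g a" using mono_is_kernel[OF a] by blast
  then have "null (g \<cdot> x)" using killed[of g] is_kernelD(1,3,4)[OF g] by simp
  then show thesis using is_kernelD(6)[OF g, of x] is_kernelD(3)[OF g] x that by auto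
qed

lemma epi_factor:
  assumes e: "epi_arr C e" and h: "h \<in> Arr C" "Dom C h = Dom C e"
    and killed: "\<And>x. x \<in> Arr C \<Longrightarrow> Cod C x = Dom C e \<Longrightarrow> null (e \<cdot> x) \<Longrightarrow> null (h \<cdot> x)"
  obtains u where "u \<in> Arr C" "Dom C u = Cod C e" "Cod C u = Cod C h" "u \<cdot> e = h"
proof -
  obtain k where k: "is_cokernel C k e" using epi_is_cokernel[OF e] by blast
  then have "null (h \<cdot> k)" using killed[of k] is_cokernelD(1,3,4)[OF k] by simp
  then show thesis using is_cokernelD(6)[OF k, of h] is_cokernelD(3)[OF k] h that by auto
qed

text \<open>An arrow \<open>h\<close> that kills \<open>a\<close> factors through the cokernel
  \<open>q\<close>, so it kills whatever \<open>q\<close> kills.\<close>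

lemma cokernel_null_iff:
  assumes "is_cokernel C a q" "h \<in> Arr C" "Dom C h = Cod C a" "null (h \<cdot> a)"
    "x \<in> Arr C" "Cod C x = Cod C a" "null (q \<cdot> x)"
  shows "null (h \<cdot> x)"
proof -
  note q = is_cokernelD(1-4)[OF assms(1)]
  obtain u where u: "u \<in> Arr C" "Dom C u = Cod C q" "u \<cdot> q = h"
    using is_cokernelD(6)[OF assms(1), of h] assms by auto
  have "null (u \<cdot> (q \<cdot> x))" by (rule null_comp2) (use assms q u in simp_all)
  moreover have "u \<cdot> (q \<cdot> x) = h \<cdot> x" by (rule Comp_eq_Comp) (use assms q u in simp_all)
  ultimately show ?thesis by simp
qed

lemma mono_cokernel_factor:
  assumes "mono_arr C a" "is_cokernel C a q" "x \<in> Arr C" "Cod C x = Cod C a" "null (q \<cdot> x)"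
  obtains u where "u \<in> Arr C" "Dom C u = Dom C x" "Cod C u = Dom C a" "a \<cdot> u = x"
  using assms(1,3,4)
proof (rule mono_factor)
  fix g assume g: "g \<in> Arr C" "Dom C g = Cod C a" "null (g \<cdot> a)"
  show "null (g \<cdot> x)" by (rule cokernel_null_iff[OF assms(2) g assms(3-5)])
qed (blast intro: that)

lemma mono_kernel_of_cokernel:
  assumes "mono_arr C a" "is_cokernel C a q"
  shows "is_kernel C q a"
proof (rule is_kernelI)
  fix x assume "x \<in> Arr C" "Cod C x = Dom C q" "null (q \<cdot> x)"
  then show "\<exists>u\<in>Arr C. Dom C u = Dom C x \<and> Cod C u = Dom C a \<and> a \<cdot> u = x"
    using mono_cokernel_factor[OF assms, of x] is_cokernelD(3)[OF assms(2)] by metis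
qed (use assms is_cokernelD[OF assms(2)] in simp_all)

text \<open>The image \<open>m\<close> is the kernel of the cokernel of \<open>f\<close>; the point
  is that the remaining factor \<open>e\<close> is epic.\<close>

lemma mono_epi_factorization:
  assumes f: "f \<in> Arr C"
  obtains m e where "mono_arr C m" "epi_arr C e" "m \<in> Arr C" "e \<in> Arr C" "Dom C e = Dom C f"
    "Cod C m = Cod C f" "Dom C m = Cod C e" "m \<cdot> e = f"
proof -
  obtain q where q: "is_cokernel C f q" using ex_cokernel[OF f] by blast
  note q' = is_cokernelD(1-5)[OF q]
  obtain m where m: "is_kernel C q m" using ex_kernel q' by blast
  note m' = is_kernelD(1-5)[OF m]
  obtain e where e: "e \<in> Arr C" "Dom C e = Dom C f" "Cod C e = Dom C m" "m \<cdot> e = f"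
    using is_kernelD(6)[OF m, of f] q' by auto
  have "epi_arr C e"
    unfolding epi_arr_iff
  proof (intro conjI ballI impI e)
    fix t assume t: "t \<in> Arr C" "Dom C t = Cod C e" "null (t \<cdot> e)"
    obtain k where k: "is_kernel C t k" using ex_kernel t by blast
    note k' = is_kernelD(1-5)[OF k]
    obtain e' where e': "e' \<in> Arr C" "Dom C e' = Dom C e" "Cod C e' = Dom C k" "k \<cdot> e' = e"
      using is_kernelD(6)[OF k, of e] e t by auto
    \<comment> \<open>Since \<open>f\<close> factors through \<open>m \<cdot> k\<close>, an arrow
      killing \<open>m \<cdot> k\<close> kills \<open>f\<close> and hence \<open>m\<close>. So
      \<open>m\<close> factors through \<open>m \<cdot> k\<close>, which splits \<open>k\<close> and
      forces \<open>t\<close> to vanish.\<close>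
    have mk: "mono_arr C (m \<cdot> k)" by (rule mono_comp) (use k' m' t e in simp_all)
    obtain s where s: "s \<in> Arr C" "Dom C s = Dom C m" "Cod C s = Dom C k" "(m \<cdot> k) \<cdot> s = m"
    proof (rule mono_factor[OF mk])
      fix g assume g: "g \<in> Arr C" "Dom C g = Cod C (m \<cdot> k)" "null (g \<cdot> (m \<cdot> k))"
      have "m \<cdot> (k \<cdot> e') = f" using e e' by simp
      then have "g \<cdot> f = (g \<cdot> (m \<cdot> k)) \<cdot> e'" using g m' k' e' t e by simp
      then have "null (g \<cdot> f)" using g m' k' e' t e null_comp1[OF g(3), of e'] by simp
      then show "null (g \<cdot> m)"
        using cokernel_null_iff[OF q, of g m] g m' k' q' t e by simp
    qed (use m' k' t e in auto)
    have t': "Dom C t = Dom C m" "Cod C k = Dom C m" using t k' e by simp_all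
    have "m \<cdot> (k \<cdot> s) = (m \<cdot> k) \<cdot> s" using s(1-3) m'(2) k'(2) t' by simp
    also have "\<dots> = m \<cdot> Id C (Dom C m)" unfolding s(4) using m'(2) by simp
    finally have "m \<cdot> (k \<cdot> s) = m \<cdot> Id C (Dom C m)" .
    then have ks: "k \<cdot> s = Id C (Dom C m)"
      by (rule mono_cancel[OF _ m'(5)]) (use s(1-3) m'(2) k'(2) t' in simp_all)
    have "null (t \<cdot> (k \<cdot> s))" by (rule null_comp3) (use s(1-3) k' t t' in simp_all)
    then show "null t" using ks t t' by simp
  qed
  then show thesis using that[of m e] m' e q' by simp
qed

section \<open>Biproducts, pushouts of monomorphisms, pullbacks of epimorphisms\<close>

lemma biproduct:
  assumes "X \<in> Ob C" "Y \<in> Ob C"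
  obtains S i j p q where
    "i \<in> Arr C" "Dom C i = X" "Cod C i = S" "j \<in> Arr C" "Dom C j = Y" "Cod C j = S"
    "p \<in> Arr C" "Dom C p = S" "Cod C p = X" "q \<in> Arr C" "Dom C q = S" "Cod C q = Y"
    "p \<cdot> i = Id C X" "q \<cdot> j = Id C Y" "null (p \<cdot> j)" "null (q \<cdot> i)" "i \<cdot> p \<boxplus> j \<cdot> q = Id C S"
proof -
  obtain S where "is_biproduct C X Y S" using ex_biproduct[OF assms] by blast
  then show thesis unfolding is_biproduct_def using that assms by auto
qed

text \<open>The pushout is the cokernel \<open>c\<close> of the map \<open>d\<close> with components
  \<open>a\<close> and minus \<open>f\<close>. Projection to the first summand recovers
  \<open>a\<close>, so \<open>d\<close> is monic and is the kernel of \<open>c\<close>. If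
  \<open>c \<cdot> j\<close> kills \<open>x\<close>, then \<open>j \<cdot> x = d \<cdot> z\<close>,
  and the first component gives that \<open>a \<cdot> z\<close>, hence \<open>z\<close>, is
  zero.\<close>

lemma pushout_mono:
  assumes a: "mono_arr C a" and f: "f \<in> Arr C" "Dom C f = Dom C a"
  obtains b w where "mono_arr C b" "b \<in> Arr C" "w \<in> Arr C" "Dom C b = Cod C f" "Dom C w = Cod C a"
    "Cod C w = Cod C b" "w \<cdot> a = b \<cdot> f"
proof -
  note a' = mono_arrD[OF a]
  obtain S i j p q where b:
    "i \<in> Arr C" "Dom C i = Cod C a" "Cod C i = S" "j \<in> Arr C" "Dom C j = Cod C f" "Cod C j = S"
    "p \<in> Arr C" "Dom C p = S" "Cod C p = Cod C a" "q \<in> Arr C" "Dom C q = S" "Cod C q = Cod C f"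
    "p \<cdot> i = Id C (Cod C a)" "q \<cdot> j = Id C (Cod C f)" "null (p \<cdot> j)" "null (q \<cdot> i)"
    by (rule biproduct[of "Cod C a" "Cod C f"]) (use a' f in auto)
  define d where "d = Sub (i \<cdot> a) (j \<cdot> f)"
  have d: "d \<in> Arr C" "Dom C d = Dom C a" "Cod C d = S" using a' f b by (simp_all add: d_def)
  have "p \<cdot> d = Sub (p \<cdot> (i \<cdot> a)) (p \<cdot> (j \<cdot> f))" using a' f b by (simp add: d_def Sub_comp)
  also have "p \<cdot> (i \<cdot> a) = a" using a' f b Comp_eq_Comp[of p i "Id C (Cod C a)" a] by simp
  also have "Sub a (p \<cdot> (j \<cdot> f)) = a" using a' f b by (simp add: Sub_null2)
  finally have pd: "p \<cdot> d = a" .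
  have dm: "mono_arr C d" by (rule mono_comp_right[of p]) (use pd a d b in simp_all)
  obtain c where c: "is_cokernel C d c" using ex_cokernel d by blast
  note c' = is_cokernelD(1-5)[OF c]
  have "null (Sub (c \<cdot> (i \<cdot> a)) (c \<cdot> (j \<cdot> f)))"
    using c' d b a' f by (simp add: d_def Sub_comp)
  then have comm: "(c \<cdot> i) \<cdot> a = (c \<cdot> j) \<cdot> f" using c' d b a' f by simp
  have "mono_arr C (c \<cdot> j)"
    unfolding mono_arr_iff
  proof (intro conjI ballI impI)
    fix x assume x: "x \<in> Arr C" "Cod C x = Dom C (c \<cdot> j)" "null ((c \<cdot> j) \<cdot> x)"
    then have x': "Cod C x = Cod C f" "null (c \<cdot> (j \<cdot> x))" using c' d b by auto
    obtain z where z: "z \<in> Arr C" "Dom C z = Dom C x" "Cod C z = Dom C d" "d \<cdot> z = j \<cdot> x"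
      by (rule mono_cokernel_factor[OF dm c, of "j \<cdot> x"]) (use x x' d b in auto)
    have "p \<cdot> (d \<cdot> z) = a \<cdot> z" by (rule Comp_eq_Comp[OF pd]) (use z d b in simp_all)
    then have "a \<cdot> z = p \<cdot> (j \<cdot> x)" using z by simp
    then have "null (a \<cdot> z)" using x x' b by simp
    then have "null z" using mono_null_iff[OF a] z d by simp
    then have "null (j \<cdot> x)" using z d by (metis null_comp2)
    moreover have "q \<cdot> (j \<cdot> x) = x" using x x' b Comp_eq_Comp[of q j "Id C (Cod C f)" x] by simp
    ultimately show "null x" using null_comp2[of "j \<cdot> x" q] x x' b by simp
  qed (use c' d b in simp)
  then show thesis using that[of "c \<cdot> j" "c \<cdot> i"] comm c' d b by simp
qed

text \<open>Dual to the pushout: \<open>d\<close> is epic because \<open>d \<cdot> i = e\<close>, so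
  an arrow \<open>t \<cdot> q\<close> that kills its kernel factors as \<open>s \<cdot> d\<close>,
  and restricting to the first summand shows that \<open>s\<close> vanishes. This replaces the
  choice of preimages under \<open>e\<close>.\<close>

lemma pullback_epi:
  assumes e: "epi_arr C e" and x: "x \<in> Arr C" "Cod C x = Cod C e"
  obtains r v where "epi_arr C r" "r \<in> Arr C" "v \<in> Arr C" "Cod C r = Dom C x" "Cod C v = Dom C e"
    "Dom C v = Dom C r" "e \<cdot> v = x \<cdot> r"
proof -
  note e' = epi_arrD[OF e]
  obtain S i j p q where b:
    "i \<in> Arr C" "Dom C i = Dom C e" "Cod C i = S" "j \<in> Arr C" "Dom C j = Dom C x" "Cod C j = S"
    "p \<in> Arr C" "Dom C p = S" "Cod C p = Dom C e" "q \<in> Arr C" "Dom C q = S" "Cod C q = Dom C x"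
    "p \<cdot> i = Id C (Dom C e)" "q \<cdot> j = Id C (Dom C x)" "null (p \<cdot> j)" "null (q \<cdot> i)"
    by (rule biproduct[of "Dom C e" "Dom C x"]) (use e' x in auto)
  define d where "d = Sub (e \<cdot> p) (x \<cdot> q)"
  have d: "d \<in> Arr C" "Cod C d = Cod C e" "Dom C d = S" using e' x b by (simp_all add: d_def)
  have "d \<cdot> i = Sub (e \<cdot> (p \<cdot> i)) (x \<cdot> (q \<cdot> i))" using e' x b by (simp add: d_def Sub_comp)
  also have "\<dots> = e" using e' x b by (simp add: Sub_null2)
  finally have di: "d \<cdot> i = e" .
  have de: "epi_arr C d" by (rule epi_comp_left[of d i]) (use di e d b in simp_all)
  obtain k where k: "is_kernel C d k" using ex_kernel d by blast
  note k' = is_kernelD(1-5)[OF k]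
  have "null (Sub (e \<cdot> (p \<cdot> k)) (x \<cdot> (q \<cdot> k)))"
    using k' d b e' x by (simp add: d_def Sub_comp)
  then have comm: "e \<cdot> (p \<cdot> k) = x \<cdot> (q \<cdot> k)" using k' d b e' x by simp
  have "epi_arr C (q \<cdot> k)"
    unfolding epi_arr_iff
  proof (intro conjI ballI impI)
    fix t assume t: "t \<in> Arr C" "Dom C t = Cod C (q \<cdot> k)" "null (t \<cdot> (q \<cdot> k))"
    then have t': "Dom C t = Dom C x" using k' d b by simp
    obtain s where s: "s \<in> Arr C" "Dom C s = Cod C d" "Cod C s = Cod C (t \<cdot> q)" "s \<cdot> d = t \<cdot> q"
    proof (rule epi_factor[OF de, of "t \<cdot> q"])
      fix y assume y: "y \<in> Arr C" "Cod C y = Dom C d" "null (d \<cdot> y)"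
      then obtain u where u: "u \<in> Arr C" "Dom C u = Dom C y" "Cod C u = Dom C k" "k \<cdot> u = y"
        using is_kernelD(6)[OF k, of y] by auto
      have "null ((t \<cdot> (q \<cdot> k)) \<cdot> u)" by (rule null_comp1) (use t t' b k' d u in simp_all)
      then show "null ((t \<cdot> q) \<cdot> y)" using t t' b k' d u y by simp
    qed (use t t' b d in auto)
    have "s \<cdot> e = s \<cdot> (d \<cdot> i)" using di by simp
    also have "\<dots> = (t \<cdot> q) \<cdot> i" by (rule Comp_eq_Comp[OF s(4)]) (use s d b in simp_all)
    finally have "s \<cdot> e = (t \<cdot> q) \<cdot> i" .
    then have "null (s \<cdot> e)" using t t' b by simp
    then have "null s" using epi_null_iff[OF e] s d by simp
    then have "null (t \<cdot> q)" using s d by (metis null_comp1)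
    then have "null (t \<cdot> (q \<cdot> j))" by (rule null_comp3) (use t(1) t' b in simp_all)
    then show "null t" using t(1) t' b by simp
  qed (use k' d b in simp)
  then show thesis using that[of "q \<cdot> k" "p \<cdot> k"] comm k' d b by simp
qed

text \<open>The arrows factoring through the sum of the images of \<open>R\<close>. Subobjects of \<open>M\<close> are treated as sets of this
  form, ordered by inclusion.\<close>

definition span :: "'o \<Rightarrow> 'm set \<Rightarrow> 'm set" where
  "span M R = {x \<in> Arr C. Cod C x = M \<and>
     (\<forall>g\<in>Arr C. Dom C g = M \<longrightarrow> (\<forall>r\<in>R. null (g \<cdot> r)) \<longrightarrow> null (g \<cdot> x))}"

lemma span_arr: "x \<in> span M R \<Longrightarrow> x \<in> Arr C" "x \<in> span M R \<Longrightarrow> Cod C x = M"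
  by (simp_all add: span_def)

lemma spanI:
  assumes "x \<in> Arr C" "Cod C x = M"
    and "\<And>g. g \<in> Arr C \<Longrightarrow> Dom C g = M \<Longrightarrow> (\<And>r. r \<in> R \<Longrightarrow> null (g \<cdot> r)) \<Longrightarrow> null (g \<cdot> x)"
  shows "x \<in> span M R"
  using assms by (simp add: span_def)

lemma spanD:
  assumes "x \<in> span M R" "g \<in> Arr C" "Dom C g = M" "\<And>r. r \<in> R \<Longrightarrow> null (g \<cdot> r)"
  shows "null (g \<cdot> x)"
  using assms by (simp add: span_def)

lemma span_superset: "r \<in> R \<Longrightarrow> r \<in> Arr C \<Longrightarrow> Cod C r = M \<Longrightarrow> r \<in> span M R"
  by (simp add: span_def)

lemma span_subset:
  assumes "\<And>r. r \<in> R \<Longrightarrow> r \<in> span M R'"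
  shows "span M R \<subseteq> span M R'"
proof
  fix x assume x: "x \<in> span M R"
  show "x \<in> span M R'"
    by (rule spanI) (use x assms spanD span_arr in \<open>blast+\<close>)
qed

lemma span_mono: "R \<subseteq> R' \<Longrightarrow> span M R \<subseteq> span M R'"
  by (auto simp: span_def)

lemma span_comp:
  assumes "x \<in> span M R" "z \<in> Arr C" "Cod C z = Dom C x" "\<And>r. r \<in> R \<Longrightarrow> Cod C r = M"
  shows "x \<cdot> z \<in> span M R"
proof (rule spanI)
  note x = span_arr[OF assms(1)]
  fix g assume g: "g \<in> Arr C" "Dom C g = M" "\<And>r. r \<in> R \<Longrightarrow> null (g \<cdot> r)"
  have "null (g \<cdot> x)" by (rule spanD[OF assms(1) g])
  then show "null (g \<cdot> (x \<cdot> z))" by (rule null_comp3) (use x g assms in simp_all)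
qed (use assms span_arr[OF assms(1)] in simp_all)

lemma span_mono_factor:
  assumes "x \<in> span (Cod C a) {a}" "mono_arr C a"
  obtains u where "u \<in> Arr C" "Dom C u = Dom C x" "Cod C u = Dom C a" "a \<cdot> u = x"
  using assms(2)
proof (rule mono_factor)
  fix g assume g: "g \<in> Arr C" "Dom C g = Cod C a" "null (g \<cdot> a)"
  show "null (g \<cdot> x)" by (rule spanD[OF assms(1)]) (use g in auto)
qed (use that assms span_arr[OF assms(1)] in auto)

text \<open>Factor \<open>x\<close> through the image of \<open>y\<close> and pull back the epic
  part of \<open>y\<close>.\<close>

lemma span_factor_epi:
  assumes "x \<in> span (Cod C y) {y}" "y \<in> Arr C"
  obtains r v where "epi_arr C r" "r \<in> Arr C" "v \<in> Arr C" "Cod C r = Dom C x" "Cod C v = Dom C y"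
    "Dom C v = Dom C r" "y \<cdot> v = x \<cdot> r"
proof -
  note x = span_arr[OF assms(1)]
  obtain m e where me: "mono_arr C m" "epi_arr C e" "m \<in> Arr C" "e \<in> Arr C" "Dom C e = Dom C y"
    "Cod C m = Cod C y" "Dom C m = Cod C e" "m \<cdot> e = y"
    using mono_epi_factorization[OF assms(2)] .
  obtain u where u: "u \<in> Arr C" "Dom C u = Dom C x" "Cod C u = Dom C m" "m \<cdot> u = x"
    using me(1)
  proof (rule mono_factor)
    fix g assume g: "g \<in> Arr C" "Dom C g = Cod C m" "null (g \<cdot> m)"
    then have "null (g \<cdot> (m \<cdot> e))" using me(3-7) by simp
    then have "null (g \<cdot> y)" using me by simp
    then show "null (g \<cdot> x)" using spanD[OF assms(1), of g] g me by auto
  qed (use x me in auto)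
  obtain r v where rv: "epi_arr C r" "r \<in> Arr C" "v \<in> Arr C" "Cod C r = Dom C u" "Cod C v = Dom C e"
    "Dom C v = Dom C r" "e \<cdot> v = u \<cdot> r"
    by (rule pullback_epi[OF me(2), of u]) (use u me in auto)
  have "y \<cdot> v = m \<cdot> (e \<cdot> v)" using me rv by auto
  also have "\<dots> = m \<cdot> (u \<cdot> r)" using rv by simp
  also have "\<dots> = x \<cdot> r" using Comp_eq_Comp[OF u(4), of r] u me rv by simp
  finally show thesis using that[of r v] rv u me by simp
qed

text \<open>\<open>y\<close> is the map out of the biproduct with components \<open>a\<close> and
  \<open>b\<close>; an arrow killing \<open>y\<close> kills both, so the case of one arrow
  applies.\<close>

lemma span_pair_factor_epi:
  assumes x: "x \<in> span M {a, b}" and ab: "a \<in> Arr C" "b \<in> Arr C" "Cod C a = M" "Cod C b = M"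
  obtains r v w where "epi_arr C r" "r \<in> Arr C" "v \<in> Arr C" "w \<in> Arr C" "Cod C r = Dom C x"
    "Dom C v = Dom C r" "Dom C w = Dom C r" "Cod C v = Dom C a" "Cod C w = Dom C b"
    "x \<cdot> r = a \<cdot> v \<boxplus> b \<cdot> w"
proof -
  obtain S i j p q where s:
    "i \<in> Arr C" "Dom C i = Dom C a" "Cod C i = S" "j \<in> Arr C" "Dom C j = Dom C b" "Cod C j = S"
    "p \<in> Arr C" "Dom C p = S" "Cod C p = Dom C a" "q \<in> Arr C" "Dom C q = S" "Cod C q = Dom C b"
    "p \<cdot> i = Id C (Dom C a)" "q \<cdot> j = Id C (Dom C b)" "null (p \<cdot> j)" "null (q \<cdot> i)"
    by (rule biproduct[of "Dom C a" "Dom C b"]) (use ab in auto)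
  define y where "y = a \<cdot> p \<boxplus> b \<cdot> q"
  have y: "y \<in> Arr C" "Dom C y = S" "Cod C y = M" using s ab by (simp_all add: y_def)
  have add: "y \<cdot> z = a \<cdot> (p \<cdot> z) \<boxplus> b \<cdot> (q \<cdot> z)" if "z \<in> Arr C" "Cod C z = S" for z
    unfolding y_def using that s ab Comp_Add[of z "Dom C z" S "a \<cdot> p" M "b \<cdot> q"] by simp
  have yi: "y \<cdot> i = a" "y \<cdot> j = b" using s ab by (simp_all add: add Add_null)
  have "x \<in> span (Cod C y) {y}"
  proof (rule spanI)
    fix g assume g: "g \<in> Arr C" "Dom C g = Cod C y" "\<And>r. r \<in> {y} \<Longrightarrow> null (g \<cdot> r)"
    then have "null (g \<cdot> (y \<cdot> i))" "null (g \<cdot> (y \<cdot> j))"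
      using g y s by auto
    then have "null (g \<cdot> a)" "null (g \<cdot> b)" by (simp_all add: yi)
    then show "null (g \<cdot> x)" using spanD[OF x, of g] g y by auto
  qed (use span_arr[OF x] y in auto)
  then obtain r v where rv: "epi_arr C r" "r \<in> Arr C" "v \<in> Arr C" "Cod C r = Dom C x" "Cod C v = Dom C y"
    "Dom C v = Dom C r" "y \<cdot> v = x \<cdot> r"
    by (rule span_factor_epi) (use y in auto)
  show thesis using that[of r "p \<cdot> v" "q \<cdot> v"] add[of v] rv y s by simp
qed

text \<open>\<open>q\<close> vanishes wherever \<open>c \<cdot> q\<close> does, so it factors as
  \<open>s \<cdot> (c \<cdot> q)\<close>; cancelling \<open>q\<close> makes \<open>s\<close> a left
  inverse of \<open>c\<close>.\<close>

lemma cokernel_comp_mono: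
  assumes q: "epi_arr C q" and c: "epi_arr C c" "Dom C c = Cod C q"
    and ker: "\<And>x. x \<in> Arr C \<Longrightarrow> Cod C x = Dom C q \<Longrightarrow> null (c \<cdot> (q \<cdot> x)) \<Longrightarrow> null (q \<cdot> x)"
  shows "mono_arr C c"
proof -
  note a = epi_arrD[OF q] epi_arrD[OF c(1)] c(2)
  obtain s where s: "s \<in> Arr C" "Dom C s = Cod C (c \<cdot> q)" "Cod C s = Cod C q" "s \<cdot> (c \<cdot> q) = q"
    by (rule epi_factor[OF epi_comp[OF q c], of q]) (use a ker in auto)
  have "(s \<cdot> c) \<cdot> q = Id C (Cod C q) \<cdot> q" using s a by simp
  then have sc: "s \<cdot> c = Id C (Cod C q)"
    by (rule epi_cancel[OF _ q]) (use s a in simp_all)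
  show ?thesis by (rule mono_comp_right[of s]) (use s a sc in simp_all)
qed

text \<open>Extend \<open>g\<close> over the pushout of \<open>g k\<close> along the monomorphism \<open>\<rho> k\<close>, and use \<open>b g - w \<rho>\<close>, which kills \<open>k\<close>.\<close>

lemma span_insert_null:
  assumes y: "y \<in> span M (insert k R)" and k: "k \<in> Arr C" "Cod C k = M"
    and \<rho>: "\<rho> \<in> Arr C" "Dom C \<rho> = M" "\<And>r. r \<in> R \<Longrightarrow> null (\<rho> \<cdot> r)" "mono_arr C (\<rho> \<cdot> k)" "null (\<rho> \<cdot> y)"
    and R: "\<And>r. r \<in> R \<Longrightarrow> r \<in> Arr C" "\<And>r. r \<in> R \<Longrightarrow> Cod C r = M"
  shows "y \<in> span M R"
proof (rule spanI)
  note y' = span_arr[OF y]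
  fix g assume g: "g \<in> Arr C" "Dom C g = M" "\<And>r. r \<in> R \<Longrightarrow> null (g \<cdot> r)"
  obtain b w where bw: "mono_arr C b" "b \<in> Arr C" "w \<in> Arr C" "Dom C b = Cod C (g \<cdot> k)"
    "Dom C w = Cod C (\<rho> \<cdot> k)" "Cod C w = Cod C b" "w \<cdot> (\<rho> \<cdot> k) = b \<cdot> (g \<cdot> k)"
    by (rule pushout_mono[OF \<rho>(4), of "g \<cdot> k"]) (use g k \<rho> in auto)
  have bw': "Dom C b = Cod C g" "Dom C w = Cod C \<rho>" using bw g k \<rho> by simp_all
  have comp: "Sub (b \<cdot> g) (w \<cdot> \<rho>) \<cdot> z = Sub (b \<cdot> (g \<cdot> z)) (w \<cdot> (\<rho> \<cdot> z))" if "z \<in> Arr C" "Cod C z = M" for z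
    using that bw(2,3,6) bw' g \<rho> by (simp add: Sub_comp)
  have "null (Sub (b \<cdot> g) (w \<cdot> \<rho>) \<cdot> y)"
  proof (rule spanD[OF y])
    fix r assume "r \<in> insert k R"
    then show "null (Sub (b \<cdot> g) (w \<cdot> \<rho>) \<cdot> r)"
    proof
      assume "r = k"
      then show ?thesis using bw(2,3,6,7) bw' g \<rho>(1,2) k by (simp add: comp)
    next
      assume r: "r \<in> R"
      then have "null (b \<cdot> (g \<cdot> r))" "null (w \<cdot> (\<rho> \<cdot> r))"
        using g \<rho> bw(2,3) bw' R by auto
      then show ?thesis using r bw(2,3,6) bw' g(1,2) \<rho>(1,2) R null_eq by (simp add: comp Sub_null2)
    qed
  qed (use bw(2,3,6) bw' g \<rho> in simp_all)
  then have "b \<cdot> (g \<cdot> y) = w \<cdot> (\<rho> \<cdot> y)"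
    using y' bw(2,3,6) bw' g(1,2) \<rho>(1,2) by (simp add: comp)
  then have "null (b \<cdot> (g \<cdot> y))" using y' bw(2,3,6) bw' g(1,2) \<rho>(1,2,5) by simp
  then show "null (g \<cdot> y)" using mono_null_iff[OF bw(1), of "g \<cdot> y"] y' bw' g(1,2) by simp
qed (use span_arr[OF y] in auto)

end

section \<open>Small sets\<close>

lemma small_subset: "A \<subseteq> B \<Longrightarrow> small \<kappa> B \<Longrightarrow> small \<kappa> A"
  unfolding small_def by (rule ordLeq_ordLess_trans[OF card_of_mono1])

lemma small_image: "small \<kappa> A \<Longrightarrow> small \<kappa> (f ` A)"
  unfolding small_def by (rule ordLeq_ordLess_trans[OF card_of_image])

lemma infinite_Field_inaccessible: "inaccessible \<kappa> \<Longrightarrow> infinite (Field \<kappa>)"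
  unfolding inaccessible_def
  by (meson card_of_Field_ordIso finite_iff_ordLess_natLeq not_ordLess_ordLeq ordIso_iff_ordLeq
      ordLess_imp_ordLeq ordLess_ordLeq_trans ordLeq_ordLess_trans)

text \<open>Moves index sets of any type into \<open>'u\<close>, the only type for which coproducts
  and exact direct limits are assumed.\<close>

lemma small_inj:
  assumes "inaccessible (\<kappa> :: 'u rel)" "small \<kappa> A"
  obtains f :: "'a \<Rightarrow> 'u" where "inj_on f A"
proof -
  have "|A| \<le>o |Field \<kappa>|"
    using assms unfolding inaccessible_def small_def
    by (meson card_of_Field_ordIso ordIso_symmetric ordLess_imp_ordLeq ordLess_ordIso_trans)
  then show thesis using that card_of_ordLeq[of A "Field \<kappa>"] by blast
qed

text \<open>\<open>inaccessible\<close> speaks only of subsets of \<open>'u\<close>, so the power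
  set is formed after an injection and pulled back by preimages.\<close>

lemma small_Pow:
  assumes "inaccessible (\<kappa> :: 'u rel)" "small \<kappa> (A :: 'a set)"
  shows "small \<kappa> (Pow A)"
proof -
  obtain f :: "'a \<Rightarrow> 'u" where f: "inj_on f A" using small_inj[OF assms] .
  have "small \<kappa> (Pow (f ` A))"
    using assms(1) small_image[OF assms(2), of f] by (simp add: inaccessible_def small_def)
  then have "small \<kappa> ((\<lambda>S. A \<inter> f -` S) ` Pow (f ` A))" by (rule small_image)
  moreover have "Pow A \<subseteq> (\<lambda>S. A \<inter> f -` S) ` Pow (f ` A)"
  proof
    fix B assume B: "B \<in> Pow A"
    then have "B = A \<inter> f -` (f ` B)" using f by (auto simp: inj_on_def)
    then show "B \<in> (\<lambda>S. A \<inter> f -` S) ` Pow (f ` A)" using B by blast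
  qed
  ultimately show ?thesis by (rule small_subset[rotated])
qed

lemma small_finite: "inaccessible \<kappa> \<Longrightarrow> finite A \<Longrightarrow> small \<kappa> A"
  unfolding small_def inaccessible_def using finite_iff_ordLess_natLeq ordLess_transitive by blast

lemma small_Times:
  assumes "inaccessible \<kappa>" "small \<kappa> A" "small \<kappa> B"
  shows "small \<kappa> (A \<times> B)"
proof (cases "finite A \<and> finite B")
  case True
  then show ?thesis using small_finite[OF assms(1), of "A \<times> B"] by simp
next
  case False
  have *: "|A \<times> B| \<le>o |A| \<or> |A \<times> B| \<le>o |B|"
  proof (cases "A = {} \<or> B = {}")
    case True
    then have "A \<times> B = {}" by auto
    then show ?thesis using card_of_empty by metis
  next
    case ne: False
    show ?thesis
    proof (cases "|A| \<le>o |B|")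
      case True
      then have "infinite B" using False card_of_ordLeq_finite by blast
      then show ?thesis using card_of_Times_infinite[of B A] ne True ordIso_imp_ordLeq by blast
    next
      case nle: False
      then have "|B| \<le>o |A|" using ordLeq_total[OF card_of_Well_order card_of_Well_order, of A B] by blast
      moreover then have "infinite A" using False card_of_ordLeq_finite by blast
      ultimately show ?thesis using card_of_Times_infinite[of A B] ne ordIso_imp_ordLeq by blast
    qed
  qed
  then show ?thesis using assms(2,3) unfolding small_def by (blast intro: ordLeq_ordLess_trans)
qed

lemma small_Un:
  assumes "inaccessible \<kappa>" "small \<kappa> A" "small \<kappa> B"
  shows "small \<kappa> (A \<union> B)"
  using assms card_of_Un_ordLess_infinite_Field[of \<kappa> A B] infinite_Field_inaccessible[of \<kappa>]
  by (simp add: small_def inaccessible_def)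

lemma small_nat: "inaccessible \<kappa> \<Longrightarrow> small \<kappa> (A :: nat set)"
proof -
  assume "inaccessible \<kappa>"
  then have "small \<kappa> (UNIV :: nat set)"
    unfolding small_def inaccessible_def using card_of_nat ordIso_ordLess_trans by blast
  then show ?thesis by (rule small_subset[rotated]) simp
qed

section \<open>Direct limits in a Grothendieck category\<close>

context category
begin

lemma coproductD:
  assumes "is_coproduct C I X S \<iota>"
  shows "S \<in> Ob C"
    and "i \<in> I \<Longrightarrow> \<iota> i \<in> Arr C" "i \<in> I \<Longrightarrow> Dom C (\<iota> i) = X i" "i \<in> I \<Longrightarrow> Cod C (\<iota> i) = S"
  using assms by (auto simp: is_coproduct_def)

lemma coproduct_ex1:
  assumes "is_coproduct C I X S \<iota>" "Y \<in> Ob C" "\<forall>i\<in>I. f i \<in> Hom C (X i) Y"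
  shows "\<exists>!h. h \<in> Hom C S Y \<and> (\<forall>i\<in>I. h \<cdot> \<iota> i = f i)"
proof -
  have "\<forall>Y\<in>Ob C. \<forall>f. (\<forall>i\<in>I. f i \<in> Hom C (X i) Y) \<longrightarrow>
      (\<exists>!h. h \<in> Hom C S Y \<and> (\<forall>i\<in>I. h \<cdot> \<iota> i = f i))"
    using assms(1) unfolding is_coproduct_def by (elim conjE)
  from bspec[OF this assms(2)] show ?thesis using assms(3) by (elim allE impE)
qed

lemma coproduct_map:
  assumes "is_coproduct C I X S \<iota>" "Y \<in> Ob C"
    "\<And>i. i \<in> I \<Longrightarrow> f i \<in> Arr C \<and> Dom C (f i) = X i \<and> Cod C (f i) = Y"
  obtains h where "h \<in> Arr C" "Dom C h = S" "Cod C h = Y" "\<And>i. i \<in> I \<Longrightarrow> h \<cdot> \<iota> i = f i"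
proof -
  have "\<exists>!h. h \<in> Hom C S Y \<and> (\<forall>i\<in>I. h \<cdot> \<iota> i = f i)"
    by (rule coproduct_ex1[OF assms(1,2)]) (use assms(3) in auto)
  then show thesis using that by auto
qed

end

lemma (in preadditive_category) coproduct_null:
  assumes S: "is_coproduct C I X S \<iota>" and h: "h \<in> Arr C" "Dom C h = S"
    "\<And>i. i \<in> I \<Longrightarrow> null (h \<cdot> \<iota> i)"
  shows "null h"
proof -
  let ?f = "\<lambda>i. h \<cdot> \<iota> i"
  have "\<exists>!g. g \<in> Hom C S (Cod C h) \<and> (\<forall>i\<in>I. g \<cdot> \<iota> i = ?f i)"
    by (rule coproduct_ex1[OF S]) (use h coproductD[OF S] in auto)
  moreover have "h \<in> Hom C S (Cod C h) \<and> (\<forall>i\<in>I. h \<cdot> \<iota> i = ?f i)" using h by simp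
  moreover have "Zero C S (Cod C h) \<in> Hom C S (Cod C h) \<and> (\<forall>i\<in>I. Zero C S (Cod C h) \<cdot> \<iota> i = ?f i)"
  proof -
    have "Zero C S (Cod C h) \<cdot> \<iota> i = ?f i" if i: "i \<in> I" for i
      using h(1,2) h(3)[OF i] coproductD(2,4)[OF S i] coproductD(1)[OF S]
      by (intro null_eq) simp_all
    then show ?thesis using h coproductD(1)[OF S] by simp
  qed
  ultimately have "h = Zero C S (Cod C h)" by blast
  then show ?thesis using h by (simp add: null_def)
qed

text \<open>The Grothendieck axioms leave \<open>\<kappa>\<close> arbitrary; inaccessibility gives
  closure of smallness under power sets and finite products and the transport of index sets.\<close>

locale accessible_grothendieck_category = grothendieck_category \<kappa> C
  for \<kappa> :: "'u rel" and C :: "('o, 'm) precat" (structure) +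
  assumes inaccessible: "inaccessible \<kappa>"
begin

lemma small_coproduct:
  assumes A: "small \<kappa> A" and X: "\<And>a. a \<in> A \<Longrightarrow> X a \<in> Ob C"
  obtains S \<iota> where "is_coproduct C A X S \<iota>"
proof -
  obtain f :: "'a \<Rightarrow> 'u" where f: "inj_on f A" using small_inj[OF inaccessible A] .
  let ?g = "inv_into A f"
  obtain S \<iota> where S: "is_coproduct C (f ` A) (X \<circ> ?g) S \<iota>"
    using ex_coproduct[of "f ` A" "X \<circ> ?g"] small_image[OF A, of f] X f by (auto simp: inv_into_f_f)
  have "is_coproduct C A X S (\<iota> \<circ> f)"
    unfolding is_coproduct_def
  proof (intro conjI ballI allI impI)
    show "S \<in> Ob C" using coproductD[OF S] by simp
    show "(\<iota> \<circ> f) a \<in> Hom C (X a) S" if "a \<in> A" for a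
      using coproductD[OF S] that f by (simp add: inv_into_f_f)
    fix Y h assume Y: "Y \<in> Ob C" "\<forall>a\<in>A. h a \<in> Hom C (X a) Y"
    then have "\<forall>i\<in>f ` A. (h \<circ> ?g) i \<in> Hom C ((X \<circ> ?g) i) Y" using f by (auto simp: inv_into_f_f)
    then have "\<exists>!k. k \<in> Hom C S Y \<and> (\<forall>i\<in>f ` A. k \<cdot> \<iota> i = (h \<circ> ?g) i)"
      by (rule coproduct_ex1[OF S Y(1)])
    then show "\<exists>!k. k \<in> Hom C S Y \<and> (\<forall>a\<in>A. k \<cdot> (\<iota> \<circ> f) a = h a)"
      using f by (simp add: inv_into_f_f)
  qed
  then show thesis by (rule that)
qed

lemma generator_null:
  assumes "generating C \<G>" "f \<in> Arr C"
    and *: "\<And>G h. G \<in> \<G> \<Longrightarrow> h \<in> Arr C \<Longrightarrow> Dom C h = G \<Longrightarrow> Cod C h = Dom C f \<Longrightarrow> null (f \<cdot> h)"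
  shows "null f"
proof (rule ccontr)
  let ?z = "Zero C (Dom C f) (Cod C f)"
  assume "\<not> null f"
  then have "f \<noteq> ?z" "f \<in> Hom C (Dom C f) (Cod C f)" "?z \<in> Hom C (Dom C f) (Cod C f)"
    using assms by (auto simp: null_def)
  then obtain G h where h: "G \<in> \<G>" "h \<in> Hom C G (Dom C f)" "f \<cdot> h \<noteq> ?z \<cdot> h"
    using assms(1) unfolding generating_def by blast
  then have "f \<cdot> h \<noteq> Zero C (Dom C h) (Cod C f)" using assms(2) by auto
  moreover have "null (f \<cdot> h)" using *[of G h] h by simp
  ultimately show False using h assms(2) by (simp add: null_def)
qed

text \<open>The family \<open>R\<close> may be too large for a coproduct. Composing its members with
  arrows from a generator \<open>G\<close> gives \<open>T\<close>, which is small because it lies in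
  \<open>Hom C G M\<close> and is killed by the same arrows. \<open>q\<close> is the cokernel of the
  induced map from copies of \<open>G\<close> indexed by \<open>T\<close>.\<close>

lemma joint_cokernel:
  assumes M: "M \<in> Ob C" and R: "\<And>r. r \<in> R \<Longrightarrow> r \<in> Arr C" "\<And>r. r \<in> R \<Longrightarrow> Cod C r = M"
  obtains q where "epi_arr C q" "q \<in> Arr C" "Dom C q = M"
    "\<And>x. x \<in> Arr C \<Longrightarrow> Cod C x = M \<Longrightarrow> null (q \<cdot> x) \<longleftrightarrow> x \<in> span M R"
proof -
  obtain G where G: "generating C {G}" using ex_generator by blast
  then have GOb: "G \<in> Ob C" by (simp add: generating_def)
  define T where "T = {r \<cdot> h |r h. r \<in> R \<and> h \<in> Hom C G (Dom C r)}"
  have T: "t \<in> Hom C G M" if "t \<in> T" for t using that R by (auto simp: T_def)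
  then have "small \<kappa> T" using small_subset[OF _ locally_small[OF GOb M]] by blast
  then obtain S \<iota> where S: "is_coproduct C T (\<lambda>_. G) S \<iota>" using small_coproduct GOb by metis
  obtain c where c: "c \<in> Arr C" "Dom C c = S" "Cod C c = M" "\<And>t. t \<in> T \<Longrightarrow> c \<cdot> \<iota> t = t"
    by (rule coproduct_map[OF S M, of "\<lambda>t. t"]) (use T in auto)
  obtain q where q: "is_cokernel C c q" using ex_cokernel c by blast
  note q' = is_cokernelD(1-5)[OF q]
  have kill: "null (g \<cdot> c) \<longleftrightarrow> (\<forall>r\<in>R. null (g \<cdot> r))" if g: "g \<in> Arr C" "Dom C g = M" for g
  proof
    assume gc: "null (g \<cdot> c)"
    show "\<forall>r\<in>R. null (g \<cdot> r)"
    proof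
      fix r assume r: "r \<in> R"
      show "null (g \<cdot> r)"
        using G
      proof (rule generator_null)
        fix G' h assume h: "G' \<in> {G}" "h \<in> Arr C" "Dom C h = G'" "Cod C h = Dom C (g \<cdot> r)"
        then have t: "r \<cdot> h \<in> T" unfolding T_def using r R g by auto
        have "null (g \<cdot> (c \<cdot> \<iota> (r \<cdot> h)))"
          by (rule null_comp3) (use gc c g coproductD[OF S] t in simp_all)
        then show "null ((g \<cdot> r) \<cdot> h)" using c(4)[OF t] h g r R by simp
      qed (use g r R in simp)
    qed
  next
    assume *: "\<forall>r\<in>R. null (g \<cdot> r)"
    show "null (g \<cdot> c)"
      using S
    proof (rule coproduct_null)
      fix t assume t: "t \<in> T"
      then obtain r h where rh: "t = r \<cdot> h" "r \<in> R" "h \<in> Hom C G (Dom C r)" by (auto simp: T_def)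
      then have "null (g \<cdot> t)" using * g R by simp
      then show "null ((g \<cdot> c) \<cdot> \<iota> t)" using c g coproductD[OF S] t by simp
    qed (use c g in simp_all)
  qed
  show thesis
  proof
    fix x assume x: "x \<in> Arr C" "Cod C x = M"
    show "null (q \<cdot> x) \<longleftrightarrow> x \<in> span M R"
    proof
      assume qx: "null (q \<cdot> x)"
      show "x \<in> span M R"
      proof (rule spanI)
        fix g assume g: "g \<in> Arr C" "Dom C g = M" "\<And>r. r \<in> R \<Longrightarrow> null (g \<cdot> r)"
        then have "null (g \<cdot> c)" using kill by blast
        then show "null (g \<cdot> x)" using cokernel_null_iff[OF q g(1) _ _ x(1) _ qx] g x c by simp
      qed (use x in auto)
    next
      assume "x \<in> span M R"
      then show "null (q \<cdot> x)" by (rule spanD) (use kill[of q] q' c in auto)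
    qed
  qed (use q' c in auto)
qed

text \<open>The limit of quotients of \<open>B\<close> is the quotient of \<open>B\<close> by the sum of the kernels.\<close>

lemma quotient_system_limit:
  assumes I: "directed_preorder I r" and B: "B \<in> Ob C"
    and P: "\<And>i. i \<in> I \<Longrightarrow> epi_arr C (P i)" "\<And>i. i \<in> I \<Longrightarrow> Dom C (P i) = B"
    and t: "\<And>i j. (i, j) \<in> r \<Longrightarrow> t i j \<in> Arr C \<and> Dom C (t i j) = Cod C (P i) \<and> Cod C (t i j) = Cod C (P j)
      \<and> t i j \<cdot> P i = P j"
  obtains Q L \<iota> where "direct_system C I r (\<lambda>i. Cod C (P i)) t"
    "is_direct_limit C I r (\<lambda>i. Cod C (P i)) t L \<iota>"
    "epi_arr C Q" "Q \<in> Arr C" "Dom C Q = B" "Cod C Q = L"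
    "\<And>i. i \<in> I \<Longrightarrow> \<iota> i \<in> Arr C \<and> Dom C (\<iota> i) = Cod C (P i) \<and> Cod C (\<iota> i) = L \<and> \<iota> i \<cdot> P i = Q"
    "\<And>h. h \<in> Arr C \<Longrightarrow> Dom C h = B
      \<Longrightarrow> (\<And>i x. i \<in> I \<Longrightarrow> x \<in> Arr C \<Longrightarrow> Cod C x = B \<Longrightarrow> null (P i \<cdot> x) \<Longrightarrow> null (h \<cdot> x))
      \<Longrightarrow> \<exists>k\<in>Arr C. Dom C k = L \<and> Cod C k = Cod C h \<and> k \<cdot> Q = h"
proof -
  note P' = P epi_arrD[OF P(1)]
  have rI: "(i, j) \<in> r \<Longrightarrow> i \<in> I \<and> j \<in> I" "i \<in> I \<Longrightarrow> (i, i) \<in> r" for i j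
    using I unfolding directed_preorder_def preorder_on_def refl_on_def by auto
  have tr: "(i, j) \<in> r \<Longrightarrow> (j, k) \<in> r \<Longrightarrow> (i, k) \<in> r" for i j k
    using I unfolding directed_preorder_def preorder_on_def trans_def by blast
  have dir: "\<exists>k\<in>I. (i, k) \<in> r \<and> (j, k) \<in> r" if "i \<in> I" "j \<in> I" for i j
    using I that unfolding directed_preorder_def by blast
  have sys: "direct_system C I r (\<lambda>i. Cod C (P i)) t"
    unfolding direct_system_def
  proof (intro conjI ballI allI impI)
    fix i assume i: "i \<in> I"
    show "Cod C (P i) \<in> Ob C" using P' i by simp
    have "t i i \<cdot> P i = Id C (Cod C (P i)) \<cdot> P i" using t rI P' i by simp
    then show "t i i = Id C (Cod C (P i))"
      by (rule epi_cancel) (use t rI P' i in simp_all)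
  next
    fix i j k assume ij: "(i, j) \<in> r" "(j, k) \<in> r"
    note ijk = ij tr[OF ij] rI(1)[OF ij(1)] rI(1)[OF ij(2)]
    have "(t j k \<cdot> t i j) \<cdot> P i = t j k \<cdot> (t i j \<cdot> P i)" using t ijk P' by simp
    also have "\<dots> = t i k \<cdot> P i" using t ijk by simp
    finally show "t j k \<cdot> t i j = t i k"
      by (rule epi_cancel) (use t ijk P' in simp_all)
  qed (use t in simp)
  define R where "R = {x \<in> Arr C. Cod C x = B \<and> (\<exists>i\<in>I. null (P i \<cdot> x))}"
  obtain Q where Q: "epi_arr C Q" "Q \<in> Arr C" "Dom C Q = B"
    "\<And>x. x \<in> Arr C \<Longrightarrow> Cod C x = B \<Longrightarrow> null (Q \<cdot> x) \<longleftrightarrow> x \<in> span B R"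
    by (rule joint_cokernel[OF B, of R]) (auto simp: R_def)
  have univ: "\<exists>k\<in>Arr C. Dom C k = Cod C Q \<and> Cod C k = Cod C h \<and> k \<cdot> Q = h"
    if h: "h \<in> Arr C" "Dom C h = B"
      "\<And>i x. i \<in> I \<Longrightarrow> x \<in> Arr C \<Longrightarrow> Cod C x = B \<Longrightarrow> null (P i \<cdot> x) \<Longrightarrow> null (h \<cdot> x)" for h
  proof -
    have "null (h \<cdot> x)" if "x \<in> Arr C" "Cod C x = B" "null (Q \<cdot> x)" for x
    proof -
      have "x \<in> span B R" using Q that by simp
      then show ?thesis
      proof (rule spanD[OF _ h(1,2)])
        fix r assume "r \<in> R"
        then obtain i where "i \<in> I" "r \<in> Arr C" "Cod C r = B" "null (P i \<cdot> r)"
          by (auto simp: R_def)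
        then show "null (h \<cdot> r)" by (rule h(3))
      qed
    qed
    then obtain u where "u \<in> Arr C" "Dom C u = Cod C Q" "Cod C u = Cod C h" "u \<cdot> Q = h"
      using epi_factor[OF Q(1), of h] h Q by metis
    then show ?thesis by blast
  qed
  have "\<exists>u. u \<in> Arr C \<and> Dom C u = Cod C (P i) \<and> Cod C u = Cod C Q \<and> u \<cdot> P i = Q" if i: "i \<in> I" for i
  proof -
    have "null (Q \<cdot> x)" if x: "x \<in> Arr C" "Cod C x = B" "null (P i \<cdot> x)" for x
      using x i Q by (auto simp: R_def intro!: span_superset)
    then show ?thesis using epi_factor[OF P(1)[OF i], of Q] P i Q by metis
  qed
  then obtain \<iota> where \<iota>: "\<And>i. i \<in> I \<Longrightarrow> \<iota> i \<in> Arr C \<and> Dom C (\<iota> i) = Cod C (P i) \<and>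
      Cod C (\<iota> i) = Cod C Q \<and> \<iota> i \<cdot> P i = Q"
    by metis
  have "is_direct_limit C I r (\<lambda>i. Cod C (P i)) t (Cod C Q) \<iota>"
    unfolding is_direct_limit_def
  proof (intro conjI ballI allI impI)
    show "Cod C Q \<in> Ob C" using Q by simp
    show "\<iota> i \<in> Hom C (Cod C (P i)) (Cod C Q)" if "i \<in> I" for i using \<iota> that by simp
    fix i j assume ij: "(i, j) \<in> r"
    have "(\<iota> j \<cdot> t i j) \<cdot> P i = \<iota> j \<cdot> (t i j \<cdot> P i)" using ij rI t P' \<iota> by simp
    also have "\<dots> = \<iota> i \<cdot> P i" using ij rI t \<iota> by simp
    finally show "\<iota> j \<cdot> t i j = \<iota> i"
      by (rule epi_cancel) (use ij rI t P' \<iota> in auto)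
  next
    fix Y f assume Y: "Y \<in> Ob C"
      and f: "(\<forall>i\<in>I. f i \<in> Hom C (Cod C (P i)) Y) \<and> (\<forall>i j. (i, j) \<in> r \<longrightarrow> f j \<cdot> t i j = f i)"
    have step: "f i \<cdot> P i = f j \<cdot> P j" if ij: "(i, j) \<in> r" for i j
    proof -
      have "f i \<cdot> P i = (f j \<cdot> t i j) \<cdot> P i" using f ij by auto
      also have "\<dots> = f j \<cdot> (t i j \<cdot> P i)"
        by (rule Comp_assoc_simp) (use f rI(1)[OF ij] t[OF ij] P' in simp_all)
      finally show ?thesis using ij t by simp
    qed
    have same: "f i \<cdot> P i = f j \<cdot> P j" if "i \<in> I" "j \<in> I" for i j
      using dir[OF that] step by metis
    obtain i0 where i0: "i0 \<in> I" using I by (auto simp: directed_preorder_def)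
    define h where "h = f i0 \<cdot> P i0"
    have h: "h \<in> Arr C" "Dom C h = B" "Cod C h = Y" using f i0 P' by (simp_all add: h_def)
    obtain k where k: "k \<in> Arr C" "Dom C k = Cod C Q" "Cod C k = Y" "k \<cdot> Q = h"
    proof -
      have "null (h \<cdot> x)" if "i \<in> I" "x \<in> Arr C" "Cod C x = B" "null (P i \<cdot> x)" for i x
      proof -
        have "h = f i \<cdot> P i" unfolding h_def by (rule same) (use i0 that in auto)
        then show ?thesis using that f P' by simp
      qed
      then show thesis using univ[of h] h that by auto
    qed
    show "\<exists>!h. h \<in> Hom C (Cod C Q) Y \<and> (\<forall>i\<in>I. h \<cdot> \<iota> i = f i)"
    proof (rule ex1I[of _ k], intro conjI ballI)
      show "k \<in> Hom C (Cod C Q) Y" using k by simp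
      fix i assume i: "i \<in> I"
      have "(k \<cdot> \<iota> i) \<cdot> P i = k \<cdot> (\<iota> i \<cdot> P i)" using i k \<iota> P' by simp
      also have "\<dots> = f i \<cdot> P i" using i k \<iota> same[OF i0 i] by (simp add: h_def)
      finally show "k \<cdot> \<iota> i = f i"
        by (rule epi_cancel) (use i k \<iota> P' f in auto)
    next
      fix k' assume k': "k' \<in> Hom C (Cod C Q) Y \<and> (\<forall>i\<in>I. k' \<cdot> \<iota> i = f i)"
      have "k' \<cdot> Q = k' \<cdot> (\<iota> i0 \<cdot> P i0)" using \<iota> i0 by simp
      also have "\<dots> = (k' \<cdot> \<iota> i0) \<cdot> P i0"
        by (rule Comp_assoc_simp[symmetric]) (use \<iota>[OF i0] i0 k' P' in simp_all)
      also have "\<dots> = k \<cdot> Q" using k' i0 k by (simp add: h_def)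
      finally show "k' = k"
        by (rule epi_cancel) (use k k' Q in auto)
    qed
  qed
  from that[OF sys this Q(1-3) refl \<iota> univ] show thesis .
qed

end

section \<open>Exactness of direct limits restated for directed sums of subobjects\<close>

context accessible_grothendieck_category
begin

text \<open>Every subobject of \<open>M\<close> is determined by the arrows from a generator factoring through it, so the
  directed family \<open>\<D>\<close> may be indexed by a small set.\<close>

lemma directed_span_index:
  assumes M: "M \<in> Ob C" and \<D>: "\<D> \<noteq> {}"
    and dir: "\<And>R S. R \<in> \<D> \<Longrightarrow> S \<in> \<D> \<Longrightarrow> \<exists>T\<in>\<D>. R \<subseteq> T \<and> S \<subseteq> T"
    and arr: "\<And>R r. R \<in> \<D> \<Longrightarrow> r \<in> R \<Longrightarrow> r \<in> Arr C \<and> Cod C r = M"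
  obtains I :: "'u set" and r F where "small \<kappa> I" "directed_preorder I r" "F ` I \<subseteq> \<D>"
    "\<And>i j. (i, j) \<in> r \<Longrightarrow> i \<in> I \<and> j \<in> I \<and> span M (F i) \<subseteq> span M (F j)"
    "\<And>R. R \<in> \<D> \<Longrightarrow> \<exists>i\<in>I. span M (F i) = span M R"
proof -
  obtain G where G: "generating C {G}" using ex_generator by blast
  then have GOb: "G \<in> Ob C" by (simp add: generating_def)
  let ?tr = "\<lambda>R. span M R \<inter> Hom C G M"
  \<comment> \<open>A span is determined by its arrows from the generator: the cokernel of
    \<open>S\<close> kills \<open>x\<close> as soon as it kills every
    \<open>x \<cdot> h\<close>.\<close>
  have le: "span M R \<subseteq> span M S" if RS: "R \<in> \<D>" "S \<in> \<D>" "?tr R \<subseteq> ?tr S" for R S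
  proof
    fix x assume x: "x \<in> span M R"
    note x' = span_arr[OF x]
    obtain q where q: "q \<in> Arr C" "Dom C q = M"
      "\<And>x. x \<in> Arr C \<Longrightarrow> Cod C x = M \<Longrightarrow> null (q \<cdot> x) \<longleftrightarrow> x \<in> span M S"
      using joint_cokernel[OF M, of S] arr RS(2) by metis
    have "null (q \<cdot> x)"
      using G
    proof (rule generator_null)
      fix G' h assume h: "G' \<in> {G}" "h \<in> Arr C" "Dom C h = G'" "Cod C h = Dom C (q \<cdot> x)"
      then have "x \<cdot> h \<in> ?tr R" using span_comp[OF x, of h] arr RS(1) x' q by auto
      then have "x \<cdot> h \<in> span M S" using RS(3) by blast
      then have "null (q \<cdot> (x \<cdot> h))" using q(3) span_arr by blast
      then show "null ((q \<cdot> x) \<cdot> h)" using h x' q(1,2) by simp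
    qed (use x' q in simp)
    then show "x \<in> span M S" using q(3) x' by blast
  qed
  define T where "T = ?tr ` \<D>"
  have "T \<subseteq> Pow (Hom C G M)" by (auto simp: T_def)
  then have small: "small \<kappa> T"
    using small_Pow[OF inaccessible locally_small[OF GOb M]] small_subset by blast
  obtain f :: "'m set \<Rightarrow> 'u" where f: "inj_on f T" using small_inj[OF inaccessible small] .
  \<comment> \<open>\<open>F i\<close> picks one family whose trace on the generator is coded by
    \<open>i\<close>; any other family with that trace has the same span by
    \<open>le\<close>.\<close>
  define F where "F i = (SOME R. R \<in> \<D> \<and> f (?tr R) = i)" for i
  define I where "I = f ` T"
  define r where "r = {(i, j). i \<in> I \<and> j \<in> I \<and> span M (F i) \<subseteq> span M (F j)}"
  have F: "F i \<in> \<D>" "f (?tr (F i)) = i" if i: "i \<in> I" for i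
  proof -
    have "\<exists>R. R \<in> \<D> \<and> f (?tr R) = i" using i by (auto simp: I_def T_def)
    from someI_ex[OF this] show "F i \<in> \<D>" "f (?tr (F i)) = i" unfolding F_def by blast+
  qed
  have ex: "\<exists>i\<in>I. span M (F i) = span M R" if R: "R \<in> \<D>" for R
  proof
    show i: "f (?tr R) \<in> I" using R by (simp add: I_def T_def)
    have "?tr (F (f (?tr R))) = ?tr R"
      using inj_onD[OF f F(2)[OF i]] F(1)[OF i] R by (simp add: T_def)
    then show "span M (F (f (?tr R))) = span M R" using le F(1)[OF i] R by (metis order_refl subset_antisym)
  qed
  have "directed_preorder I r"
    unfolding directed_preorder_def
  proof (intro conjI ballI)
    show "I \<noteq> {}" using \<D> by (simp add: I_def T_def)
    show "preorder_on I r" by (auto simp: preorder_on_def refl_on_def trans_def r_def)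
    fix i j assume ij: "i \<in> I" "j \<in> I"
    obtain T where T: "T \<in> \<D>" "F i \<subseteq> T" "F j \<subseteq> T" using dir F ij by meson
    obtain k where k: "k \<in> I" "span M (F k) = span M T" using ex T by blast
    then have "(i, k) \<in> r" "(j, k) \<in> r" using T span_mono ij by (auto simp: r_def)
    then show "\<exists>k\<in>I. (i, k) \<in> r \<and> (j, k) \<in> r" using k by blast
  qed
  then show thesis
  proof (rule that[rotated])
    show "small \<kappa> I" unfolding I_def by (rule small_image[OF small])
    show "F ` I \<subseteq> \<D>" using F by blast
    show "i \<in> I \<and> j \<in> I \<and> span M (F i) \<subseteq> span M (F j)" if "(i, j) \<in> r" for i j
      using that by (simp add: r_def)
  qed (rule ex)
qed

text \<open>Exactness of direct limits, applied to the systems \<open>N / f\<^sup>-\<^sup>1(R) \<rightarrow> M / R \<rightarrow> M / (R + im f)\<close>, whose limits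
  are quotients of \<open>N\<close>, \<open>M\<close> and \<open>M\<close> again.\<close>

theorem directed_span_null:
  assumes M: "M \<in> Ob C" and \<D>: "\<D> \<noteq> {}"
    and dir: "\<And>R S. R \<in> \<D> \<Longrightarrow> S \<in> \<D> \<Longrightarrow> \<exists>T\<in>\<D>. R \<subseteq> T \<and> S \<subseteq> T"
    and arr: "\<And>R r. R \<in> \<D> \<Longrightarrow> r \<in> R \<Longrightarrow> r \<in> Arr C \<and> Cod C r = M"
    and f: "f \<in> span M (\<Union>\<D>)" and g: "g \<in> Arr C" "Dom C g = Dom C f"
    and kill: "\<And>R z. R \<in> \<D> \<Longrightarrow> z \<in> Arr C \<Longrightarrow> Cod C z = Dom C f \<Longrightarrow> f \<cdot> z \<in> span M R \<Longrightarrow> null (g \<cdot> z)"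
  shows "null g"
proof -
  note f' = span_arr[OF f]
  obtain I :: "'u set" and r F where I: "small \<kappa> I" "directed_preorder I r" "F ` I \<subseteq> \<D>"
    and r: "\<And>i j. (i, j) \<in> r \<Longrightarrow> i \<in> I \<and> j \<in> I \<and> span M (F i) \<subseteq> span M (F j)"
    and F: "\<And>R. R \<in> \<D> \<Longrightarrow> \<exists>i\<in>I. span M (F i) = span M R"
    by (rule directed_span_index[OF M \<D>]) (erule (1) dir | erule (1) arr | (rule that; assumption))+
  have "\<exists>q. epi_arr C q \<and> q \<in> Arr C \<and> Dom C q = M \<and>
    (\<forall>x. x \<in> Arr C \<longrightarrow> Cod C x = M \<longrightarrow> null (q \<cdot> x) = (x \<in> span M (F i)))" if "i \<in> I" for i
    using joint_cokernel[OF M, of "F i"] arr I(3) that by (metis image_subset_iff)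
  then obtain q where q: "\<And>i. i \<in> I \<Longrightarrow> epi_arr C (q i)" "\<And>i. i \<in> I \<Longrightarrow> q i \<in> Arr C"
    "\<And>i. i \<in> I \<Longrightarrow> Dom C (q i) = M"
    "\<And>i x. i \<in> I \<Longrightarrow> x \<in> Arr C \<Longrightarrow> Cod C x = M \<Longrightarrow> null (q i \<cdot> x) \<longleftrightarrow> x \<in> span M (F i)"
    by metis
  have "\<exists>mp. mono_arr C (fst mp) \<and> epi_arr C (snd mp) \<and> fst mp \<in> Arr C \<and> snd mp \<in> Arr C \<and>
    Dom C (snd mp) = Dom C f \<and> Cod C (fst mp) = Cod C (q i) \<and> Dom C (fst mp) = Cod C (snd mp) \<and>
    fst mp \<cdot> snd mp = q i \<cdot> f" if i: "i \<in> I" for i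
  proof -
    have "q i \<cdot> f \<in> Arr C" "Dom C (q i \<cdot> f) = Dom C f" "Cod C (q i \<cdot> f) = Cod C (q i)"
      using q i f' by simp_all
    then show ?thesis using mono_epi_factorization[of "q i \<cdot> f"] by (metis fst_conv snd_conv)
  qed
  then obtain mp where mp0: "\<And>i. i \<in> I \<Longrightarrow> mono_arr C (fst (mp i)) \<and> epi_arr C (snd (mp i)) \<and>
    fst (mp i) \<in> Arr C \<and> snd (mp i) \<in> Arr C \<and> Dom C (snd (mp i)) = Dom C f \<and>
    Cod C (fst (mp i)) = Cod C (q i) \<and> Dom C (fst (mp i)) = Cod C (snd (mp i)) \<and>
    fst (mp i) \<cdot> snd (mp i) = q i \<cdot> f" by metis
  define m where "m i = fst (mp i)" for i
  define p where "p i = snd (mp i)" for i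
  have mp: "\<And>i. i \<in> I \<Longrightarrow> mono_arr C (m i)" "\<And>i. i \<in> I \<Longrightarrow> epi_arr C (p i)"
    "\<And>i. i \<in> I \<Longrightarrow> m i \<in> Arr C" "\<And>i. i \<in> I \<Longrightarrow> p i \<in> Arr C" "\<And>i. i \<in> I \<Longrightarrow> Dom C (p i) = Dom C f"
    "\<And>i. i \<in> I \<Longrightarrow> Cod C (m i) = Cod C (q i)" "\<And>i. i \<in> I \<Longrightarrow> Dom C (m i) = Cod C (p i)"
    "\<And>i. i \<in> I \<Longrightarrow> m i \<cdot> p i = q i \<cdot> f"
    using mp0 by (simp_all add: m_def p_def)
  have "\<forall>i\<in>I. \<exists>c. is_cokernel C (m i) c" using ex_cokernel mp(3) by blast
  from bchoice[OF this] obtain c where c: "\<And>i. i \<in> I \<Longrightarrow> is_cokernel C (m i) (c i)" by blast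
  note c' = is_cokernelD(2-5)[OF c]
  \<comment> \<open>So the codomain of \<open>p i\<close> is the quotient of \<open>Dom C f\<close>
    by the preimage of \<open>F i\<close>.\<close>
  have p_null: "null (p i \<cdot> x) \<longleftrightarrow> f \<cdot> x \<in> span M (F i)" if i: "i \<in> I" and x: "x \<in> Arr C" "Cod C x = Dom C f" for i x
  proof -
    have "null (p i \<cdot> x) \<longleftrightarrow> null (m i \<cdot> (p i \<cdot> x))"
      using mono_null_iff[OF mp(1)[OF i], of "p i \<cdot> x"] mp i x by simp
    also have "m i \<cdot> (p i \<cdot> x) = (q i \<cdot> f) \<cdot> x"
      by (rule Comp_eq_Comp[OF mp(8)[OF i]]) (use mp i x in simp_all)
    also have "(q i \<cdot> f) \<cdot> x = q i \<cdot> (f \<cdot> x)" using q i f' x by simp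
    also have "null \<dots> \<longleftrightarrow> f \<cdot> x \<in> span M (F i)" by (rule q(4)) (use i x f' in simp_all)
    finally show ?thesis .
  qed
  have "\<exists>s. s \<in> Arr C \<and> Dom C s = Cod C (p i) \<and> Cod C s = Cod C (p j) \<and> s \<cdot> p i = p j" if ij: "(i, j) \<in> r" for i j
  proof (rule epi_factor[OF mp(2), of i "p j"])
    fix x assume "x \<in> Arr C" "Cod C x = Dom C (p i)" "null (p i \<cdot> x)"
    then show "null (p j \<cdot> x)" using p_null r[OF ij] mp by auto
  qed (use r[OF ij] mp in auto)
  then obtain s where s: "\<And>i j. (i, j) \<in> r \<Longrightarrow> s i j \<in> Arr C \<and> Dom C (s i j) = Cod C (p i) \<and>
      Cod C (s i j) = Cod C (p j) \<and> s i j \<cdot> p i = p j"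
    by metis
  have "\<exists>t. t \<in> Arr C \<and> Dom C t = Cod C (q i) \<and> Cod C t = Cod C (q j) \<and> t \<cdot> q i = q j" if ij: "(i, j) \<in> r" for i j
  proof (rule epi_factor[OF q(1), of i "q j"])
    fix x assume "x \<in> Arr C" "Cod C x = Dom C (q i)" "null (q i \<cdot> x)"
    then show "null (q j \<cdot> x)" using q r[OF ij] by auto
  qed (use r[OF ij] q in auto)
  then obtain t where t: "\<And>i j. (i, j) \<in> r \<Longrightarrow> t i j \<in> Arr C \<and> Dom C (t i j) = Cod C (q i) \<and>
      Cod C (t i j) = Cod C (q j) \<and> t i j \<cdot> q i = q j"
    by metis
  have tm: "t i j \<cdot> m i = m j \<cdot> s i j" if ij: "(i, j) \<in> r" for i j
  proof -
    note i = r[OF ij, THEN conjunct1] and j = r[OF ij, THEN conjunct2, THEN conjunct1]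
    have "(t i j \<cdot> m i) \<cdot> p i = t i j \<cdot> (m i \<cdot> p i)"
      by (rule Comp_assoc_simp) (use i j mp t[OF ij] in simp_all)
    also have "\<dots> = t i j \<cdot> (q i \<cdot> f)" using mp i by simp
    also have "\<dots> = q j \<cdot> f" by (rule Comp_eq_Comp) (use t[OF ij] q i f' in auto)
    also have "\<dots> = m j \<cdot> p j" using mp j by simp
    also have "\<dots> = m j \<cdot> (s i j \<cdot> p i)" using s[OF ij] by simp
    also have "\<dots> = (m j \<cdot> s i j) \<cdot> p i"
      by (rule Comp_assoc_simp[symmetric]) (use i j mp s[OF ij] in simp_all)
    finally show ?thesis by (rule epi_cancel) (use i j mp s[OF ij] t[OF ij] in simp_all)
  qed
  have "\<exists>u. u \<in> Arr C \<and> Dom C u = Cod C (c i) \<and> Cod C u = Cod C (c j) \<and> u \<cdot> c i = c j \<cdot> t i j" if ij: "(i, j) \<in> r" for i j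
  proof -
    note i = r[OF ij, THEN conjunct1] and j = r[OF ij, THEN conjunct2, THEN conjunct1]
    have "null ((c j \<cdot> m j) \<cdot> s i j)" by (rule null_comp1) (use i j c' mp s[OF ij] in simp_all)
    then have "null ((c j \<cdot> t i j) \<cdot> m i)" using i j c' mp s[OF ij] t[OF ij] tm[OF ij] by simp
    then show ?thesis using is_cokernelD(6)[OF c[OF i], of "c j \<cdot> t i j"] i j c' mp t[OF ij] by auto
  qed
  then obtain u where u: "\<And>i j. (i, j) \<in> r \<Longrightarrow> u i j \<in> Arr C \<and> Dom C (u i j) = Cod C (c i) \<and>
      Cod C (u i j) = Cod C (c j) \<and> u i j \<cdot> c i = c j \<cdot> t i j"
    by metis
  have cq: "epi_arr C (c i \<cdot> q i)" "c i \<cdot> q i \<in> Arr C" "Dom C (c i \<cdot> q i) = M" "Cod C (c i \<cdot> q i) = Cod C (c i)" if "i \<in> I" for i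
    using that q c' mp epi_comp by simp_all
  have ucq: "u i j \<in> Arr C \<and> Dom C (u i j) = Cod C (c i \<cdot> q i) \<and>
      Cod C (u i j) = Cod C (c j \<cdot> q j) \<and> u i j \<cdot> (c i \<cdot> q i) = c j \<cdot> q j" if ij: "(i, j) \<in> r" for i j
  proof -
    note i = r[OF ij, THEN conjunct1] and j = r[OF ij, THEN conjunct2, THEN conjunct1]
    have "u i j \<cdot> (c i \<cdot> q i) = (c j \<cdot> t i j) \<cdot> q i"
      by (rule Comp_eq_Comp) (use u[OF ij] i j c' q mp in auto)
    also have "\<dots> = c j \<cdot> (t i j \<cdot> q i)"
      by (rule Comp_assoc_simp) (use t[OF ij] i j c' q mp in auto)
    finally show ?thesis using u[OF ij] t[OF ij] i j cq by simp
  qed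
  obtain QX LX \<iota> where X: "direct_system C I r (\<lambda>i. Cod C (p i)) s"
    "is_direct_limit C I r (\<lambda>i. Cod C (p i)) s LX \<iota>"
    "epi_arr C QX" "QX \<in> Arr C" "Dom C QX = Dom C f" "Cod C QX = LX"
    "\<And>i. i \<in> I \<Longrightarrow> \<iota> i \<in> Arr C \<and> Dom C (\<iota> i) = Cod C (p i) \<and> Cod C (\<iota> i) = LX \<and> \<iota> i \<cdot> p i = QX"
    "\<And>h. h \<in> Arr C \<Longrightarrow> Dom C h = Dom C f
      \<Longrightarrow> (\<And>i x. i \<in> I \<Longrightarrow> x \<in> Arr C \<Longrightarrow> Cod C x = Dom C f \<Longrightarrow> null (p i \<cdot> x) \<Longrightarrow> null (h \<cdot> x))
      \<Longrightarrow> \<exists>k\<in>Arr C. Dom C k = LX \<and> Cod C k = Cod C h \<and> k \<cdot> QX = h"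
    by (rule quotient_system_limit[OF I(2), of "Dom C f" p s]) (use f' mp s in auto)
  obtain QY LY \<iota>' where Y: "direct_system C I r (\<lambda>i. Cod C (q i)) t"
    "is_direct_limit C I r (\<lambda>i. Cod C (q i)) t LY \<iota>'"
    "epi_arr C QY" "QY \<in> Arr C" "Dom C QY = M" "Cod C QY = LY"
    "\<And>i. i \<in> I \<Longrightarrow> \<iota>' i \<in> Arr C \<and> Dom C (\<iota>' i) = Cod C (q i) \<and> Cod C (\<iota>' i) = LY \<and> \<iota>' i \<cdot> q i = QY"
    "\<And>h. h \<in> Arr C \<Longrightarrow> Dom C h = M
      \<Longrightarrow> (\<And>i x. i \<in> I \<Longrightarrow> x \<in> Arr C \<Longrightarrow> Cod C x = M \<Longrightarrow> null (q i \<cdot> x) \<Longrightarrow> null (h \<cdot> x))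
      \<Longrightarrow> \<exists>k\<in>Arr C. Dom C k = LY \<and> Cod C k = Cod C h \<and> k \<cdot> QY = h"
    by (rule quotient_system_limit[OF I(2) M, of q t]) (use q t in auto)
  obtain QZ LZ \<iota>'' where Z: "direct_system C I r (\<lambda>i. Cod C (c i \<cdot> q i)) u"
    "is_direct_limit C I r (\<lambda>i. Cod C (c i \<cdot> q i)) u LZ \<iota>''"
    "epi_arr C QZ" "QZ \<in> Arr C" "Dom C QZ = M" "Cod C QZ = LZ"
    "\<And>i. i \<in> I \<Longrightarrow> \<iota>'' i \<in> Arr C \<and> Dom C (\<iota>'' i) = Cod C (c i \<cdot> q i) \<and> Cod C (\<iota>'' i) = LZ \<and> \<iota>'' i \<cdot> (c i \<cdot> q i) = QZ"
    by (rule quotient_system_limit[OF I(2) M, of "\<lambda>i. c i \<cdot> q i" u]) (use cq ucq in blast)+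
  \<comment> \<open>\<open>f\<close> lies in the sum of all members of \<open>\<D>\<close>, and the
    limit \<open>LY\<close> kills each of them.\<close>
  have QYf: "null (QY \<cdot> f)"
  proof (rule spanD[OF f Y(4,5)])
    fix x assume "x \<in> \<Union>\<D>"
    then obtain R where R: "R \<in> \<D>" "x \<in> R" by blast
    note x = arr[OF R]
    obtain i where i: "i \<in> I" "span M (F i) = span M R" using F R by blast
    then have "null (q i \<cdot> x)" using q(4)[OF i(1), of x] x R span_superset by simp
    then have "null (\<iota>' i \<cdot> (q i \<cdot> x))" using i Y(7)[OF i(1)] q x by simp
    moreover have "\<iota>' i \<cdot> (q i \<cdot> x) = QY \<cdot> x" by (rule Comp_eq_Comp) (use i Y(7)[OF i(1)] q x in auto)
    ultimately show "null (QY \<cdot> x)" by simp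
  qed
  obtain \<phi> where \<phi>: "\<phi> \<in> Arr C" "Dom C \<phi> = LX" "Cod C \<phi> = LY" "\<phi> \<cdot> QX = QY \<cdot> f"
  proof -
    have "null ((QY \<cdot> f) \<cdot> x)" if "x \<in> Arr C" "Cod C x = Dom C f" for x
      by (rule null_comp1[OF QYf]) (use that Y f' in auto)
    then show thesis using X(8)[of "QY \<cdot> f"] Y f' that by auto
  qed
  have \<phi>m: "\<phi> \<cdot> \<iota> i = \<iota>' i \<cdot> m i" if i: "i \<in> I" for i
  proof -
    have "(\<phi> \<cdot> \<iota> i) \<cdot> p i = \<phi> \<cdot> (\<iota> i \<cdot> p i)"
      by (rule Comp_assoc_simp) (use i \<phi> X(7)[OF i] mp in simp_all)
    also have "\<dots> = QY \<cdot> f" using X(7)[OF i] \<phi> by simp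
    also have "\<dots> = \<iota>' i \<cdot> (q i \<cdot> f)"
      by (rule Comp_eq_Comp[symmetric]) (use i Y(7)[OF i] q f' in auto)
    also have "\<dots> = \<iota>' i \<cdot> (m i \<cdot> p i)" using mp i by simp
    also have "\<dots> = (\<iota>' i \<cdot> m i) \<cdot> p i"
      by (rule Comp_assoc_simp[symmetric]) (use i Y(7)[OF i] mp in auto)
    finally show ?thesis
      by (rule epi_cancel) (use i \<phi> X(7)[OF i] Y(7)[OF i] mp in auto)
  qed
  obtain \<psi> where \<psi>: "\<psi> \<in> Arr C" "Dom C \<psi> = LY" "Cod C \<psi> = LZ" "\<psi> \<cdot> QY = QZ"
  proof -
    have "null (QZ \<cdot> x)" if x: "i \<in> I" "x \<in> Arr C" "Cod C x = M" "null (q i \<cdot> x)" for i x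
    proof -
      have "QZ \<cdot> x = (\<iota>'' i \<cdot> c i) \<cdot> (q i \<cdot> x)"
        using Z(7)[OF x(1)] Comp_eq_Comp[of "\<iota>'' i" "c i \<cdot> q i" QZ x] x q c' mp by simp
      then show ?thesis using x Z(7)[OF x(1)] q c' mp by simp
    qed
    then show thesis using Y(8)[of QZ] Z that by auto
  qed
  have \<psi>c: "\<psi> \<cdot> \<iota>' i = \<iota>'' i \<cdot> c i" if i: "i \<in> I" for i
  proof -
    have "(\<psi> \<cdot> \<iota>' i) \<cdot> q i = \<psi> \<cdot> (\<iota>' i \<cdot> q i)"
      by (rule Comp_assoc_simp) (use i \<psi> Y(7)[OF i] q in auto)
    also have "\<dots> = QZ" using Y(7)[OF i] \<psi> by simp
    also have "\<dots> = \<iota>'' i \<cdot> (c i \<cdot> q i)" using Z(7)[OF i] by simp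
    also have "\<dots> = (\<iota>'' i \<cdot> c i) \<cdot> q i"
      by (rule Comp_assoc_simp[symmetric]) (use i Z(7)[OF i] c' mp q cq in auto)
    finally show ?thesis
      by (rule epi_cancel) (use i \<psi> Y(7)[OF i] Z(7)[OF i] c' mp q cq in auto)
  qed
  have "short_exact C \<phi> \<psi>"
  proof (rule direct_limits_exact[OF I(1,2) X(1) Y(1) Z(1) _ _ X(2) Y(2) Z(2)])
    show "\<forall>i\<in>I. m i \<in> Hom C (Cod C (p i)) (Cod C (q i)) \<and>
        c i \<in> Hom C (Cod C (q i)) (Cod C (c i \<cdot> q i)) \<and> short_exact C (m i) (c i)"
      using mp c c' cq mono_kernel_of_cokernel by (simp add: short_exact_def)
    show "\<forall>i j. (i, j) \<in> r \<longrightarrow> t i j \<cdot> m i = m j \<cdot> s i j \<and> u i j \<cdot> c i = c j \<cdot> t i j"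
      using tm u by blast
  qed (use \<phi> \<psi> \<phi>m \<psi>c in auto)
  then have "mono_arr C \<phi>" using is_kernelD(5) by (auto simp: short_exact_def)
  \<comment> \<open>All of \<open>Dom C f\<close> dies in the limit \<open>LX\<close>, because
    \<open>\<phi> \<cdot> QX = QY \<cdot> f\<close> is zero and \<open>\<phi>\<close> is monic. By
    \<open>kill\<close>, \<open>g\<close> factors through \<open>QX\<close>.\<close>
  then have "null QX" using mono_null_iff[of \<phi> QX] \<phi> X QYf by simp
  moreover obtain k where "k \<in> Arr C" "Dom C k = LX" "k \<cdot> QX = g"
  proof -
    have "null (g \<cdot> x)" if "i \<in> I" "x \<in> Arr C" "Cod C x = Dom C f" "null (p i \<cdot> x)" for i x
      by (rule kill[of "F i"]) (use that p_null I in auto)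
    then show thesis using X(8)[of g] g that by auto
  qed
  ultimately show "null g" using X by auto
qed

text \<open>\<open>k R\<close> is the preimage of \<open>R\<close> under \<open>f\<close>. If
  \<open>f\<close> lies in no single span, every \<open>R\<close> has a larger member of
  \<open>\<D>\<close> with strictly larger preimage, and dependent choice builds an ascending chain
  that never stops.\<close>

lemma noetherian_factor:
  assumes N: "noetherian_object C (Dom C f)"
    and M: "M \<in> Ob C" and \<D>: "\<D> \<noteq> {}"
    and dir: "\<And>R S. R \<in> \<D> \<Longrightarrow> S \<in> \<D> \<Longrightarrow> \<exists>T\<in>\<D>. R \<subseteq> T \<and> S \<subseteq> T"
    and arr: "\<And>R r. R \<in> \<D> \<Longrightarrow> r \<in> R \<Longrightarrow> r \<in> Arr C \<and> Cod C r = M"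
    and f: "f \<in> span M (\<Union>\<D>)"
  shows "\<exists>R\<in>\<D>. f \<in> span M R"
proof (rule ccontr)
  assume no: "\<not> (\<exists>R\<in>\<D>. f \<in> span M R)"
  note f' = span_arr[OF f]
  have "\<exists>k. mono_arr C k \<and> k \<in> Arr C \<and> Cod C k = Dom C f \<and>
    (\<forall>x\<in>Arr C. Cod C x = Dom C f \<longrightarrow> (f \<cdot> x \<in> span M R \<longleftrightarrow> (\<exists>u\<in>Arr C. Dom C u = Dom C x \<and> Cod C u = Dom C k \<and> k \<cdot> u = x)))"
    if R: "R \<in> \<D>" for R
  proof -
    obtain q where q: "q \<in> Arr C" "Dom C q = M"
      "\<And>x. x \<in> Arr C \<Longrightarrow> Cod C x = M \<Longrightarrow> null (q \<cdot> x) \<longleftrightarrow> x \<in> span M R"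
      using joint_cokernel[OF M, of R] arr R by metis
    obtain k where k: "is_kernel C (q \<cdot> f) k" using ex_kernel[of "q \<cdot> f"] q f' by auto
    note k' = is_kernelD(2-5)[OF k]
    have "f \<cdot> x \<in> span M R \<longleftrightarrow> (\<exists>u\<in>Arr C. Dom C u = Dom C x \<and> Cod C u = Dom C k \<and> k \<cdot> u = x)"
      if x: "x \<in> Arr C" "Cod C x = Dom C f" for x
    proof
      assume "f \<cdot> x \<in> span M R"
      then have "null ((q \<cdot> f) \<cdot> x)" using q(3)[of "f \<cdot> x"] q f' x by simp
      then show "\<exists>u\<in>Arr C. Dom C u = Dom C x \<and> Cod C u = Dom C k \<and> k \<cdot> u = x"
        using is_kernelD(6)[OF k] q f' x by auto
    next
      assume "\<exists>u\<in>Arr C. Dom C u = Dom C x \<and> Cod C u = Dom C k \<and> k \<cdot> u = x"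
      then obtain u where u: "u \<in> Arr C" "Cod C u = Dom C k" "k \<cdot> u = x" by blast
      have "null (((q \<cdot> f) \<cdot> k) \<cdot> u)" by (rule null_comp1) (use k' u q f' in simp_all)
      then show "f \<cdot> x \<in> span M R" using q(3)[of "f \<cdot> x"] q f' x u k' by simp
    qed
    then show ?thesis using k' q f' by auto
  qed
  then have "\<forall>R\<in>\<D>. \<exists>k. mono_arr C k \<and> k \<in> Arr C \<and> Cod C k = Dom C f \<and>
    (\<forall>x\<in>Arr C. Cod C x = Dom C f \<longrightarrow> (f \<cdot> x \<in> span M R \<longleftrightarrow> (\<exists>u\<in>Arr C. Dom C u = Dom C x \<and> Cod C u = Dom C k \<and> k \<cdot> u = x)))"
    by blast
  from bchoice[OF this] obtain k where k: "\<And>R. R \<in> \<D> \<Longrightarrow> mono_arr C (k R)" "\<And>R. R \<in> \<D> \<Longrightarrow> k R \<in> Arr C"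
    "\<And>R. R \<in> \<D> \<Longrightarrow> Cod C (k R) = Dom C f" "\<And>R x. R \<in> \<D> \<Longrightarrow> x \<in> Arr C \<Longrightarrow> Cod C x = Dom C f \<Longrightarrow>
      f \<cdot> x \<in> span M R \<longleftrightarrow> (\<exists>u\<in>Arr C. Dom C u = Dom C x \<and> Cod C u = Dom C (k R) \<and> k R \<cdot> u = x)"
    by blast
  have kspan: "f \<cdot> k R \<in> span M R" if "R \<in> \<D>" for R
    using k(4)[of R "k R"] k that by (auto intro!: bexI[of _ "Id C (Dom C (k R))"])
  have step: "\<exists>S\<in>\<D>. R \<subseteq> S \<and> \<not> sub_le C (k S) (k R)" if R: "R \<in> \<D>" for R
  proof (rule ccontr)
    assume le: "\<not> (\<exists>S\<in>\<D>. R \<subseteq> S \<and> \<not> sub_le C (k S) (k R))"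
    obtain g where g: "is_cokernel C (k R) g" using ex_cokernel k R by blast
    note g' = is_cokernelD(2-5)[OF g]
    \<comment> \<open>If no member above \<open>R\<close> enlarged the preimage, the cokernel
      \<open>g\<close> of \<open>k R\<close> would kill all preimages and so vanish. Then the
      identity factors through \<open>k R\<close>, which puts \<open>f\<close> into the span of
      \<open>R\<close>.\<close>
    have "null g"
      using M \<D> dir arr f
    proof (rule directed_span_null)
      fix S z assume z: "S \<in> \<D>" "z \<in> Arr C" "Cod C z = Dom C f" "f \<cdot> z \<in> span M S"
      obtain T where T: "T \<in> \<D>" "R \<subseteq> T" "S \<subseteq> T" using dir R z by meson
      then have "f \<cdot> z \<in> span M T" using z span_mono by blast
      then obtain v where v: "v \<in> Arr C" "Cod C v = Dom C (k T)" "k T \<cdot> v = z"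
        using k(4)[OF T(1) z(2,3)] by blast
      have "sub_le C (k T) (k R)" using le T by blast
      then obtain w where w: "w \<in> Arr C" "Dom C w = Dom C (k T)" "Cod C w = Dom C (k R)" "k R \<cdot> w = k T"
        by (auto simp: sub_le_def)
      have "k R \<cdot> (w \<cdot> v) = z" using Comp_eq_Comp[OF w(4)] v w k R by simp
      moreover have "null (g \<cdot> (k R \<cdot> (w \<cdot> v)))"
        by (rule null_comp3) (use g' v w k R in simp_all)
      ultimately show "null (g \<cdot> z)" by simp
    qed (use g' k R in auto)
    then obtain w where "w \<in> Arr C" "Dom C w = Dom C f" "Cod C w = Dom C (k R)" "k R \<cdot> w = Id C (Dom C f)"
      using mono_cokernel_factor[OF k(1)[OF R] g, of "Id C (Dom C f)"] k R g' f' by auto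
    then have "f \<cdot> Id C (Dom C f) \<in> span M R" using k(4)[OF R, of "Id C (Dom C f)"] f' by auto
    then show False using no R f' by simp
  qed
  have "\<exists>R. \<forall>n::nat. R n \<in> \<D> \<and> (R n \<subseteq> R (Suc n) \<and> \<not> sub_le C (k (R (Suc n))) (k (R n)))"
    by (rule dependent_nat_choice) (use \<D> step in blast)+
  then obtain R where R: "\<And>n::nat. R n \<in> \<D>" "\<And>n. R n \<subseteq> R (Suc n)" "\<And>n. \<not> sub_le C (k (R (Suc n))) (k (R n))"
    by metis
  have "subobj C (k (R n)) (Dom C f) \<and> sub_le C (k (R n)) (k (R (Suc n)))" for n
  proof
    show "subobj C (k (R n)) (Dom C f)" using k R by (simp add: subobj_def)
    have "f \<cdot> k (R n) \<in> span M (R (Suc n))" using kspan[OF R(1)[of n]] span_mono[OF R(2)[of n]] by blast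
    then show "sub_le C (k (R n)) (k (R (Suc n)))"
      using k(4)[OF R(1)[of "Suc n"], of "k (R n)"] k R by (auto simp: sub_le_def)
  qed
  then obtain n where "\<forall>m\<ge>n. sub_le C (k (R m)) (k (R n))"
    using N[unfolded noetherian_object_def, THEN conjunct2, THEN spec, of "\<lambda>n. k (R n)"] by blast
  then show False using R(3)[of n] by simp
qed

end

section \<open>Enough injectives\<close>

lemma (in category) generating_Ob: "generating C {G} \<Longrightarrow> G \<in> Ob C"
  by (simp add: generating_def)

lemma (in preadditive_category) noetherian_subobject:
  assumes G: "noetherian_object C G" and n: "mono_arr C n" "Cod C n = G"
  shows "noetherian_object C (Dom C n)"
  unfolding noetherian_object_def
proof (intro conjI allI impI)
  note n' = mono_arrD[OF n(1)]
  show "Dom C n \<in> Ob C" using n' by simp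
  fix i :: "nat \<Rightarrow> 'm"
  assume i: "\<forall>k. subobj C (i k) (Dom C n) \<and> sub_le C (i k) (i (Suc k))"
  then have i': "mono_arr C (i k)" "i k \<in> Arr C" "Cod C (i k) = Dom C n" for k
    using mono_arrD by (auto simp: subobj_def)
  have le: "sub_le C (n \<cdot> i k) (n \<cdot> i l) \<longleftrightarrow> sub_le C (i k) (i l)" for k l
  proof
    assume "sub_le C (n \<cdot> i k) (n \<cdot> i l)"
    then obtain u where u: "u \<in> Arr C" "Dom C u = Dom C (i k)" "Cod C u = Dom C (i l)" "n \<cdot> (i l \<cdot> u) = n \<cdot> i k"
      using i' n' by (auto simp: sub_le_def)
    then have "i l \<cdot> u = i k" by (intro mono_cancel[OF u(4) n(1)]) (use i' in simp_all)
    then show "sub_le C (i k) (i l)" using u by (auto simp: sub_le_def)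
  next
    assume "sub_le C (i k) (i l)"
    then obtain u where u: "u \<in> Arr C" "Dom C u = Dom C (i k)" "Cod C u = Dom C (i l)" "i l \<cdot> u = i k"
      by (auto simp: sub_le_def)
    then have "(n \<cdot> i l) \<cdot> u = n \<cdot> i k" using i' n' by simp
    then show "sub_le C (n \<cdot> i k) (n \<cdot> i l)" using u i' n' unfolding sub_le_def by (intro bexI[of _ u]) simp_all
  qed
  have "subobj C (n \<cdot> i k) G \<and> sub_le C (n \<cdot> i k) (n \<cdot> i (Suc k))" for k
    using mono_comp[OF i'(1) n(1)] i' i n n' le by (simp add: subobj_def)
  then obtain k where "\<forall>m\<ge>k. sub_le C (n \<cdot> i m) (n \<cdot> i k)"
    using G[unfolded noetherian_object_def, THEN conjunct2, THEN spec, of "\<lambda>k. n \<cdot> i k"] by blast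
  then show "\<exists>k. \<forall>m\<ge>k. sub_le C (i m) (i k)" using le by blast
qed

context accessible_grothendieck_category
begin

text \<open>Pairs of a subobject \<open>n\<close> of \<open>G\<close> and a map \<open>f\<close> from it to \<open>X\<close> form a small set up to isomorphism,
  because they are determined by their graphs \<open>{(n h, f h)}\<close> on arrows \<open>h\<close> from the generator.\<close>

lemma graph_determines_partial_map:
  assumes G: "generating C {G}" and n: "mono_arr C n" "Cod C n = G" and n': "mono_arr C n'" "Cod C n' = G"
    and f: "f \<in> Arr C" "Dom C f = Dom C n" and f': "f' \<in> Arr C" "Dom C f' = Dom C n'" "Cod C f' = Cod C f"
    and graph: "(\<lambda>h. (n \<cdot> h, f \<cdot> h)) ` Hom C G (Dom C n) = (\<lambda>h. (n' \<cdot> h, f' \<cdot> h)) ` Hom C G (Dom C n')"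
  obtains u where "u \<in> Arr C" "Dom C u = Dom C n" "Cod C u = Dom C n'" "n' \<cdot> u = n" "f' \<cdot> u = f"
proof -
  note a = mono_arrD[OF n(1)] mono_arrD[OF n'(1)]
  have gr: "\<exists>h'. h' \<in> Arr C \<and> Dom C h' = G \<and> Cod C h' = Dom C n' \<and> n' \<cdot> h' = n \<cdot> h \<and> f' \<cdot> h' = f \<cdot> h"
    if "h \<in> Arr C" "Dom C h = G" "Cod C h = Dom C n" for h
  proof -
    have "(n \<cdot> h, f \<cdot> h) \<in> (\<lambda>h. (n' \<cdot> h, f' \<cdot> h)) ` Hom C G (Dom C n')"
      unfolding graph[symmetric] by (rule imageI) (use that in simp)
    then show ?thesis by auto
  qed
  obtain u where u: "u \<in> Arr C" "Dom C u = Dom C n" "Cod C u = Dom C n'" "n' \<cdot> u = n"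
  proof (rule mono_factor[OF n'(1), of n])
    fix g assume g: "g \<in> Arr C" "Dom C g = Cod C n'" "null (g \<cdot> n')"
    show "null (g \<cdot> n)"
      using G
    proof (rule generator_null)
      fix G' h assume "G' \<in> {G}" "h \<in> Arr C" "Dom C h = G'" "Cod C h = Dom C (g \<cdot> n)"
      then have h: "h \<in> Arr C" "Dom C h = G" "Cod C h = Dom C n" using g a n n' by simp_all
      obtain h' where h': "h' \<in> Arr C" "Cod C h' = Dom C n'" "n' \<cdot> h' = n \<cdot> h" using gr[OF h] by blast
      have "null (g \<cdot> (n' \<cdot> h'))" by (rule null_comp3) (use g a h' in simp_all)
      then show "null ((g \<cdot> n) \<cdot> h)" using h' h g a n n' by simp
    qed (use g a n n' in simp)
  qed (use a n n' in auto)
  have "null (Sub f (f' \<cdot> u))"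
    using G
  proof (rule generator_null)
    fix G' h assume "G' \<in> {G}" "h \<in> Arr C" "Dom C h = G'" "Cod C h = Dom C (Sub f (f' \<cdot> u))"
    then have h: "h \<in> Arr C" "Dom C h = G" "Cod C h = Dom C n" using f f' u by simp_all
    obtain h' where h': "h' \<in> Arr C" "Dom C h' = G" "Cod C h' = Dom C n'" "n' \<cdot> h' = n \<cdot> h" "f' \<cdot> h' = f \<cdot> h"
      using gr[OF h] by blast
    have "n' \<cdot> (u \<cdot> h) = n \<cdot> h" by (rule Comp_eq_Comp[OF u(4)]) (use u h a in simp_all)
    then have "n' \<cdot> (u \<cdot> h) = n' \<cdot> h'" using h' by simp
    then have "u \<cdot> h = h'" by (rule mono_cancel[OF _ n'(1)]) (use u h h' in simp_all)
    then show "null (Sub f (f' \<cdot> u) \<cdot> h)" using h h' f f' u by (simp add: Sub_comp)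
  qed (use f f' u in simp)
  then have "f' \<cdot> u = f" using f f' u by simp
  then show thesis using that u by blast
qed

text \<open>All partial maps are extended at once: take the coproduct of \<open>X\<close> with one
  copy of \<open>G\<close> per partial map and divide by relations \<open>R j\<close> that identify
  \<open>ff j\<close> with \<open>nn j\<close>. \<open>X\<close> stays embedded because finitely
  many relations meet it trivially, and all of them together form a directed union of finite
  families.\<close>

lemma extend_all_partial_maps:
  assumes G: "generating C {G}" and X: "X \<in> Ob C"
  obtains e where "mono_arr C e" "Dom C e = X"
    "\<And>n f. mono_arr C n \<Longrightarrow> Cod C n = G \<Longrightarrow> f \<in> Arr C \<Longrightarrow> Dom C f = Dom C n \<Longrightarrow> Cod C f = X \<Longrightarrow>
      \<exists>w\<in>Arr C. Dom C w = G \<and> Cod C w = Cod C e \<and> w \<cdot> n = e \<cdot> f"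
proof -
  have GOb: "G \<in> Ob C" using G by (rule generating_Ob)
  define V where "V = {(n, f). mono_arr C n \<and> Cod C n = G \<and> f \<in> Arr C \<and> Dom C f = Dom C n \<and> Cod C f = X}"
  define graph where "graph = (\<lambda>(n, f). (\<lambda>h. (n \<cdot> h, f \<cdot> h)) ` Hom C G (Dom C n))"
  \<comment> \<open>One index per graph: graphs lie in a small power set, whereas the pairs in
    \<open>V\<close> need not form a small set.\<close>
  define J where "J = graph ` V"
  define nn where "nn j = fst (SOME v. v \<in> V \<and> graph v = j)" for j
  define ff where "ff j = snd (SOME v. v \<in> V \<and> graph v = j)" for j
  have V: "(nn j, ff j) \<in> V" "graph (nn j, ff j) = j" if j: "j \<in> J" for j
  proof -
    have "\<exists>v. v \<in> V \<and> graph v = j" using j by (auto simp: J_def)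
    from someI_ex[OF this] show "(nn j, ff j) \<in> V" "graph (nn j, ff j) = j" by (simp_all add: nn_def ff_def)
  qed
  have nf: "mono_arr C (nn j)" "nn j \<in> Arr C" "Cod C (nn j) = G" "ff j \<in> Arr C" "Dom C (ff j) = Dom C (nn j)"
    "Cod C (ff j) = X" if "j \<in> J" for j
    using V(1)[OF that] mono_arrD by (auto simp: V_def)
  have "graph v \<subseteq> Hom C G G \<times> Hom C G X" if "v \<in> V" for v
    using that mono_arrD[of "fst v"] by (cases v) (auto simp: V_def graph_def)
  then have "J \<subseteq> Pow (Hom C G G \<times> Hom C G X)" unfolding J_def by blast
  then have "small \<kappa> J"
    by (rule small_subset) (intro small_Pow small_Times inaccessible locally_small GOb X)
  then have K: "small \<kappa> ({None} \<union> Some ` J)"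
    using small_Un[OF inaccessible small_finite[OF inaccessible] small_image] by blast
  \<comment> \<open>\<open>None\<close> indexes the summand \<open>X\<close>, and
    \<open>Some j\<close> the copy of \<open>G\<close> that belongs to \<open>j\<close>.\<close>
  define Xs where "Xs i = (case i of None \<Rightarrow> X | Some _ \<Rightarrow> G)" for i :: "('m \<times> 'm) set option"
  have XOb: "Xs k \<in> Ob C" for k using GOb X by (auto simp: Xs_def split: option.splits)
  obtain S \<iota> where S: "is_coproduct C ({None} \<union> Some ` J) Xs S \<iota>"
    using small_coproduct[OF K XOb] .
  have \<iota>: "\<iota> None \<in> Arr C" "Dom C (\<iota> None) = X" "Cod C (\<iota> None) = S" "S \<in> Ob C"
    "\<And>j. j \<in> J \<Longrightarrow> \<iota> (Some j) \<in> Arr C" "\<And>j. j \<in> J \<Longrightarrow> Dom C (\<iota> (Some j)) = G"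
    "\<And>j. j \<in> J \<Longrightarrow> Cod C (\<iota> (Some j)) = S"
    using coproductD[OF S] by (auto simp: Xs_def)
  have proj: "\<exists>\<pi>. \<pi> \<in> Arr C \<and> Dom C \<pi> = S \<and> Cod C \<pi> = Xs i \<and> \<pi> \<cdot> \<iota> i = Id C (Xs i) \<and>
    (\<forall>k\<in>{None} \<union> Some ` J. k \<noteq> i \<longrightarrow> null (\<pi> \<cdot> \<iota> k))" if i: "i \<in> {None} \<union> Some ` J" for i
  proof -
    obtain \<pi> where \<pi>: "\<pi> \<in> Arr C" "Dom C \<pi> = S" "Cod C \<pi> = Xs i"
      "\<And>k. k \<in> {None} \<union> Some ` J \<Longrightarrow> \<pi> \<cdot> \<iota> k = (if k = i then Id C (Xs i) else Zero C (Xs k) (Xs i))"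
      by (rule coproduct_map[OF S XOb[of i], of "\<lambda>k. if k = i then Id C (Xs i) else Zero C (Xs k) (Xs i)"])
        (use XOb in auto)
    then show ?thesis using i XOb by (intro exI[of _ \<pi>]) auto
  qed
  define R where "R j = Sub (\<iota> None \<cdot> ff j) (\<iota> (Some j) \<cdot> nn j)" for j
  have R: "R j \<in> Arr C" "Cod C (R j) = S" "Dom C (R j) = Dom C (nn j)" if "j \<in> J" for j
    using nf[OF that] \<iota> that by (simp_all add: R_def)
  have R_comp: "h \<cdot> R j = Sub (h \<cdot> (\<iota> None \<cdot> ff j)) (h \<cdot> (\<iota> (Some j) \<cdot> nn j))"
    if "j \<in> J" "h \<in> Arr C" "Dom C h = S" for j h
    unfolding R_def by (rule Sub_comp) (use nf[OF that(1)] \<iota> that in simp_all)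
  \<comment> \<open>Relations are removed one at a time. The projection to the copy of
    \<open>G\<close> at \<open>j\<close> kills the summand \<open>X\<close> and the other relations,
    and sends \<open>R j\<close> to minus \<open>nn j\<close>, which is monic; so
    \<open>span_insert_null\<close> drops \<open>R j\<close>.\<close>
  have independent: "null y"
    if "finite L" "L \<subseteq> J" "y \<in> Arr C" "Cod C y = X" "\<iota> None \<cdot> y \<in> span S (R ` L)" for L y
    using that
  proof (induction L)
    case empty
    obtain \<pi> where \<pi>: "\<pi> \<in> Arr C" "Dom C \<pi> = S" "Cod C \<pi> = X" "\<pi> \<cdot> \<iota> None = Id C X"
      using proj[of None] by (auto simp: Xs_def)
    have "null (\<pi> \<cdot> (\<iota> None \<cdot> y))" by (rule spanD[OF empty(4)]) (use \<pi> in auto)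
    moreover have "\<pi> \<cdot> (\<iota> None \<cdot> y) = Id C X \<cdot> y"
      by (rule Comp_eq_Comp[OF \<pi>(4)]) (use \<pi> \<iota> empty in simp_all)
    ultimately show ?case using empty by simp
  next
    case (insert j L)
    then have j: "j \<in> J" "L \<subseteq> J" by auto
    obtain \<pi> where \<pi>: "\<pi> \<in> Arr C" "Dom C \<pi> = S" "Cod C \<pi> = G" "\<pi> \<cdot> \<iota> (Some j) = Id C G"
      "\<And>k. k \<in> {None} \<union> Some ` J \<Longrightarrow> k \<noteq> Some j \<Longrightarrow> null (\<pi> \<cdot> \<iota> k)"
      using proj[of "Some j"] j by (auto simp: Xs_def)
    have None: "null (\<pi> \<cdot> (\<iota> None \<cdot> z))" if "z \<in> Arr C" "Cod C z = X" for z
      by (rule null_comp3) (use \<pi> \<iota> that in auto)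
    have "\<iota> None \<cdot> y \<in> span S (R ` L)"
    proof (rule span_insert_null[where k = "R j" and \<rho> = \<pi>])
      show "\<iota> None \<cdot> y \<in> span S (insert (R j) (R ` L))" using insert by simp
      show "null (\<pi> \<cdot> r)" if "r \<in> R ` L" for r
      proof -
        obtain l where l: "l \<in> L" "r = R l" using \<open>r \<in> R ` L\<close> by blast
        then have "l \<in> J" "l \<noteq> j" using insert by auto
        then have "null (\<pi> \<cdot> (\<iota> (Some l) \<cdot> nn l))" by (intro null_comp3 \<pi>(5)) (use \<pi> \<iota> nf in auto)
        then show ?thesis
          using l \<open>l \<in> J\<close> None[of "ff l"] nf[OF \<open>l \<in> J\<close>] \<pi> \<iota> by (simp add: R_comp Sub_null2)
      qed
      have "\<pi> \<cdot> (\<iota> (Some j) \<cdot> nn j) = nn j"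
        using Comp_eq_Comp[OF \<pi>(4), of "nn j"] nf[OF j(1)] \<iota> j \<pi> by simp
      then have \<pi>R: "\<pi> \<cdot> R j = Sub (\<pi> \<cdot> (\<iota> None \<cdot> ff j)) (nn j)"
        using j(1) \<pi> by (simp add: R_comp)
      show "mono_arr C (\<pi> \<cdot> R j)"
        unfolding mono_arr_iff
      proof (intro conjI ballI impI)
        fix z assume z: "z \<in> Arr C" "Cod C z = Dom C (\<pi> \<cdot> R j)" "null ((\<pi> \<cdot> R j) \<cdot> z)"
        then have zc: "Cod C z = Dom C (nn j)" using R[OF j(1)] \<pi> by simp
        have "null (\<pi> \<cdot> (\<iota> None \<cdot> (ff j \<cdot> z)))" using None[of "ff j \<cdot> z"] nf[OF j(1)] z(1) zc by simp
        moreover have "null (Sub (\<pi> \<cdot> (\<iota> None \<cdot> (ff j \<cdot> z))) (nn j \<cdot> z))"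
          using z(1,3) zc nf[OF j(1)] \<iota> \<pi>(1-3) unfolding \<pi>R by (simp add: Sub_comp)
        ultimately have "null (nn j \<cdot> z)"
          by (rule null_Sub_null) (use z(1) zc nf[OF j(1)] \<iota> \<pi>(1-3) in simp_all)
        then show "null z" using mono_null_iff nf[OF j(1)] z zc by blast
      qed (use R[OF j(1)] \<pi> in simp)
    qed (use \<pi> R j None insert \<iota> in auto)
    then show ?case using insert j by simp
  qed
  obtain q where q: "epi_arr C q" "q \<in> Arr C" "Dom C q = S"
    "\<And>x. x \<in> Arr C \<Longrightarrow> Cod C x = S \<Longrightarrow> null (q \<cdot> x) \<longleftrightarrow> x \<in> span S (R ` J)"
    by (rule joint_cokernel[OF \<iota>(4), of "R ` J"]) (use R in auto)
  have "mono_arr C (q \<cdot> \<iota> None)"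
    unfolding mono_arr_iff
  proof (intro conjI ballI impI)
    fix x assume x: "x \<in> Arr C" "Cod C x = Dom C (q \<cdot> \<iota> None)" "null ((q \<cdot> \<iota> None) \<cdot> x)"
    then have x': "Cod C x = X" "null (q \<cdot> (\<iota> None \<cdot> x))" using q \<iota> by simp_all
    define \<D> where "\<D> = {R ` L |L. finite L \<and> L \<subseteq> J}"
    show "null x"
    proof (rule directed_span_null[of S \<D> "\<iota> None \<cdot> x" x])
      show "S \<in> Ob C" by (rule \<iota>)
      show "\<D> \<noteq> {}" by (auto simp: \<D>_def)
      show "\<exists>T\<in>\<D>. A \<subseteq> T \<and> B \<subseteq> T" if AB: "A \<in> \<D>" "B \<in> \<D>" for A B
      proof -
        obtain L L' where L: "A = R ` L" "B = R ` L'" "finite L" "finite L'" "L \<subseteq> J" "L' \<subseteq> J"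
          using AB by (auto simp: \<D>_def)
        then have "finite (L \<union> L') \<and> L \<union> L' \<subseteq> J" by simp
        then have "R ` (L \<union> L') \<in> \<D>" unfolding \<D>_def by blast
        then show ?thesis by (rule bexI[rotated]) (simp add: L image_mono)
      qed
      show "r \<in> Arr C \<and> Cod C r = S" if "A \<in> \<D>" "r \<in> A" for A r using that R by (auto simp: \<D>_def)
      have "\<iota> None \<cdot> x \<in> span S (R ` J)" using q(4)[of "\<iota> None \<cdot> x"] x x' \<iota> by simp
      moreover have "R ` J \<subseteq> \<Union>\<D>"
      proof
        fix r assume "r \<in> R ` J"
        then obtain j where "j \<in> J" "r = R j" by blast
        then have "R ` {j} \<in> \<D>" "r \<in> R ` {j}" unfolding \<D>_def by blast+
        then show "r \<in> \<Union>\<D>" by blast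
      qed
      ultimately show "\<iota> None \<cdot> x \<in> span S (\<Union>\<D>)" using span_mono by blast
      show "x \<in> Arr C" "Dom C x = Dom C (\<iota> None \<cdot> x)" using x x' \<iota> by simp_all
      fix A z assume z: "A \<in> \<D>" "z \<in> Arr C" "Cod C z = Dom C (\<iota> None \<cdot> x)" "(\<iota> None \<cdot> x) \<cdot> z \<in> span S A"
      then have z': "Cod C z = Dom C x" "\<iota> None \<cdot> (x \<cdot> z) \<in> span S A" using x x' \<iota> by simp_all
      obtain L where L: "A = R ` L" "finite L" "L \<subseteq> J" using z by (auto simp: \<D>_def)
      show "null (x \<cdot> z)" by (rule independent[OF L(2,3)]) (use z z' x x' L in simp_all)
    qed
  qed (use q \<iota> in simp)
  moreover have "\<exists>w\<in>Arr C. Dom C w = G \<and> Cod C w = Cod C (q \<cdot> \<iota> None) \<and> w \<cdot> n = (q \<cdot> \<iota> None) \<cdot> f"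
    if n: "mono_arr C n" "Cod C n = G" and f: "f \<in> Arr C" "Dom C f = Dom C n" "Cod C f = X" for n f
  proof -
    \<comment> \<open>The chosen representative has the same graph, so one arrow \<open>u\<close>
      factors both \<open>n\<close> and \<open>f\<close> through it, and the inclusion of the copy
      of \<open>G\<close> at \<open>j\<close> extends \<open>f\<close>.\<close>
    define j where "j = graph (n, f)"
    have j: "j \<in> J" using n f by (auto simp: j_def J_def V_def)
    note nfj = nf[OF j] and n' = mono_arrD[OF n(1)]
    have "(\<lambda>h. (n \<cdot> h, f \<cdot> h)) ` Hom C G (Dom C n) = (\<lambda>h. (nn j \<cdot> h, ff j \<cdot> h)) ` Hom C G (Dom C (nn j))"
      using V(2)[OF j] by (simp add: j_def graph_def)
    then obtain u where u: "u \<in> Arr C" "Dom C u = Dom C n" "Cod C u = Dom C (nn j)" "nn j \<cdot> u = n" "ff j \<cdot> u = f"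
      by (rule graph_determines_partial_map[OF G n nfj(1,3) f(1,2) nfj(4,5), rotated]) (use nfj f in auto)
    have "null (q \<cdot> R j)" using q(4)[of "R j"] R j by (auto intro: span_superset)
    then have eq: "q \<cdot> (\<iota> None \<cdot> ff j) = q \<cdot> (\<iota> (Some j) \<cdot> nn j)"
      using R_comp[OF j q(2,3)] nfj \<iota> q(2,3) j by simp
    have "(q \<cdot> \<iota> (Some j)) \<cdot> n = (q \<cdot> \<iota> (Some j)) \<cdot> (nn j \<cdot> u)" using u by simp
    also have "\<dots> = (q \<cdot> (\<iota> (Some j) \<cdot> nn j)) \<cdot> u" using u(1-3) nfj \<iota> q(2,3) j by simp
    also have "\<dots> = (q \<cdot> (\<iota> None \<cdot> ff j)) \<cdot> u" using eq by simp
    also have "\<dots> = (q \<cdot> \<iota> None) \<cdot> (ff j \<cdot> u)" using u(1-3) nfj \<iota> q(2,3) by simp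
    also have "\<dots> = (q \<cdot> \<iota> None) \<cdot> f" using u by simp
    finally show ?thesis by (intro bexI[of _ "q \<cdot> \<iota> (Some j)"]) (use j \<iota> q in simp_all)
  qed
  ultimately show thesis using that[of "q \<cdot> \<iota> None"] q \<iota> by simp
qed

end

context accessible_grothendieck_category
begin

text \<open>The colimit of \<open>X \<rightarrow> X\<^sub>1 \<rightarrow> X\<^sub>2 \<rightarrow> \<dots>\<close>, where every partial map from \<open>G\<close> to \<open>X\<^sub>n\<close> extends after passing to
  \<open>X\<^sub>n\<^sub>+\<^sub>1\<close>. Maps from noetherian objects factor through some \<open>X\<^sub>n\<close>, so no longer tower is needed.\<close>

lemma extend_noetherian_partial_maps:
  assumes G: "generating C {G}" and X: "X \<in> Ob C"
  obtains e where "mono_arr C e" "Dom C e = X"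
    "\<And>n f. mono_arr C n \<Longrightarrow> Cod C n = G \<Longrightarrow> noetherian_object C (Dom C n) \<Longrightarrow>
      f \<in> Arr C \<Longrightarrow> Dom C f = Dom C n \<Longrightarrow> Cod C f = Cod C e \<Longrightarrow>
      \<exists>w\<in>Arr C. Dom C w = G \<and> Cod C w = Cod C e \<and> w \<cdot> n = f"
proof -
  define ext where "ext Y e \<longleftrightarrow> mono_arr C e \<and> Dom C e = Y \<and>
    (\<forall>n f. mono_arr C n \<longrightarrow> Cod C n = G \<longrightarrow> f \<in> Arr C \<longrightarrow> Dom C f = Dom C n \<longrightarrow> Cod C f = Y \<longrightarrow>
      (\<exists>w\<in>Arr C. Dom C w = G \<and> Cod C w = Cod C e \<and> w \<cdot> n = e \<cdot> f))" for Y e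
  define \<sigma> where "\<sigma> Y = (SOME e. ext Y e)" for Y
  have \<sigma>: "ext Y (\<sigma> Y)" if Y: "Y \<in> Ob C" for Y
  proof -
    obtain e where "ext Y e"
      by (rule extend_all_partial_maps[OF G Y]) (auto simp: ext_def)
    then show ?thesis unfolding \<sigma>_def by (rule someI)
  qed
  define Xs where "Xs = rec_nat X (\<lambda>_ Y. Cod C (\<sigma> Y))"
  define e where "e n = \<sigma> (Xs n)" for n
  have Xs: "Xs 0 = X" "Xs (Suc n) = Cod C (e n)" for n by (simp_all add: Xs_def e_def)
  have XsOb: "Xs n \<in> Ob C" for n
  proof (induction n)
    case (Suc n)
    then show ?case using \<sigma>[OF Suc] mono_arrD[of "e n"] Xs by (simp add: ext_def e_def)
  qed (use X Xs in simp)
  have e_ext: "ext (Xs n) (e n)" for n using \<sigma>[OF XsOb] by (simp add: e_def)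
  have e: "mono_arr C (e n)" "e n \<in> Arr C" "Dom C (e n) = Xs n" "Cod C (e n) = Xs (Suc n)" for n
    using e_ext[of n] mono_arrD[of "e n"] Xs by (simp_all add: ext_def)
  obtain T \<iota> where T: "is_coproduct C UNIV Xs T \<iota>"
    using small_coproduct[OF small_nat[OF inaccessible] XsOb] .
  have \<iota>: "\<iota> n \<in> Arr C" "Dom C (\<iota> n) = Xs n" "Cod C (\<iota> n) = T" "T \<in> Ob C" for n
    using coproductD[OF T] by simp_all
  \<comment> \<open>Telescope for the colimit: killing \<open>R k\<close> identifies stage
    \<open>k\<close> with its image in stage \<open>Suc k\<close>. Hence \<open>q\<close> maps the
    coproduct to the colimit, with leg \<open>\<mu> n\<close> at stage \<open>n\<close>.\<close>
  define R where "R k = Sub (\<iota> (Suc k) \<cdot> e k) (\<iota> k)" for k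
  have R: "R k \<in> Arr C" "Cod C (R k) = T" "Dom C (R k) = Xs k" for k
    using \<iota> e by (simp_all add: R_def)
  have R_comp: "h \<cdot> R k = Sub (h \<cdot> (\<iota> (Suc k) \<cdot> e k)) (h \<cdot> \<iota> k)"
    if "h \<in> Arr C" "Dom C h = T" for h k
    unfolding R_def by (rule Sub_comp) (use e \<iota> that in simp_all)
  obtain q where q: "epi_arr C q" "q \<in> Arr C" "Dom C q = T"
    "\<And>x. x \<in> Arr C \<Longrightarrow> Cod C x = T \<Longrightarrow> null (q \<cdot> x) \<longleftrightarrow> x \<in> span T (range R)"
    by (rule joint_cokernel[OF \<iota>(4), of "range R"]) (use R in auto)
  define \<mu> where "\<mu> n = q \<cdot> \<iota> n" for n
  have \<mu>: "\<mu> n \<in> Arr C" "Dom C (\<mu> n) = Xs n" "Cod C (\<mu> n) = Cod C q" for n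
    using q \<iota> by (simp_all add: \<mu>_def)
  have \<mu>_e: "\<mu> (Suc n) \<cdot> e n = \<mu> n" for n
  proof -
    have "null (q \<cdot> R n)" using q(4)[of "R n"] R by (auto intro: span_superset)
    then show ?thesis using R_comp[OF q(2,3), of n] q \<iota> e by (simp add: \<mu>_def)
  qed
  \<comment> \<open>The map to stage \<open>M\<close> follows the tower on stages up to
    \<open>M\<close> and is zero on later ones. It respects only the relations below
    \<open>M\<close>: in \<open>R M\<close> the term from stage \<open>Suc M\<close> is
    lost.\<close>
  have truncate: "\<exists>g\<in>Arr C. Dom C g = T \<and> (\<forall>k<M. null (g \<cdot> R k)) \<and> (\<forall>k\<le>M. mono_arr C (g \<cdot> \<iota> k))" for M
  proof -
    \<comment> \<open>\<open>c d\<close> runs from stage \<open>M - d\<close> to stage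
      \<open>M\<close>; the recursion adds arrows on the right, hence the descending index.\<close>
    define c where "c = rec_nat (Id C (Xs M)) (\<lambda>d u. u \<cdot> e (M - Suc d))"
    have c_Suc: "c (Suc d) = c d \<cdot> e (M - Suc d)" for d by (simp add: c_def)
    have c: "mono_arr C (c d) \<and> Dom C (c d) = Xs (M - d) \<and> Cod C (c d) = Xs M" if "d \<le> M" for d
      using that
    proof (induction d)
      case 0
      then show ?case using XsOb by (simp add: c_def)
    next
      case (Suc d)
      have "Suc (M - Suc d) = M - d" using Suc by simp
      then show ?case unfolding c_Suc
        using Suc e[of "M - Suc d"] mono_comp[OF e(1)[of "M - Suc d"], of "c d"] mono_arrD[of "c d"] by simp
    qed
    obtain g where g: "g \<in> Arr C" "Dom C g = T" "Cod C g = Xs M"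
      "\<And>k. g \<cdot> \<iota> k = (if k \<le> M then c (M - k) else Zero C (Xs k) (Xs M))"
      by (rule coproduct_map[OF T XsOb[of M], of "\<lambda>k. if k \<le> M then c (M - k) else Zero C (Xs k) (Xs M)"])
        (use XsOb c mono_arrD in auto)
    have "null (g \<cdot> R k)" if k: "k < M" for k
    proof -
      have "M - Suc (M - Suc k) = k" "M - k = Suc (M - Suc k)" using k by simp_all
      then have "c (M - k) = c (M - Suc k) \<cdot> e k" using c_Suc[of "M - Suc k"] by simp
      moreover have "g \<cdot> (\<iota> (Suc k) \<cdot> e k) = c (M - Suc k) \<cdot> e k"
        by (rule Comp_eq_Comp) (use g k e \<iota> in auto)
      ultimately show ?thesis using R_comp[OF g(1,2), of k] g k c[of "M - k"] mono_arrD by simp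
    qed
    then show ?thesis using g c by (intro bexI[of _ g]) auto
  qed
  have \<mu>_mono: "mono_arr C (\<mu> n)" for n
    unfolding mono_arr_iff
  proof (intro conjI ballI impI)
    fix x assume x: "x \<in> Arr C" "Cod C x = Dom C (\<mu> n)" "null (\<mu> n \<cdot> x)"
    then have x': "Cod C x = Xs n" "null (q \<cdot> (\<iota> n \<cdot> x))" using q \<iota> by (simp_all add: \<mu>_def)
    show "null x"
    proof (rule directed_span_null[of T "range (\<lambda>m::nat. R ` {..<m})" "\<iota> n \<cdot> x" x])
      show "\<exists>B\<in>range (\<lambda>m. R ` {..<m}). A \<subseteq> B \<and> A' \<subseteq> B"
        if A: "A \<in> range (\<lambda>m. R ` {..<m})" "A' \<in> range (\<lambda>m. R ` {..<m})" for A A'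
      proof -
        obtain m m' where "A = R ` {..<m}" "A' = R ` {..<m'}" using A by blast
        then have "A \<subseteq> R ` {..<max m m'}" "A' \<subseteq> R ` {..<max m m'}" by auto
        then show ?thesis by blast
      qed
      have "\<iota> n \<cdot> x \<in> span T (range R)" using q(4)[of "\<iota> n \<cdot> x"] x x' \<iota> by simp
      moreover have "range R \<subseteq> (\<Union>m. R ` {..<m})" by blast
      ultimately show "\<iota> n \<cdot> x \<in> span T (\<Union>m. R ` {..<m})" using span_mono by blast
      fix A z assume z: "A \<in> range (\<lambda>m. R ` {..<m})" "z \<in> Arr C" "Cod C z = Dom C (\<iota> n \<cdot> x)" "(\<iota> n \<cdot> x) \<cdot> z \<in> span T A"
      then have z': "Cod C z = Dom C x" "\<iota> n \<cdot> (x \<cdot> z) \<in> span T A" using x x' \<iota> by simp_all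
      obtain m where m: "A = R ` {..<m}" using z by blast
      \<comment> \<open>The bound \<open>max n m\<close> makes the relations below \<open>m\<close>
        die and at the same time keeps stage \<open>n\<close> embedded.\<close>
      obtain g where g: "g \<in> Arr C" "Dom C g = T" "\<forall>k<max n m. null (g \<cdot> R k)" "mono_arr C (g \<cdot> \<iota> n)"
        using truncate[of "max n m"] by auto
      have "null (g \<cdot> (\<iota> n \<cdot> (x \<cdot> z)))"
        by (rule spanD[OF z'(2) g(1,2)]) (use g(3) m in auto)
      then have "null ((g \<cdot> \<iota> n) \<cdot> (x \<cdot> z))" using g(1,2) x(1) x'(1) z(2) z'(1) \<iota> by simp
      then show "null (x \<cdot> z)" using mono_null_iff[OF g(4), of "x \<cdot> z"] g(1,2) x(1) x'(1) z(2) z'(1) \<iota> by simp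
    qed (use \<iota> R x x' in auto)
  qed (rule \<mu>)
  have \<mu>_le: "\<mu> k \<in> span (Cod C q) {\<mu> n}" if "k \<le> n" for k n
    using that
  proof (induction n)
    case 0
    then show ?case using \<mu> by (auto intro: span_superset)
  next
    case (Suc n)
    show ?case
    proof (cases "k = Suc n")
      case True
      then show ?thesis using \<mu> by (auto intro: span_superset)
    next
      case False
      have "\<mu> (Suc n) \<cdot> e n \<in> span (Cod C q) {\<mu> (Suc n)}"
        by (rule span_comp) (use \<mu> e in \<open>auto intro: span_superset\<close>)
      then have "span (Cod C q) {\<mu> n} \<subseteq> span (Cod C q) {\<mu> (Suc n)}"
        using \<mu>_e by (intro span_subset) auto
      then show ?thesis using Suc False by auto
    qed
  qed
  have extends: "\<exists>w\<in>Arr C. Dom C w = G \<and> Cod C w = Cod C (\<mu> 0) \<and> w \<cdot> n = f"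
    if n: "mono_arr C n" "Cod C n = G" "noetherian_object C (Dom C n)"
      and f: "f \<in> Arr C" "Dom C f = Dom C n" "Cod C f = Cod C (\<mu> 0)" for n f
  proof -
    have "\<exists>A\<in>range (\<lambda>m::nat. \<mu> ` {..m}). f \<in> span (Cod C q) A"
    proof (rule noetherian_factor)
      show "noetherian_object C (Dom C f)" using n f by simp
      show "\<exists>B\<in>range (\<lambda>m. \<mu> ` {..m}). A \<subseteq> B \<and> A' \<subseteq> B"
        if A: "A \<in> range (\<lambda>m. \<mu> ` {..m})" "A' \<in> range (\<lambda>m. \<mu> ` {..m})" for A A'
      proof -
        obtain m m' where "A = \<mu> ` {..m}" "A' = \<mu> ` {..m'}" using A by blast
        then have "A \<subseteq> \<mu> ` {..max m m'}" "A' \<subseteq> \<mu> ` {..max m m'}" by auto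
        then show ?thesis by blast
      qed
      show "f \<in> span (Cod C q) (\<Union>m. \<mu> ` {..m})"
      proof (rule spanI)
        fix g assume g: "g \<in> Arr C" "Dom C g = Cod C q" "\<And>r. r \<in> (\<Union>m. \<mu> ` {..m}) \<Longrightarrow> null (g \<cdot> r)"
        have "null (g \<cdot> q)"
        proof (rule coproduct_null[OF T])
          show "null ((g \<cdot> q) \<cdot> \<iota> k)" for k using g(3)[of "\<mu> k"] g(1,2) q(2,3) \<iota> by (auto simp: \<mu>_def)
        qed (use g q in simp_all)
        then have "null g" using epi_null_iff[OF q(1)] g by blast
        then show "null (g \<cdot> f)" using g(1,2) f \<mu> by simp
      qed (use f \<mu> in auto)
    qed (use q \<mu> in auto)
    then obtain m where "f \<in> span (Cod C q) (\<mu> ` {..m})" by blast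
    moreover have "span (Cod C q) (\<mu> ` {..m}) \<subseteq> span (Cod C q) {\<mu> m}"
      by (rule span_subset) (use \<mu>_le in auto)
    ultimately have "f \<in> span (Cod C (\<mu> m)) {\<mu> m}" using \<mu> by auto
    then obtain u where u: "u \<in> Arr C" "Dom C u = Dom C n" "Cod C u = Xs m" "\<mu> m \<cdot> u = f"
      by (rule span_mono_factor[OF _ \<mu>_mono]) (use \<mu> f in auto)
    obtain w where w: "w \<in> Arr C" "Dom C w = G" "Cod C w = Xs (Suc m)" "w \<cdot> n = e m \<cdot> u"
      using e_ext[of m] n(1,2) u e unfolding ext_def by metis
    have "(\<mu> (Suc m) \<cdot> w) \<cdot> n = \<mu> (Suc m) \<cdot> (w \<cdot> n)"
      by (rule Comp_assoc_simp) (use \<mu> w n mono_arrD[OF n(1)] in simp_all)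
    also have "\<dots> = \<mu> (Suc m) \<cdot> (e m \<cdot> u)" using w by simp
    also have "\<dots> = \<mu> m \<cdot> u" by (rule Comp_eq_Comp[OF \<mu>_e]) (use \<mu> e u in simp_all)
    finally have "(\<mu> (Suc m) \<cdot> w) \<cdot> n = f" using u by simp
    then show ?thesis by (intro bexI[of _ "\<mu> (Suc m) \<cdot> w"]) (use \<mu> w in simp_all)
  qed
  show thesis
  proof (rule that[of "\<mu> 0"])
    show "Dom C (\<mu> 0) = X" using \<mu> Xs by simp
  qed (use \<mu>_mono extends in blast)+
qed

text \<open>Baer's criterion. Choose a quotient \<open>W \<rightarrow> V\<close> with largest kernel among those restricting to a monomorphism
  on \<open>E\<close>. Then \<open>E \<rightarrow> V\<close> is an isomorphism, because otherwise the extension property yields a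
  subobject of \<open>V\<close> meeting \<open>E\<close> trivially.\<close>

lemma extension_property_retract:
  assumes \<G>: "generating C \<G>"
    and ext: "\<And>n f. Cod C n \<in> \<G> \<Longrightarrow> mono_arr C n \<Longrightarrow> f \<in> Arr C \<Longrightarrow> Dom C f = Dom C n \<Longrightarrow> Cod C f = E \<Longrightarrow>
      \<exists>w\<in>Arr C. Dom C w = Cod C n \<and> Cod C w = E \<and> w \<cdot> n = f"
    and e: "mono_arr C e" "Dom C e = E"
  obtains \<rho> where "\<rho> \<in> Arr C" "Dom C \<rho> = Cod C e" "Cod C \<rho> = E" "\<rho> \<cdot> e = Id C E"
proof -
  note e' = mono_arrD[OF e(1)]
  define W where "W = Cod C e"
  have W: "W \<in> Ob C" "Cod C e = W" using e' by (simp_all add: W_def)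
  \<comment> \<open>Quotients of \<open>W\<close> are compared through the arrows they kill, so
    Zorn's lemma for set inclusion applies.\<close>
  define Ker where "Ker q = {x \<in> Arr C. Cod C x = W \<and> null (q \<cdot> x)}" for q
  define \<A> where "\<A> = {Ker q |q. epi_arr C q \<and> Dom C q = W \<and> mono_arr C (q \<cdot> e)}"
  have "\<exists>S\<in>\<A>. \<forall>T\<in>\<A>. S \<subseteq> T \<longrightarrow> T = S"
  proof (rule subset_Zorn)
    fix \<C> assume chain: "subset.chain \<A> \<C>"
    show "\<exists>U\<in>\<A>. \<forall>T\<in>\<C>. T \<subseteq> U"
    proof (cases "\<C> = {}")
      case True
      have "Ker (Id C W) \<in> \<A>"
        using W e e' unfolding \<A>_def by (intro CollectI exI[of _ "Id C W"]) simp
      then show ?thesis by (rule bexI[rotated]) (simp add: True)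
    next
      case False
      have \<C>: "\<exists>q. T = Ker q \<and> epi_arr C q \<and> q \<in> Arr C \<and> Dom C q = W \<and> mono_arr C (q \<cdot> e)" if T: "T \<in> \<C>" for T
      proof -
        have "T \<in> \<A>" using chain T unfolding subset_chain_def by blast
        then obtain q where "T = Ker q" "epi_arr C q" "Dom C q = W" "mono_arr C (q \<cdot> e)"
          unfolding \<A>_def by blast
        then show ?thesis using epi_arrD by blast
      qed
      have arr: "r \<in> Arr C \<and> Cod C r = W" if "T \<in> \<C>" "r \<in> T" for T r
        using \<C>[OF that(1)] that(2) by (auto simp: Ker_def)
      \<comment> \<open>The upper bound of a chain is the quotient by the sum of its kernels;
        exactness reduces injectivity on \<open>E\<close> to the members of the chain.\<close>
      obtain q where q: "epi_arr C q" "q \<in> Arr C" "Dom C q = W"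
        "\<And>x. x \<in> Arr C \<Longrightarrow> Cod C x = W \<Longrightarrow> null (q \<cdot> x) \<longleftrightarrow> x \<in> span W (\<Union>\<C>)"
        by (rule joint_cokernel[OF W(1), of "\<Union>\<C>"]) (use arr in auto)
      have "mono_arr C (q \<cdot> e)"
        unfolding mono_arr_iff
      proof (intro conjI ballI impI)
        fix x assume x: "x \<in> Arr C" "Cod C x = Dom C (q \<cdot> e)" "null ((q \<cdot> e) \<cdot> x)"
        then have x': "Cod C x = Dom C e" "null (q \<cdot> (e \<cdot> x))" using q e' W by simp_all
        show "null x"
        proof (rule directed_span_null[of W \<C> "e \<cdot> x" x])
          show "W \<in> Ob C" "\<C> \<noteq> {}" by fact+
          show "r \<in> Arr C \<and> Cod C r = W" if "T \<in> \<C>" "r \<in> T" for T r using that by (rule arr)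
          show "\<exists>T\<in>\<C>. A \<subseteq> T \<and> B \<subseteq> T" if AB: "A \<in> \<C>" "B \<in> \<C>" for A B
          proof -
            have "A \<subseteq> B \<or> B \<subseteq> A" using chain AB unfolding subset_chain_def by blast
            then show ?thesis using AB by auto
          qed
          show "e \<cdot> x \<in> span W (\<Union>\<C>)" using q(4)[of "e \<cdot> x"] x x' e' W by simp
          fix T z assume z: "T \<in> \<C>" "z \<in> Arr C" "Cod C z = Dom C (e \<cdot> x)" "(e \<cdot> x) \<cdot> z \<in> span W T"
          then have z': "Cod C z = Dom C x" "e \<cdot> (x \<cdot> z) \<in> span W T" using x(1) x'(1) e' by simp_all
          obtain p where p: "T = Ker p" "p \<in> Arr C" "Dom C p = W" "mono_arr C (p \<cdot> e)" using \<C>[OF z(1)] by blast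
          have "null (p \<cdot> (e \<cdot> (x \<cdot> z)))" by (rule spanD[OF z'(2) p(2,3)]) (use p in \<open>simp add: Ker_def\<close>)
          then show "null (x \<cdot> z)"
            using mono_null_iff[OF p(4), of "x \<cdot> z"] p(2,3) x(1) x'(1) z(2) z'(1) e' W by simp
        qed (use x(1) x'(1) e' in simp_all)
      qed (use q e' W in simp)
      then have "Ker q \<in> \<A>" using q unfolding \<A>_def by blast
      moreover have "T \<subseteq> Ker q" if "T \<in> \<C>" for T
        using arr[OF that] q(4) that by (auto simp: Ker_def intro!: span_superset)
      ultimately show ?thesis by blast
    qed
  qed
  then obtain q where q: "epi_arr C q" "Dom C q = W" "mono_arr C (q \<cdot> e)"
    and max: "\<And>q'. epi_arr C q' \<Longrightarrow> Dom C q' = W \<Longrightarrow> mono_arr C (q' \<cdot> e) \<Longrightarrow> Ker q \<subseteq> Ker q' \<Longrightarrow> Ker q' = Ker q"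
    unfolding \<A>_def by blast
  note q' = epi_arrD[OF q(1)]
  define a where "a = q \<cdot> e"
  have a: "mono_arr C a" "a \<in> Arr C" "Dom C a = E" "Cod C a = Cod C q" using q q' e e' W by (simp_all add: a_def)
  \<comment> \<open>A \<open>y\<close> that meets the image of \<open>a\<close> trivially can be
    divided out with \<open>E\<close> still embedded. By maximality nothing new is killed, so the
    cokernel of \<open>y\<close> is monic and \<open>y\<close> is zero.\<close>
  have maximal: "null y" if y: "y \<in> Arr C" "Cod C y = Cod C q"
    and indep: "\<And>x v. x \<in> Arr C \<Longrightarrow> v \<in> Arr C \<Longrightarrow> Cod C x = E \<Longrightarrow> Cod C v = Dom C y \<Longrightarrow> Dom C x = Dom C v \<Longrightarrow>
      y \<cdot> v = a \<cdot> x \<Longrightarrow> null x" for y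
  proof -
    obtain k where k: "is_cokernel C y k" using ex_cokernel y by blast
    note k' = is_cokernelD(2-5)[OF k]
    have "mono_arr C ((k \<cdot> q) \<cdot> e)"
      unfolding mono_arr_iff
    proof (intro conjI ballI impI)
      fix x assume x: "x \<in> Arr C" "Cod C x = Dom C ((k \<cdot> q) \<cdot> e)" "null (((k \<cdot> q) \<cdot> e) \<cdot> x)"
      then have x': "Cod C x = E" "null (k \<cdot> (a \<cdot> x))" using k' q q' y e e' W by (simp_all add: a_def)
      have "a \<cdot> x \<in> span (Cod C y) {y}"
        by (rule spanI) (use cokernel_null_iff[OF k _ _ _ _ _ x'(2)] x x' a y in auto)
      then obtain r v where rv: "epi_arr C r" "r \<in> Arr C" "v \<in> Arr C" "Cod C r = Dom C (a \<cdot> x)" "Cod C v = Dom C y"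
        "Dom C v = Dom C r" "y \<cdot> v = (a \<cdot> x) \<cdot> r"
        by (rule span_factor_epi) (use y in auto)
      have r: "Cod C r = Dom C x" "y \<cdot> v = a \<cdot> (x \<cdot> r)" using rv x(1) x'(1) a by simp_all
      have "null (x \<cdot> r)" by (rule indep[OF _ rv(3) _ rv(5) _ r(2)]) (use rv r x(1) x'(1) in simp_all)
      then show "null x" using epi_null_iff[OF rv(1), of x] x r by simp
    qed (use k' q q' y e' W in simp)
    moreover have kq: "epi_arr C (k \<cdot> q)" by (rule epi_comp) (use k' q y in simp_all)
    moreover have "Ker q \<subseteq> Ker (k \<cdot> q)"
      using k' q q' y by (auto simp: Ker_def)
    ultimately have Ker_eq: "Ker (k \<cdot> q) = Ker q" using max[of "k \<cdot> q"] k' q q' y by simp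
    have "mono_arr C k"
      using q(1)
    proof (rule cokernel_comp_mono)
      fix x assume x: "x \<in> Arr C" "Cod C x = Dom C q" "null (k \<cdot> (q \<cdot> x))"
      then have "x \<in> Ker (k \<cdot> q)" using k' q(2) q' y by (simp add: Ker_def)
      then show "null (q \<cdot> x)" unfolding Ker_eq by (simp add: Ker_def)
    qed (use k' y in simp_all)
    then show "null y" using mono_null_iff[of k y] k' y by simp
  qed
  have "epi_arr C a"
    unfolding epi_arr_iff
  proof (intro conjI ballI impI a)
    fix t assume t: "t \<in> Arr C" "Dom C t = Cod C a" "null (t \<cdot> a)"
    show "null t"
      using \<G> t(1)
    proof (rule generator_null)
      fix G y assume y: "G \<in> \<G>" "y \<in> Arr C" "Dom C y = G" "Cod C y = Dom C t"
      then have y': "Cod C y = Cod C q" using t a by simp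
      obtain c where c: "is_cokernel C a c" using ex_cokernel a by blast
      note c' = is_cokernelD(2-5)[OF c]
      \<comment> \<open>\<open>n\<close> is the part of \<open>G\<close> that \<open>y\<close> sends
        into the image of \<open>a\<close>; \<open>z\<close> is the resulting partial map to
        \<open>E\<close>, and \<open>w\<close> its extension to \<open>G\<close>.\<close>
      obtain n where n: "is_kernel C (c \<cdot> y) n" using ex_kernel[of "c \<cdot> y"] c' y y' a by auto
      have n': "n \<in> Arr C" "Cod C n = G" "null (c \<cdot> (y \<cdot> n))" "mono_arr C n"
        using is_kernelD(1-5)[OF n] c' y y' a by auto
      obtain z where z: "z \<in> Arr C" "Dom C z = Dom C n" "Cod C z = E" "a \<cdot> z = y \<cdot> n"
        by (rule mono_cokernel_factor[OF a(1) c, of "y \<cdot> n"]) (use n' y y' a in auto)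
      obtain w where w: "w \<in> Arr C" "Dom C w = G" "Cod C w = E" "w \<cdot> n = z"
        using ext[of n z] n' y z by auto
      \<comment> \<open>The difference vanishes on \<open>n\<close>, and whatever it sends into the
        image of \<open>a\<close> comes from \<open>n\<close>; so it meets that image
        trivially.\<close>
      have "null (Sub y (a \<cdot> w))"
      proof (rule maximal)
        fix x v assume v: "x \<in> Arr C" "v \<in> Arr C" "Cod C x = E" "Cod C v = Dom C (Sub y (a \<cdot> w))"
          "Dom C x = Dom C v" "Sub y (a \<cdot> w) \<cdot> v = a \<cdot> x"
        then have v': "Cod C v = G" "Sub (y \<cdot> v) (a \<cdot> (w \<cdot> v)) = a \<cdot> x"
          using y y' a w by (simp_all add: Sub_comp)
        have "null (c \<cdot> (a \<cdot> x))" by (rule null_comp3) (use c' a v in simp_all)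
        then have "null (c \<cdot> Sub (y \<cdot> v) (a \<cdot> (w \<cdot> v)))" using v' by simp
        then have "null (Sub (c \<cdot> (y \<cdot> v)) (c \<cdot> (a \<cdot> (w \<cdot> v))))"
          using v(1-3) v'(1) y y' a w c' by (simp add: Sub_comp)
        moreover have "null (c \<cdot> (a \<cdot> (w \<cdot> v)))" by (rule null_comp3) (use c' a v(2) v'(1) w in simp_all)
        ultimately have "null ((c \<cdot> y) \<cdot> v)"
          using v(2) v'(1) y y' a w c' by (simp add: Sub_null2)
        then obtain s where s: "s \<in> Arr C" "Cod C s = Dom C n" "n \<cdot> s = v" "Dom C s = Dom C v"
          using is_kernelD(6)[OF n, of v] v(2) v'(1) y y' a c' by auto
        have "y \<cdot> (n \<cdot> s) = (a \<cdot> z) \<cdot> s"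
          by (rule Comp_eq_Comp[OF z(4)[symmetric]]) (use s n' y in simp_all)
        also have "(a \<cdot> z) \<cdot> s = a \<cdot> (z \<cdot> s)"
          by (rule Comp_assoc_simp) (use s z a in simp_all)
        finally have "y \<cdot> v = a \<cdot> (z \<cdot> s)" using s(3) by simp
        moreover have "w \<cdot> v = z \<cdot> s" using Comp_eq_Comp[OF w(4), of s] s n' w by simp
        ultimately have "null (a \<cdot> x)" using v'(2)[symmetric] s(1,2) z(1-3) a by simp
        then show "null x" using mono_null_iff[OF a(1)] v a by simp
      qed (use y y' a w in simp_all)
      then have "y = a \<cdot> w" using y y' a w by simp
      moreover have "null (t \<cdot> (a \<cdot> w))" by (rule null_comp3) (use t a w in simp_all)
      ultimately show "null (t \<cdot> y)" by simp
    qed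
  qed
  then obtain u where u: "u \<in> Arr C" "Dom C u = Cod C a" "Cod C u = E" "u \<cdot> a = Id C E"
    by (rule epi_factor[of a "Id C E"]) (use a e e' mono_null_iff[OF a(1)] in auto)
  then show thesis using that[of "u \<cdot> q"] a q q' e' W by (simp add: a_def)
qed

text \<open>The pushout of \<open>i\<close> along \<open>f\<close> embeds \<open>E\<close>; a
  retraction of this embedding, composed with the other leg, extends \<open>f\<close>.\<close>

lemma extension_property_injective:
  assumes \<G>: "generating C \<G>" and E: "E \<in> Ob C"
    and ext: "\<And>n f. Cod C n \<in> \<G> \<Longrightarrow> mono_arr C n \<Longrightarrow> f \<in> Arr C \<Longrightarrow> Dom C f = Dom C n \<Longrightarrow> Cod C f = E \<Longrightarrow>
      \<exists>w\<in>Arr C. Dom C w = Cod C n \<and> Cod C w = E \<and> w \<cdot> n = f"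
  shows "injective_object C E"
  unfolding injective_object_def
proof (intro conjI allI impI ballI E)
  fix i f assume i: "mono_arr C i" and f: "f \<in> Hom C (Dom C i) E"
  obtain b w where bw: "mono_arr C b" "b \<in> Arr C" "w \<in> Arr C" "Dom C b = Cod C f" "Dom C w = Cod C i"
    "Cod C w = Cod C b" "w \<cdot> i = b \<cdot> f"
    by (rule pushout_mono[OF i, of f]) (use f in auto)
  obtain \<rho> where \<rho>: "\<rho> \<in> Arr C" "Dom C \<rho> = Cod C b" "Cod C \<rho> = E" "\<rho> \<cdot> b = Id C E"
    by (rule extension_property_retract[OF \<G> ext bw(1)]) (use bw f in auto)
  have "(\<rho> \<cdot> w) \<cdot> i = \<rho> \<cdot> (w \<cdot> i)"
    by (rule Comp_assoc_simp) (use \<rho> bw mono_arrD[OF i] in simp_all)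
  also have "\<dots> = f" using Comp_eq_Comp[OF \<rho>(4), of f] \<rho> bw f by simp
  finally show "\<exists>g\<in>Hom C (Cod C i) E. g \<cdot> i = f"
    by (intro bexI[of _ "\<rho> \<cdot> w"]) (use \<rho> bw in simp_all)
qed

end

locale accessible_locally_noetherian_category =
  accessible_grothendieck_category \<kappa> C + locally_noetherian_grothendieck_category \<kappa> C
  for \<kappa> :: "'u rel" and C :: "('o, 'm) precat" (structure)
begin

text \<open>\<open>G\<close> is the coproduct of the noetherian generators. Each is a direct
  summand: retractions carry test arrows from \<open>H\<close> to \<open>G\<close>, and subobjects
  of \<open>H\<close> become subobjects of \<open>G\<close>.\<close>

lemma noetherian_generators:
  obtains \<G> G s where "generating C \<G>" "generating C {G}" "\<And>H. H \<in> \<G> \<Longrightarrow> noetherian_object C H"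
    "\<And>H. H \<in> \<G> \<Longrightarrow> mono_arr C (s H) \<and> Dom C (s H) = H \<and> Cod C (s H) = G"
proof -
  obtain \<G> where \<G>: "small \<kappa> \<G>" "generating C \<G>" "\<And>H. H \<in> \<G> \<Longrightarrow> noetherian_object C H"
    using ex_noetherian_generating by blast
  have Ob: "H \<in> Ob C" if "H \<in> \<G>" for H using \<G>(2) that by (auto simp: generating_def)
  obtain S \<iota> where S: "is_coproduct C \<G> (\<lambda>H. H) S \<iota>" using small_coproduct[OF \<G>(1), of "\<lambda>H. H"] Ob by blast
  note S' = coproductD[OF S]
  have proj: "\<exists>t. t \<in> Arr C \<and> Dom C t = S \<and> Cod C t = H \<and> t \<cdot> \<iota> H = Id C H" if H: "H \<in> \<G>" for H
  proof -
    obtain t where "t \<in> Arr C" "Dom C t = S" "Cod C t = H"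
      "\<And>K. K \<in> \<G> \<Longrightarrow> t \<cdot> \<iota> K = (if K = H then Id C H else Zero C K H)"
      by (rule coproduct_map[OF S Ob[OF H], of "\<lambda>K. if K = H then Id C H else Zero C K H"]) (use Ob H in auto)
    then show ?thesis using H by auto
  qed
  have "generating C {S}"
    unfolding generating_def
  proof (intro conjI allI ballI impI)
    show "{S} \<subseteq> Ob C" using S' by simp
    fix X Y f g assume fg: "f \<in> Hom C X Y" "g \<in> Hom C X Y" "f \<noteq> g"
    obtain H h where h: "H \<in> \<G>" "h \<in> Hom C H X" "f \<cdot> h \<noteq> g \<cdot> h" using \<G>(2) fg unfolding generating_def by blast
    obtain t where t: "t \<in> Arr C" "Dom C t = S" "Cod C t = H" "t \<cdot> \<iota> H = Id C H" using proj[OF h(1)] by blast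
    have "f \<cdot> (h \<cdot> t) \<noteq> g \<cdot> (h \<cdot> t)"
    proof
      assume "f \<cdot> (h \<cdot> t) = g \<cdot> (h \<cdot> t)"
      then have "(f \<cdot> (h \<cdot> t)) \<cdot> \<iota> H = (g \<cdot> (h \<cdot> t)) \<cdot> \<iota> H" by simp
      then show False using fg h t S' by simp
    qed
    then show "\<exists>G\<in>{S}. \<exists>h\<in>Hom C G X. f \<cdot> h \<noteq> g \<cdot> h"
      by (intro bexI[of _ S] bexI[of _ "h \<cdot> t"]) (use h t in auto)
  qed
  moreover have "mono_arr C (\<iota> H)" if H: "H \<in> \<G>" for H
  proof -
    obtain t where "t \<in> Arr C" "Dom C t = S" "Cod C t = H" "t \<cdot> \<iota> H = Id C H" using proj[OF H] by blast
    then show ?thesis using mono_comp_right[of t "\<iota> H"] S' H Ob by simp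
  qed
  ultimately show thesis using that[of \<G> S \<iota>] \<G> S' by simp
qed

text \<open>A subobject of a noetherian generator \<open>H\<close> is noetherian and, through
  \<open>s H\<close>, a subobject of \<open>G\<close>. The extension to \<open>G\<close>, restricted
  along \<open>s H\<close>, is what Baer's criterion asks for.\<close>

theorem enough_injectives:
  assumes X: "X \<in> Ob C"
  obtains e where "mono_arr C e" "Dom C e = X" "injective_object C (Cod C e)"
proof -
  obtain \<G> G s where G: "generating C \<G>" "generating C {G}" "\<And>H. H \<in> \<G> \<Longrightarrow> noetherian_object C H"
    "\<And>H. H \<in> \<G> \<Longrightarrow> mono_arr C (s H) \<and> Dom C (s H) = H \<and> Cod C (s H) = G"
    using noetherian_generators by metis
  obtain e where e: "mono_arr C e" "Dom C e = X"
    "\<And>n f. mono_arr C n \<Longrightarrow> Cod C n = G \<Longrightarrow> noetherian_object C (Dom C n) \<Longrightarrow>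
      f \<in> Arr C \<Longrightarrow> Dom C f = Dom C n \<Longrightarrow> Cod C f = Cod C e \<Longrightarrow>
      \<exists>w\<in>Arr C. Dom C w = G \<and> Cod C w = Cod C e \<and> w \<cdot> n = f"
    using extend_noetherian_partial_maps[OF G(2) X] by blast
  have "injective_object C (Cod C e)"
    using G(1)
  proof (rule extension_property_injective)
    show "Cod C e \<in> Ob C" using mono_arrD[OF e(1)] by simp
    fix n f assume n: "Cod C n \<in> \<G>" "mono_arr C n" and f: "f \<in> Arr C" "Dom C f = Dom C n" "Cod C f = Cod C e"
    let ?s = "s (Cod C n)"
    have s: "mono_arr C ?s" "?s \<in> Arr C" "Dom C ?s = Cod C n" "Cod C ?s = G" using G(4)[OF n(1)] mono_arrD by auto
    note n' = mono_arrD[OF n(2)]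
    obtain w where w: "w \<in> Arr C" "Dom C w = G" "Cod C w = Cod C e" "w \<cdot> (?s \<cdot> n) = f"
      using e(3)[of "?s \<cdot> n" f] mono_comp[OF n(2) s(1)] noetherian_subobject[OF G(3)[OF n(1)] n(2)] s n' f by auto
    then show "\<exists>w\<in>Arr C. Dom C w = Cod C n \<and> Cod C w = Cod C e \<and> w \<cdot> n = f"
      by (intro bexI[of _ "w \<cdot> ?s"]) (use s n' in simp_all)
  qed
  then show thesis using that e by blast
qed

end

section \<open>Atoms\<close>

context abelian_category
begin

section \<open>Monoform objects\<close>

lemma quotient_object_cokernel:
  assumes "i \<in> Arr C"
  obtains q where "is_cokernel C i q" "Cod C q = quotient_object C i"
proof -
  have "is_cokernel C i (SOME q. is_cokernel C i q)" using ex_cokernel[OF assms] by (rule someI_ex)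
  then show thesis using that by (simp add: quotient_object_def)
qed

lemma isomorphic_refl: "X \<in> Ob C \<Longrightarrow> isomorphic C X X"
  unfolding isomorphic_def by (auto intro!: bexI[of _ "Id C X"])

lemma isomorphic_mono:
  assumes "isomorphic C X Y"
  obtains f where "mono_arr C f" "f \<in> Arr C" "Dom C f = X" "Cod C f = Y"
proof -
  obtain f g where f: "f \<in> Arr C" "Dom C f = X" "Cod C f = Y" "g \<in> Arr C" "Dom C g = Y" "g \<cdot> f = Id C X" "X \<in> Ob C"
    using assms by (auto simp: isomorphic_def)
  then have "mono_arr C f" using mono_comp_right[of g f] by simp
  then show thesis using that f by blast
qed

text \<open>With \<open>monoformI\<close>, this frees the definition from the chosen quotient and
  from isomorphisms: \<open>u\<close> compares \<open>q\<close> with the chosen cokernel, and an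
  isomorphism of domains is absorbed into a monomorphism.\<close>

lemma monoformD:
  assumes H: "monoform C H" and i: "mono_arr C i" "Cod C i = H" "\<not> null i" and q: "is_cokernel C i q"
    and j: "mono_arr C j" "Cod C j = H" and k: "mono_arr C k" "Cod C k = Cod C q" "Dom C k = Dom C j"
  shows "null j"
proof (rule ccontr)
  assume nj: "\<not> null j"
  note a = mono_arrD[OF i(1)] mono_arrD[OF j(1)] mono_arrD[OF k(1)]
  note q' = is_cokernelD(2-5)[OF q]
  obtain p where p: "is_cokernel C i p" "Cod C p = quotient_object C i" using quotient_object_cokernel[OF a(1)] .
  note p' = is_cokernelD(2-5)[OF p(1)]
  obtain u where u: "u \<in> Arr C" "Dom C u = Cod C q" "Cod C u = Cod C p" "u \<cdot> q = p"
    using is_cokernelD(6)[OF q, of p] p' by auto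
  obtain v where v: "v \<in> Arr C" "Dom C v = Cod C p" "Cod C v = Cod C q" "v \<cdot> p = q"
    using is_cokernelD(6)[OF p(1), of q] q' by auto
  have "v \<cdot> (u \<cdot> q) = Id C (Cod C q) \<cdot> q" using u v q' by simp
  then have "(v \<cdot> u) \<cdot> q = Id C (Cod C q) \<cdot> q" using u(1-3) v(1-3) q' by simp
  then have "v \<cdot> u = Id C (Cod C q)" by (rule epi_cancel) (use u(1-3) v(1-3) q' in simp_all)
  then have "mono_arr C u" using mono_comp_right[of v u] u(1-3) v(1-3) q' by simp
  then have uk: "mono_arr C (u \<cdot> k)" using k u by (intro mono_comp) simp_all
  have "subobj C i H" "nonzero C (Dom C i)" "subobj C j H" "nonzero C (Dom C j)"
    "subobj C (u \<cdot> k) (quotient_object C i)" "isomorphic C (Dom C j) (Dom C (u \<cdot> k))"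
    using i j nj uk u k a p isomorphic_refl by (simp_all add: subobj_def nonzero_mono_iff)
  then show False using H unfolding monoform_def by blast
qed

lemma monoformI:
  assumes "nonzero C H"
    and "\<And>i q j k. mono_arr C i \<Longrightarrow> Cod C i = H \<Longrightarrow> \<not> null i \<Longrightarrow> is_cokernel C i q \<Longrightarrow>
      mono_arr C j \<Longrightarrow> Cod C j = H \<Longrightarrow> mono_arr C k \<Longrightarrow> Cod C k = Cod C q \<Longrightarrow> Dom C k = Dom C j \<Longrightarrow> null j"
  shows "monoform C H"
  unfolding monoform_def
proof (intro conjI allI impI notI)
  fix i assume "subobj C i H \<and> nonzero C (Dom C i)"
  then have i: "mono_arr C i" "Cod C i = H" "\<not> null i" by (auto simp: subobj_def nonzero_mono_iff)
  obtain q where q: "is_cokernel C i q" "Cod C q = quotient_object C i"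
    using quotient_object_cokernel[OF mono_arrD[OF i(1)]] .
  assume "\<exists>j k. subobj C j H \<and> nonzero C (Dom C j) \<and>
    subobj C k (quotient_object C i) \<and> isomorphic C (Dom C j) (Dom C k)"
  then obtain j k where jk: "mono_arr C j" "Cod C j = H" "\<not> null j" "mono_arr C k" "Cod C k = Cod C q"
    "isomorphic C (Dom C j) (Dom C k)"
    using q by (auto simp: subobj_def nonzero_mono_iff)
  obtain f where f: "mono_arr C f" "f \<in> Arr C" "Dom C f = Dom C j" "Cod C f = Dom C k"
    using isomorphic_mono[OF jk(6)] .
  have "null j"
    by (rule assms(2)[OF i q(1) jk(1,2), of "k \<cdot> f"]) (use mono_comp[OF f(1) jk(4)] f jk mono_arrD in simp_all)
  then show False using jk by simp
qed (fact assms(1))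

text \<open>The quotient of \<open>Dom C n\<close> by \<open>i\<close> embeds by \<open>r\<close> in
  the quotient of \<open>H\<close> by \<open>n \<cdot> i\<close>, so a violation in
  \<open>Dom C n\<close> would be one in \<open>H\<close>.\<close>

lemma monoform_subobject:
  assumes H: "monoform C H" and n: "mono_arr C n" "Cod C n = H" "\<not> null n"
  shows "monoform C (Dom C n)"
proof (rule monoformI)
  show "nonzero C (Dom C n)" using n by (simp add: nonzero_mono_iff)
  note n' = mono_arrD[OF n(1)]
  fix i q j k
  assume i: "mono_arr C i" "Cod C i = Dom C n" "\<not> null i" and q: "is_cokernel C i q"
    and j: "mono_arr C j" "Cod C j = Dom C n" and k: "mono_arr C k" "Cod C k = Cod C q" "Dom C k = Dom C j"
  note a = mono_arrD[OF i(1)] mono_arrD[OF j(1)] mono_arrD[OF k(1)]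
  note q' = is_cokernelD(2-5)[OF q]
  have ni: "mono_arr C (n \<cdot> i)" using i n by (intro mono_comp) simp_all
  obtain p where p: "is_cokernel C (n \<cdot> i) p" using ex_cokernel[of "n \<cdot> i"] a n' i by auto
  have p': "p \<in> Arr C" "Dom C p = H" "null (p \<cdot> (n \<cdot> i))" "epi_arr C p"
    using is_cokernelD(2-5)[OF p] a n' i n by simp_all
  have "null ((p \<cdot> n) \<cdot> i)" using p' n n' a i by simp
  then obtain r where r: "r \<in> Arr C" "Dom C r = Cod C q" "Cod C r = Cod C p" "r \<cdot> q = p \<cdot> n"
    using is_cokernelD(6)[OF q, of "p \<cdot> n"] p' n n' i by auto
  have "mono_arr C r"
    unfolding mono_arr_iff
  proof (intro conjI ballI impI r)
    fix x assume x: "x \<in> Arr C" "Cod C x = Dom C r" "null (r \<cdot> x)"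
    \<comment> \<open>After an epimorphism, \<open>x\<close> lifts along \<open>q\<close> to
      \<open>v\<close>. Then \<open>n \<cdot> v\<close> factors through \<open>n \<cdot> i\<close>,
      so \<open>v\<close> factors through \<open>i\<close> and is killed by
      \<open>q\<close>.\<close>
    obtain e v where ev: "epi_arr C e" "e \<in> Arr C" "v \<in> Arr C" "Cod C e = Dom C x" "Cod C v = Dom C q"
      "Dom C v = Dom C e" "q \<cdot> v = x \<cdot> e"
      by (rule pullback_epi[OF q'(4), of x]) (use x r in auto)
    have nv: "Cod C v = Dom C n" using ev q' i by simp
    have "r \<cdot> (q \<cdot> v) = (p \<cdot> n) \<cdot> v" by (rule Comp_eq_Comp[OF r(4)]) (use ev q' r in simp_all)
    moreover have "null (r \<cdot> (x \<cdot> e))" using x ev r by simp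
    ultimately have "null ((p \<cdot> n) \<cdot> v)" using ev by simp
    then have "null (p \<cdot> (n \<cdot> v))" using p' n n' ev nv by simp
    then obtain s where s: "s \<in> Arr C" "Dom C s = Dom C v" "Cod C s = Dom C i" "(n \<cdot> i) \<cdot> s = n \<cdot> v"
      using mono_cokernel_factor[OF ni p, of "n \<cdot> v"] n n' ev nv a i by auto
    have "n \<cdot> (i \<cdot> s) = n \<cdot> v" using s n' a i by simp
    then have "i \<cdot> s = v" by (rule mono_cancel[OF _ n(1)]) (use s a i ev nv in simp_all)
    moreover have "null (q \<cdot> (i \<cdot> s))" by (rule null_comp3) (use q' a s in simp_all)
    ultimately have "null (x \<cdot> e)" using ev by simp
    then show "null x" using epi_null_iff[OF ev(1), of x] x ev by simp
  qed
  then have "mono_arr C (r \<cdot> k)" using k r by (intro mono_comp) simp_all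
  moreover have "mono_arr C (n \<cdot> j)" using j n by (intro mono_comp) simp_all
  moreover have "\<not> null (n \<cdot> i)" using mono_null_iff[OF n(1), of i] a i by simp
  ultimately have "null (n \<cdot> j)"
    by (intro monoformD[OF H ni _ _ p, of "n \<cdot> j" "r \<cdot> k"]) (use a n n' i j k r in simp_all)
  then show "null j" using mono_null_iff[OF n(1), of j] a j by simp
qed

text \<open>If \<open>a\<close> and \<open>b\<close> met trivially, \<open>b\<close> would embed in
  the quotient of \<open>H\<close> by \<open>a\<close>, against monoformity.\<close>

lemma monoform_uniform:
  assumes H: "monoform C H" and a: "mono_arr C a" "Cod C a = H" "\<not> null a" and b: "mono_arr C b" "Cod C b = H" "\<not> null b"
  obtains x y where "mono_arr C x" "mono_arr C y" "Cod C x = Dom C a" "Cod C y = Dom C b" "Dom C x = Dom C y" "\<not> null x"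
proof -
  note ab = mono_arrD[OF a(1)] mono_arrD[OF b(1)]
  have "\<exists>x y. x \<in> Arr C \<and> y \<in> Arr C \<and> Cod C x = Dom C a \<and> Cod C y = Dom C b \<and> Dom C x = Dom C y \<and> a \<cdot> x = b \<cdot> y \<and> \<not> null x"
  proof (rule ccontr)
    assume no: "\<not> ?thesis"
    obtain q where q: "is_cokernel C a q" using ex_cokernel[OF ab(1)] by blast
    note q' = is_cokernelD(2-5)[OF q]
    have "mono_arr C (q \<cdot> b)"
      unfolding mono_arr_iff
    proof (intro conjI ballI impI)
      fix z assume z: "z \<in> Arr C" "Cod C z = Dom C (q \<cdot> b)" "null ((q \<cdot> b) \<cdot> z)"
      then have z': "Cod C z = Dom C b" "null (q \<cdot> (b \<cdot> z))" using q' ab a b by simp_all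
      obtain s where s: "s \<in> Arr C" "Dom C s = Dom C z" "Cod C s = Dom C a" "a \<cdot> s = b \<cdot> z"
        by (rule mono_cokernel_factor[OF a(1) q, of "b \<cdot> z"]) (use z z' ab a b in auto)
      then have "null s" using no z(1) z'(1) by metis
      then have "null (b \<cdot> z)" using s ab null_comp2 by metis
      then show "null z" using mono_null_iff[OF b(1)] z z' by simp
    qed (use q' ab a b in simp)
    then have "null b"
      by (intro monoformD[OF H a q b(1,2), of "q \<cdot> b"]) (use q' ab a b in simp_all)
    then show False using b by simp
  qed
  then obtain x y where xy: "x \<in> Arr C" "y \<in> Arr C" "Cod C x = Dom C a" "Cod C y = Dom C b" "Dom C x = Dom C y" "a \<cdot> x = b \<cdot> y" "\<not> null x"
    by blast
  \<comment> \<open>\<open>x\<close> and \<open>y\<close> need not be monic, so they are replaced by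
    the image of \<open>a \<cdot> x\<close>, which factors through both subobjects.\<close>
  have ax: "a \<cdot> x \<in> Arr C" using xy ab by simp
  obtain m e where me: "mono_arr C m" "epi_arr C e" "m \<in> Arr C" "e \<in> Arr C" "Dom C e = Dom C (a \<cdot> x)"
    "Cod C m = Cod C (a \<cdot> x)" "Dom C m = Cod C e" "m \<cdot> e = a \<cdot> x"
    using mono_epi_factorization[OF ax] .
  have m: "Cod C m = H" "Dom C e = Dom C x" using me xy ab a b by simp_all
  have factor: "\<exists>u. u \<in> Arr C \<and> Dom C u = Dom C m \<and> Cod C u = Dom C c \<and> c \<cdot> u = m"
    if c: "mono_arr C c" "Cod C c = H" and z: "z \<in> Arr C" "Cod C z = Dom C c" "m \<cdot> e = c \<cdot> z" for c z
  proof -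
    obtain u where "u \<in> Arr C" "Dom C u = Dom C m" "Cod C u = Dom C c" "c \<cdot> u = m"
    proof (rule mono_factor[OF c(1), of m])
      fix g assume g: "g \<in> Arr C" "Dom C g = Cod C c" "null (g \<cdot> c)"
      have "null (g \<cdot> (m \<cdot> e))" unfolding z(3) by (rule null_comp3) (use g z mono_arrD[OF c(1)] in simp_all)
      then have "null ((g \<cdot> m) \<cdot> e)" using g me m c by simp
      then show "null (g \<cdot> m)" using epi_null_iff[OF me(2), of "g \<cdot> m"] g me(3-7) m c by simp
    qed (use me m c in auto)
    then show ?thesis by blast
  qed
  obtain u where u: "u \<in> Arr C" "Dom C u = Dom C m" "Cod C u = Dom C a" "a \<cdot> u = m"
    using factor[OF a(1,2) xy(1,3) me(8)] by blast
  obtain v where v: "v \<in> Arr C" "Dom C v = Dom C m" "Cod C v = Dom C b" "b \<cdot> v = m"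
    using factor[OF b(1,2) xy(2,4)] me(8) xy(6) by auto
  have "mono_arr C u" "mono_arr C v"
    using mono_comp_right[of a u] mono_comp_right[of b v] u v me(1) ab by simp_all
  moreover have "\<not> null u"
  proof
    assume "null u"
    then have "null m" using u ab null_comp2 by metis
    then have "null (a \<cdot> x)" using me by (metis null_comp1)
    then show False using mono_null_iff[OF a(1)] xy(1,3,7) by blast
  qed
  ultimately show thesis using that[of u v] u v by simp
qed

lemma atom_equiv_iff:
  "(H, H') \<in> atom_equiv C \<longleftrightarrow> monoform C H \<and> monoform C H' \<and>
    (\<exists>i j. mono_arr C i \<and> mono_arr C j \<and> Cod C i = H \<and> Cod C j = H' \<and> Dom C i = Dom C j \<and> \<not> null i)"
proof
  assume "(H, H') \<in> atom_equiv C"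
  then obtain i j where ij: "monoform C H" "monoform C H'" "mono_arr C i" "mono_arr C j" "Cod C i = H" "Cod C j = H'"
    "\<not> null i" "isomorphic C (Dom C i) (Dom C j)"
    by (auto simp: atom_equiv_def subobj_def nonzero_mono_iff)
  obtain f where f: "mono_arr C f" "f \<in> Arr C" "Dom C f = Dom C i" "Cod C f = Dom C j"
    using isomorphic_mono[OF ij(8)] .
  have "mono_arr C (j \<cdot> f)" "Cod C (j \<cdot> f) = H'" "Dom C i = Dom C (j \<cdot> f)"
    using mono_comp[OF f(1) ij(4)] f ij mono_arrD[OF ij(4)] by simp_all
  then show "monoform C H \<and> monoform C H' \<and>
    (\<exists>i j. mono_arr C i \<and> mono_arr C j \<and> Cod C i = H \<and> Cod C j = H' \<and> Dom C i = Dom C j \<and> \<not> null i)"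
    using ij by blast
next
  assume "monoform C H \<and> monoform C H' \<and>
    (\<exists>i j. mono_arr C i \<and> mono_arr C j \<and> Cod C i = H \<and> Cod C j = H' \<and> Dom C i = Dom C j \<and> \<not> null i)"
  then obtain i j where ij: "monoform C H" "monoform C H'" "mono_arr C i" "mono_arr C j" "Cod C i = H" "Cod C j = H'"
    "Dom C i = Dom C j" "\<not> null i"
    by blast
  then have "nonzero C (Dom C i)" "nonzero C (Dom C j)" "isomorphic C (Dom C i) (Dom C j)"
    using nonzero_mono_iff[of i] isomorphic_refl mono_arrD[of j] by simp_all
  then show "(H, H') \<in> atom_equiv C"
    using ij unfolding atom_equiv_def subobj_def by blast
qed

section \<open>Atoms and atom support\<close>

lemma atom_monoform: "\<alpha> \<in> ASpec C \<Longrightarrow> H \<in> \<alpha> \<Longrightarrow> monoform C H"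
  by (auto simp: ASpec_def quotient_def atom_equiv_iff)

text \<open>\<open>H\<close> shares a nonzero subobject with a representative \<open>H0\<close> of
  the atom. By \<open>monoform_uniform\<close> it meets \<open>n\<close>, which links
  \<open>H0\<close> to \<open>Dom C n\<close> directly.\<close>

lemma atom_subobject:
  assumes \<alpha>: "\<alpha> \<in> ASpec C" "H \<in> \<alpha>" and n: "mono_arr C n" "Cod C n = H" "\<not> null n"
  shows "Dom C n \<in> \<alpha>"
proof -
  obtain H0 where H0: "\<alpha> = atom_equiv C `` {H0}" using \<alpha> by (auto simp: ASpec_def quotient_def)
  obtain i j where ij: "monoform C H0" "monoform C H" "mono_arr C i" "mono_arr C j" "Cod C i = H0" "Cod C j = H"
    "Dom C i = Dom C j" "\<not> null i"
    using \<alpha> H0 by (auto simp: atom_equiv_iff)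
  have nj: "\<not> null j" using nonzero_mono_iff ij by metis
  obtain x y where xy: "mono_arr C x" "mono_arr C y" "Cod C x = Dom C j" "Cod C y = Dom C n" "Dom C x = Dom C y" "\<not> null x"
    using monoform_uniform[OF ij(2,4,6) nj n] .
  have "mono_arr C (i \<cdot> x)" "\<not> null (i \<cdot> x)" "Dom C (i \<cdot> x) = Dom C y" "Cod C (i \<cdot> x) = H0"
    using mono_comp[OF xy(1) ij(3)] mono_null_iff[OF ij(3), of x] xy ij mono_arrD by simp_all
  then have "(H0, Dom C n) \<in> atom_equiv C"
    using ij(1) monoform_subobject[OF ij(2) n] xy unfolding atom_equiv_iff by blast
  then show ?thesis using H0 by simp
qed

text \<open>By the kernel condition the image of \<open>w\<close> maps onto the image of
  \<open>q\<close>, which is a nonzero subobject of \<open>H\<close> and hence again in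
  \<open>\<alpha>\<close>. Membership in a support thus becomes a statement about arrows.\<close>

lemma ASuppI:
  assumes \<alpha>: "\<alpha> \<in> ASpec C" "H \<in> \<alpha>" and q: "q \<in> Arr C" "Cod C q = H" "\<not> null q"
    and w: "w \<in> Arr C" "Dom C w = Dom C q"
    and ker: "\<And>x. x \<in> Arr C \<Longrightarrow> Cod C x = Dom C q \<Longrightarrow> null (w \<cdot> x) \<Longrightarrow> null (q \<cdot> x)"
  shows "\<alpha> \<in> ASupp C (Cod C w)"
proof -
  obtain m e where me: "mono_arr C m" "epi_arr C e" "m \<in> Arr C" "e \<in> Arr C" "Dom C e = Dom C w"
    "Cod C m = Cod C w" "Dom C m = Cod C e" "m \<cdot> e = w"
    using mono_epi_factorization[OF w(1)] .
  obtain u where u: "u \<in> Arr C" "Dom C u = Cod C e" "Cod C u = Cod C q" "u \<cdot> e = q"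
  proof (rule epi_factor[OF me(2) q(1)])
    fix x assume x: "x \<in> Arr C" "Cod C x = Dom C e" "null (e \<cdot> x)"
    then have "null (m \<cdot> (e \<cdot> x))" using me by simp
    moreover have "m \<cdot> (e \<cdot> x) = w \<cdot> x" by (rule Comp_eq_Comp) (use me x in simp_all)
    ultimately show "null (q \<cdot> x)" using ker x me w by simp
  qed (use me w in auto)
  obtain n p where np: "mono_arr C n" "epi_arr C p" "n \<in> Arr C" "p \<in> Arr C" "Dom C p = Dom C u"
    "Cod C n = Cod C u" "Dom C n = Cod C p" "n \<cdot> p = u"
    using mono_epi_factorization[OF u(1)] .
  have "\<not> null n"
  proof
    assume "null n"
    then have "null u" using np null_comp1 by metis
    then have "null q" using u me null_comp1 by metis
    then show False using q by simp
  qed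
  then have "Dom C n \<in> \<alpha>" by (intro atom_subobject[OF \<alpha> np(1)]) (use np u q in simp_all)
  moreover have "subquotient C (Dom C n) (Cod C w)"
    unfolding subquotient_def subobj_def using me np u by (intro exI[of _ m] exI[of _ p]) simp
  ultimately show ?thesis using \<alpha> by (auto simp: ASupp_def)
qed

lemma ASuppE:
  assumes "\<alpha> \<in> ASupp C X"
  obtains H m q where "\<alpha> \<in> ASpec C" "H \<in> \<alpha>" "mono_arr C m" "m \<in> Arr C" "Cod C m = X" "epi_arr C q" "q \<in> Arr C"
    "Dom C q = Dom C m" "Cod C q = H" "\<not> null q"
proof -
  obtain H m q where *: "\<alpha> \<in> ASpec C" "H \<in> \<alpha>" "mono_arr C m" "Cod C m = X" "epi_arr C q"
    "Dom C q = Dom C m" "Cod C q = H"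
    using assms by (auto simp: ASupp_def subquotient_def subobj_def)
  then have "nonzero C H" using atom_monoform monoform_def by metis
  then show thesis using that * nonzero_epi_iff mono_arrD epi_arrD by metis
qed

lemma ASupp_mono:
  assumes a: "mono_arr C a"
  shows "ASupp C (Dom C a) \<subseteq> ASupp C (Cod C a)"
proof
  fix \<alpha> assume "\<alpha> \<in> ASupp C (Dom C a)"
  then obtain H m q where *: "\<alpha> \<in> ASpec C" "H \<in> \<alpha>" "mono_arr C m" "m \<in> Arr C" "Cod C m = Dom C a" "epi_arr C q" "q \<in> Arr C"
    "Dom C q = Dom C m" "Cod C q = H" "\<not> null q"
    by (rule ASuppE)
  have am: "mono_arr C (a \<cdot> m)" using a * by (intro mono_comp) simp_all
  have "\<alpha> \<in> ASupp C (Cod C (a \<cdot> m))"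
    using *(1,2,7,9,10)
  proof (rule ASuppI)
    fix x assume x: "x \<in> Arr C" "Cod C x = Dom C q" "null ((a \<cdot> m) \<cdot> x)"
    then have "null x" using mono_null_iff[OF am, of x] * mono_arrD[OF a] by simp
    then show "null (q \<cdot> x)" using x * by simp
  qed (use * mono_arrD[OF a] in simp_all)
  then show "\<alpha> \<in> ASupp C (Cod C a)" using * mono_arrD[OF a] by simp
qed

text \<open>A monoform subquotient of \<open>a + b\<close> is seen by \<open>a\<close> if it does not vanish on \<open>a\<close>, and otherwise by \<open>b\<close>.\<close>

lemma ASupp_span_pair:
  assumes a: "mono_arr C a" "Cod C a = M" and b: "mono_arr C b" "Cod C b = M"
    and l: "mono_arr C l" "l \<in> span M {a, b}"
  shows "ASupp C (Dom C l) \<subseteq> ASupp C (Dom C a) \<union> ASupp C (Dom C b)"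
proof
  note ab = mono_arrD[OF a(1)] mono_arrD[OF b(1)]
  note l' = span_arr[OF l(2)]
  fix \<alpha> assume "\<alpha> \<in> ASupp C (Dom C l)"
  then obtain H m q where *: "\<alpha> \<in> ASpec C" "H \<in> \<alpha>" "mono_arr C m" "m \<in> Arr C" "Cod C m = Dom C l" "epi_arr C q" "q \<in> Arr C"
    "Dom C q = Dom C m" "Cod C q = H" "\<not> null q"
    by (rule ASuppE)
  define f where "f = l \<cdot> m"
  have f: "mono_arr C f" "f \<in> Arr C" "Dom C f = Dom C m" "Cod C f = M"
    using mono_comp[OF *(3) l(1)] * l' by (simp_all add: f_def)
  have "f \<in> span M {a, b}" unfolding f_def by (rule span_comp[OF l(2)]) (use * a b in auto)
  then obtain r v w where r: "epi_arr C r" "r \<in> Arr C" "v \<in> Arr C" "w \<in> Arr C" "Cod C r = Dom C f"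
    "Dom C v = Dom C r" "Dom C w = Dom C r" "Cod C v = Dom C a" "Cod C w = Dom C b"
    "f \<cdot> r = a \<cdot> v \<boxplus> b \<cdot> w"
    by (rule span_pair_factor_epi) (use ab a b in auto)
  show "\<alpha> \<in> ASupp C (Dom C a) \<union> ASupp C (Dom C b)"
  proof (cases "\<exists>z s. z \<in> Arr C \<and> s \<in> Arr C \<and> Cod C z = Dom C f \<and> Cod C s = Dom C a \<and> Dom C z = Dom C s \<and>
      f \<cdot> z = a \<cdot> s \<and> \<not> null (q \<cdot> z)")
    case True
    then obtain z s where z: "z \<in> Arr C" "s \<in> Arr C" "Cod C z = Dom C f" "Cod C s = Dom C a" "Dom C z = Dom C s"
      "f \<cdot> z = a \<cdot> s" "\<not> null (q \<cdot> z)" by blast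
    have "\<alpha> \<in> ASupp C (Cod C s)"
    proof (rule ASuppI[OF *(1,2), of "q \<cdot> z"])
      fix x assume x: "x \<in> Arr C" "Cod C x = Dom C (q \<cdot> z)" "null (s \<cdot> x)"
      then have x': "Cod C x = Dom C z" using z * f by simp
      have "f \<cdot> (z \<cdot> x) = (a \<cdot> s) \<cdot> x"
        by (rule Comp_eq_Comp[OF z(6)]) (use z(1,3) x(1) x' f in simp_all)
      also have "\<dots> = a \<cdot> (s \<cdot> x)" by (rule Comp_assoc_simp) (use z(2,4,5) x(1) x' ab in simp_all)
      finally have "null (f \<cdot> (z \<cdot> x))" using z(2,4,5) x(1,3) x' ab by simp
      then have "null (z \<cdot> x)" using mono_null_iff[OF f(1), of "z \<cdot> x"] z x x' by simp
      then show "null ((q \<cdot> z) \<cdot> x)" using z(1,3) x x' * f by simp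
    qed (use z * f in simp_all)
    then show ?thesis using z by simp
  next
    case False
    have "\<alpha> \<in> ASupp C (Cod C w)"
    proof (rule ASuppI[OF *(1,2), of "q \<cdot> r"])
      show "\<not> null (q \<cdot> r)" using epi_null_iff[OF r(1), of q] * r f by simp
      fix x assume x: "x \<in> Arr C" "Cod C x = Dom C (q \<cdot> r)" "null (w \<cdot> x)"
      then have x': "Cod C x = Dom C r" using r * f by simp
      \<comment> \<open>Where \<open>w\<close> vanishes only the component through \<open>a\<close>
        remains, and there \<open>q\<close> is zero by \<open>False\<close>.\<close>
      have "(f \<cdot> r) \<cdot> x = (a \<cdot> v) \<cdot> x \<boxplus> (b \<cdot> w) \<cdot> x"
        unfolding r(10) using Comp_Add[of x "Dom C x" "Dom C r" "a \<cdot> v" M "b \<cdot> w"] x(1) x' r(2-9) ab a b by simp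
      also have "\<dots> = a \<cdot> (v \<cdot> x)" using x x' r(2-9) ab a b by (simp add: Add_null)
      finally have "f \<cdot> (r \<cdot> x) = a \<cdot> (v \<cdot> x)" using x(1) x' r(2-9) f by simp
      then have "null (q \<cdot> (r \<cdot> x))"
        using False x(1) x' r(2-9) f
        by (metis Comp_arr(1) Comp_arr(2) Comp_arr(3))
      then show "null ((q \<cdot> r) \<cdot> x)" using x(1) x' r(2-9) f * by simp
    qed (use r * f in simp_all)
    then show ?thesis using r by simp
  qed
qed

end

section \<open>Existence of the largest subobject with given support\<close>

context accessible_grothendieck_category
begin

text \<open>The kernel of the joint cokernel realises a span as an actual subobject.\<close>

lemma span_subobject:
  assumes M: "M \<in> Ob C" and R: "\<And>r. r \<in> R \<Longrightarrow> r \<in> Arr C" "\<And>r. r \<in> R \<Longrightarrow> Cod C r = M"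
  obtains l where "mono_arr C l" "Cod C l = M" "l \<in> span M R" "\<And>x. x \<in> span M R \<Longrightarrow> sub_le C x l"
proof -
  obtain q where q: "q \<in> Arr C" "Dom C q = M"
    "\<And>x. x \<in> Arr C \<Longrightarrow> Cod C x = M \<Longrightarrow> null (q \<cdot> x) \<longleftrightarrow> x \<in> span M R"
    using joint_cokernel[OF M R] by metis
  obtain l where l: "is_kernel C q l" using ex_kernel q by blast
  note l' = is_kernelD(2-5)[OF l]
  show thesis
  proof (rule that[of l])
    fix x assume x: "x \<in> span M R"
    then have "null (q \<cdot> x)" using q(3) span_arr by blast
    then show "sub_le C x l"
      using is_kernelD(6)[OF l, of x] span_arr[OF x] q unfolding sub_le_def by auto
  qed (use l' q in auto)
qed

text \<open>By \<open>directed_span_null\<close>, a monoform subquotient of the union does not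
  vanish on the part coming from some member \<open>d\<close>; \<open>ASuppI\<close> then finds its
  atom in the support of \<open>d\<close>.\<close>

lemma ASupp_directed_span:
  assumes D: "\<And>d. d \<in> D \<Longrightarrow> subobj C d M \<and> ASupp C (Dom C d) \<subseteq> U" "D \<noteq> {}" and M: "M \<in> Ob C"
    and dir: "\<And>a b. a \<in> D \<Longrightarrow> b \<in> D \<Longrightarrow> \<exists>c\<in>D. sub_le C a c \<and> sub_le C b c"
    and l: "mono_arr C l" "l \<in> span M D"
  shows "ASupp C (Dom C l) \<subseteq> U"
proof
  note l' = span_arr[OF l(2)]
  have D': "mono_arr C d" "d \<in> Arr C" "Cod C d = M" if "d \<in> D" for d
    using D(1)[OF that] mono_arrD by (auto simp: subobj_def)
  fix \<alpha> assume "\<alpha> \<in> ASupp C (Dom C l)"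
  then obtain H m q where *: "\<alpha> \<in> ASpec C" "H \<in> \<alpha>" "mono_arr C m" "m \<in> Arr C" "Cod C m = Dom C l" "epi_arr C q" "q \<in> Arr C"
    "Dom C q = Dom C m" "Cod C q = H" "\<not> null q"
    by (rule ASuppE)
  define f where "f = l \<cdot> m"
  have f: "mono_arr C f" "f \<in> Arr C" "Dom C f = Dom C m" "Cod C f = M"
    using mono_comp[OF *(3) l(1)] * l' by (simp_all add: f_def)
  \<comment> \<open>Passing from \<open>d\<close> to its span turns \<open>sub_le\<close> into the
    inclusion that \<open>directed_span_null\<close> works with.\<close>
  define \<D> where "\<D> = (\<lambda>d. span M {d}) ` D"
  have "\<exists>R\<in>\<D>. \<exists>z. z \<in> Arr C \<and> Cod C z = Dom C f \<and> f \<cdot> z \<in> span M R \<and> \<not> null (q \<cdot> z)"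
  proof (rule ccontr)
    assume no: "\<not> ?thesis"
    have "null q"
    proof (rule directed_span_null[of M \<D> f q])
      show "M \<in> Ob C" "\<D> \<noteq> {}" using M D by (simp_all add: \<D>_def)
      show "\<exists>T\<in>\<D>. R \<subseteq> T \<and> S \<subseteq> T" if RS: "R \<in> \<D>" "S \<in> \<D>" for R S
      proof -
        obtain a b where ab: "a \<in> D" "b \<in> D" "R = span M {a}" "S = span M {b}" using RS by (auto simp: \<D>_def)
        obtain c where c: "c \<in> D" "sub_le C a c" "sub_le C b c" using dir ab by blast
        have "x \<in> span M {c}" if x: "sub_le C x c" for x
        proof -
          obtain u where u: "u \<in> Arr C" "Cod C u = Dom C c" "c \<cdot> u = x" using x by (auto simp: sub_le_def)
          have "c \<cdot> u \<in> span M {c}" by (rule span_comp) (use u D'[OF c(1)] in \<open>auto intro: span_superset\<close>)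
          then show ?thesis using u by simp
        qed
        then have "a \<in> span M {c}" "b \<in> span M {c}" using c by blast+
        then have "R \<subseteq> span M {c}" "S \<subseteq> span M {c}" unfolding ab(3,4) by (intro span_subset; simp)+
        then show ?thesis using c(1) unfolding \<D>_def by blast
      qed
      show "r \<in> Arr C \<and> Cod C r = M" if "R \<in> \<D>" "r \<in> R" for R r
        using that span_arr by (auto simp: \<D>_def)
      have "d \<in> \<Union>\<D>" if "d \<in> D" for d
        using span_superset[of d "{d}" M] D'[OF that] that by (auto simp: \<D>_def)
      then have "span M D \<subseteq> span M (\<Union>\<D>)" by (intro span_mono) blast
      moreover have "f \<in> span M D" unfolding f_def by (rule span_comp[OF l(2)]) (use * D' in auto)
      ultimately show "f \<in> span M (\<Union>\<D>)" by blast
      show "null (q \<cdot> z)" if "R \<in> \<D>" "z \<in> Arr C" "Cod C z = Dom C f" "f \<cdot> z \<in> span M R" for R z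
        using no that by blast
    qed (use * f in simp_all)
    then show False using * by simp
  qed
  then obtain d z where d: "d \<in> D" and z: "z \<in> Arr C" "Cod C z = Dom C f" "f \<cdot> z \<in> span M (span M {d})" "\<not> null (q \<cdot> z)"
    by (auto simp: \<D>_def)
  have "f \<cdot> z \<in> span (Cod C d) {d}" using z(3) span_subset[of "span M {d}" M "{d}"] D'[OF d] by blast
  then obtain w where w: "w \<in> Arr C" "Dom C w = Dom C (f \<cdot> z)" "Cod C w = Dom C d" "d \<cdot> w = f \<cdot> z"
    by (rule span_mono_factor) (use D'[OF d] in auto)
  have "\<alpha> \<in> ASupp C (Cod C w)"
  proof (rule ASuppI[OF *(1,2), of "q \<cdot> z"])
    fix x assume x: "x \<in> Arr C" "Cod C x = Dom C (q \<cdot> z)" "null (w \<cdot> x)"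
    then have x': "Cod C x = Dom C z" using z * f by simp
    have "d \<cdot> (w \<cdot> x) = (f \<cdot> z) \<cdot> x" by (rule Comp_eq_Comp[OF w(4)]) (use w z f D'[OF d] x x' in simp_all)
    moreover have "null (d \<cdot> (w \<cdot> x))" by (rule null_comp2) (use w z f D'[OF d] x x' in simp_all)
    ultimately have "null (f \<cdot> (z \<cdot> x))" using z f x x' by simp
    then have "null (z \<cdot> x)" using mono_null_iff[OF f(1), of "z \<cdot> x"] z x x' by simp
    then show "null ((q \<cdot> z) \<cdot> x)" using z(1,2) x x' * f by simp
  qed (use z w * f in simp_all)
  then show "\<alpha> \<in> U" using w D(1)[OF d] by auto
qed

text \<open>Subobjects with support in \<open>U\<close> include the zero subobject and are closed
  under sums of two, so they are directed; their total sum again has support in \<open>U\<close> and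
  is the largest.\<close>

lemma section_inclusion:
  assumes M: "M \<in> Ob C"
  shows "is_section_inclusion C U M (section_inclusion C U M)"
proof -
  define D where "D = {d. subobj C d M \<and> ASupp C (Dom C d) \<subseteq> U}"
  have D: "mono_arr C d" "d \<in> Arr C" "Cod C d = M" if "d \<in> D" for d
    using that mono_arrD by (auto simp: D_def subobj_def)
  have "D \<noteq> {}"
  proof -
    obtain l where l: "mono_arr C l" "Cod C l = M" "l \<in> span M {}"
      using span_subobject[OF M, of "{}"] by blast
    note l' = mono_arrD[OF l(1)]
    have "null (Id C M \<cdot> l)" by (rule spanD[OF l(3)]) (use M in auto)
    then have nl: "null l" using l l' by simp
    have "ASupp C (Dom C l) \<subseteq> U"
    proof
      fix \<alpha> assume "\<alpha> \<in> ASupp C (Dom C l)"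
      then obtain H m q where *: "\<alpha> \<in> ASpec C" "H \<in> \<alpha>" "mono_arr C m" "m \<in> Arr C" "Cod C m = Dom C l" "epi_arr C q" "q \<in> Arr C"
        "Dom C q = Dom C m" "Cod C q = H" "\<not> null q"
        by (rule ASuppE)
      have "null m" using mono_null_iff[OF l(1), of m] nl * l' by simp
      then have "null (Id C (Dom C m))" using nonzero_mono_iff[OF *(3)] * by (simp add: nonzero_iff)
      then have "null (q \<cdot> Id C (Dom C m))" using * by (intro null_comp2) simp_all
      then show "\<alpha> \<in> U" using * by simp
    qed
    then have "l \<in> D" using l by (simp add: D_def subobj_def)
    then show ?thesis by blast
  qed
  moreover have "\<exists>c\<in>D. sub_le C a c \<and> sub_le C b c" if ab: "a \<in> D" "b \<in> D" for a b
  proof -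
    obtain l where l: "mono_arr C l" "Cod C l = M" "l \<in> span M {a, b}" "\<And>x. x \<in> span M {a, b} \<Longrightarrow> sub_le C x l"
      by (rule span_subobject[OF M, of "{a, b}"]) (use ab D in auto)
    have "ASupp C (Dom C l) \<subseteq> U"
      using ASupp_span_pair[of a M b l] l D ab by (auto simp: D_def)
    then have "l \<in> D" using l by (simp add: D_def subobj_def)
    then show ?thesis using l(4) ab D by (auto intro!: bexI[of _ l] span_superset)
  qed
  moreover obtain i where i: "mono_arr C i" "Cod C i = M" "i \<in> span M D" "\<And>x. x \<in> span M D \<Longrightarrow> sub_le C x i"
    by (rule span_subobject[OF M, of D]) (use D in auto)
  ultimately have "ASupp C (Dom C i) \<subseteq> U"
    by (intro ASupp_directed_span[of D M U i]) (use M in \<open>auto simp: D_def\<close>)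
  moreover have "sub_le C j i" if "j \<in> D" for j
    using i(4) span_superset[OF that] D[OF that] by blast
  ultimately have "is_section_inclusion C U M i"
    using i by (auto simp: is_section_inclusion_def subobj_def D_def)
  then show ?thesis unfolding section_inclusion_def by (rule someI)
qed

end

section \<open>Associated atoms of the quotient by the section\<close>

context accessible_locally_noetherian_category
begin

lemma embedding_in_injective_section:
  assumes inj: "section_preserves_injectives C U" and X: "X \<in> Ob C" "ASupp C X \<subseteq> U"
  obtains j where "mono_arr C j" "Dom C j = X" "injective_object C (Cod C j)" "ASupp C (Cod C j) \<subseteq> U"
proof -
  obtain e where e: "mono_arr C e" "Dom C e = X" "injective_object C (Cod C e)" using enough_injectives[OF X(1)] .
  note e' = mono_arrD[OF e(1)]
  let ?g = "section_inclusion C U (Cod C e)"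
  have g: "is_section_inclusion C U (Cod C e) ?g" using e' by (intro section_inclusion) simp
  then have g': "mono_arr C ?g" "?g \<in> Arr C" "Cod C ?g = Cod C e" "ASupp C (Dom C ?g) \<subseteq> U"
    using mono_arrD[of ?g] by (auto simp: is_section_inclusion_def subobj_def)
  have "sub_le C e ?g" using g e X by (auto simp: is_section_inclusion_def subobj_def)
  then obtain j where j: "j \<in> Arr C" "Dom C j = X" "Cod C j = Dom C ?g" "?g \<cdot> j = e"
    using e by (auto simp: sub_le_def)
  have "mono_arr C j" using mono_comp_right[of ?g j] j g' e by simp
  moreover have "injective_object C (Dom C ?g)"
    using inj e by (auto simp: section_preserves_injectives_def section_object_def)
  ultimately show thesis using that j g' by simp
qed

lemma AAss_quotient_section:
  assumes inj: "section_preserves_injectives C U" and M: "M \<in> Ob C"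
  shows "AAss C (quotient_object C (section_inclusion C U M)) \<subseteq> AAss C M"
proof
  fix \<alpha> assume "\<alpha> \<in> AAss C (quotient_object C (section_inclusion C U M))"
  define \<gamma> where "\<gamma> = section_inclusion C U M"
  have sec: "is_section_inclusion C U M \<gamma>" unfolding \<gamma>_def by (rule section_inclusion[OF M])
  then have \<gamma>: "mono_arr C \<gamma>" "\<gamma> \<in> Arr C" "Cod C \<gamma> = M" "ASupp C (Dom C \<gamma>) \<subseteq> U"
    "\<And>j. mono_arr C j \<Longrightarrow> Cod C j = M \<Longrightarrow> ASupp C (Dom C j) \<subseteq> U \<Longrightarrow> sub_le C j \<gamma>"
    using mono_arrD[of \<gamma>] by (auto simp: is_section_inclusion_def subobj_def)
  obtain q where q: "is_cokernel C \<gamma> q" "Cod C q = quotient_object C \<gamma>" using quotient_object_cokernel[OF \<gamma>(2)] .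
  have q': "q \<in> Arr C" "Dom C q = M" "null (q \<cdot> \<gamma>)" "epi_arr C q" using is_cokernelD(2-5)[OF q(1)] \<gamma> by simp_all
  obtain k where \<alpha>: "\<alpha> \<in> ASpec C" "Dom C k \<in> \<alpha>" and k: "mono_arr C k" "Cod C k = Cod C q"
    using \<open>\<alpha> \<in> AAss C (quotient_object C (section_inclusion C U M))\<close> q
    by (auto simp: AAss_def subobj_def \<gamma>_def)
  note k' = mono_arrD[OF k(1)]
  have nk: "\<not> null k" using atom_monoform[OF \<alpha>] nonzero_mono_iff[OF k(1)] by (simp add: monoform_def)
  obtain c where c: "is_cokernel C k c" using ex_cokernel k' by blast
  have c': "c \<in> Arr C" "Dom C c = Cod C q" "null (c \<cdot> k)" "epi_arr C c" using is_cokernelD(2-5)[OF c] k by simp_all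
  \<comment> \<open>\<open>p\<close> is the preimage of \<open>k\<close> under \<open>q\<close>;
    below, \<open>l\<close> includes the section into it and \<open>u\<close> maps it to the
    monoform object.\<close>
  obtain p where p: "is_kernel C (c \<cdot> q) p" using ex_kernel[of "c \<cdot> q"] c' q' by auto
  have p': "p \<in> Arr C" "Cod C p = M" "null (c \<cdot> (q \<cdot> p))" "mono_arr C p"
    using is_kernelD(2-5)[OF p] c' q' by simp_all
  have p_factor: "\<exists>u\<in>Arr C. Dom C u = Dom C x \<and> Cod C u = Dom C p \<and> p \<cdot> u = x"
    if "x \<in> Arr C" "Cod C x = M" "null (c \<cdot> (q \<cdot> x))" for x
    using is_kernelD(6)[OF p, of x] that c' q' by simp
  obtain l where l: "l \<in> Arr C" "Dom C l = Dom C \<gamma>" "Cod C l = Dom C p" "p \<cdot> l = \<gamma>"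
    using p_factor[of \<gamma>] \<gamma> c' q' by auto
  have lm: "mono_arr C l" using mono_comp_right[of p l] l p' \<gamma> by simp
  obtain u where u: "u \<in> Arr C" "Dom C u = Dom C p" "Cod C u = Dom C k" "k \<cdot> u = q \<cdot> p"
    using mono_cokernel_factor[OF k(1) c, of "q \<cdot> p"] p' q' k by auto
  \<comment> \<open>An arrow is killed by \<open>u\<close> exactly when it factors through
    \<open>l\<close>, so \<open>u \<cdot> n\<close> being monic says that \<open>n\<close> meets the
    section trivially.\<close>
  have "\<exists>n. mono_arr C n \<and> Cod C n = Dom C p \<and> \<not> null n \<and> mono_arr C (u \<cdot> n)"
  proof (rule ccontr)
    assume no: "\<not> ?thesis"
    obtain j where j: "mono_arr C j" "Dom C j = Dom C l" "injective_object C (Cod C j)" "ASupp C (Cod C j) \<subseteq> U"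
      using embedding_in_injective_section[OF inj, of "Dom C l"] l \<gamma> by auto
    note j' = mono_arrD[OF j(1)]
    have "\<exists>g\<in>Hom C (Cod C l) (Cod C j). g \<cdot> l = j"
    proof -
      have "\<forall>f\<in>Hom C (Dom C l) (Cod C j). \<exists>g\<in>Hom C (Cod C l) (Cod C j). g \<cdot> l = f"
        using j(3) lm unfolding injective_object_def by blast
      then show ?thesis by (rule bspec) (use j(2) j' in simp)
    qed
    then obtain g where g_Hom: "g \<in> Hom C (Cod C l) (Cod C j)" and gl: "g \<cdot> l = j" by blast
    have g: "g \<in> Arr C" "Dom C g = Dom C p" "Cod C g = Cod C j" "g \<cdot> l = j"
      using g_Hom l(3) gl by simp_all
    have "mono_arr C g"
      unfolding mono_arr_iff
    proof (intro conjI ballI impI g)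
      fix x assume x: "x \<in> Arr C" "Cod C x = Dom C g" "null (g \<cdot> x)"
      show "null x"
      proof (rule ccontr)
        assume nx: "\<not> null x"
        \<comment> \<open>The image \<open>n\<close> of a nonzero \<open>x\<close> killed by
          \<open>g\<close> meets the section trivially, because \<open>g\<close> restricts there to
          the monomorphism \<open>j\<close>; this contradicts \<open>no\<close>.\<close>
        obtain n e where ne: "mono_arr C n" "epi_arr C e" "n \<in> Arr C" "e \<in> Arr C" "Dom C e = Dom C x"
          "Cod C n = Cod C x" "Dom C n = Cod C e" "n \<cdot> e = x"
          using mono_epi_factorization[OF x(1)] .
        have n: "Cod C n = Dom C p" using ne x g by simp
        have "null ((g \<cdot> n) \<cdot> e)" using ne x g n by simp
        then have gn: "null (g \<cdot> n)" using epi_null_iff[OF ne(2), of "g \<cdot> n"] ne(3-7) g n by simp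
        have "\<not> null n" using nx ne null_comp1 by metis
        moreover have "mono_arr C (u \<cdot> n)"
          unfolding mono_arr_iff
        proof (intro conjI ballI impI)
          fix z assume z: "z \<in> Arr C" "Cod C z = Dom C (u \<cdot> n)" "null ((u \<cdot> n) \<cdot> z)"
          then have z': "Cod C z = Dom C n" "null (u \<cdot> (n \<cdot> z))" using u ne(3) n by simp_all
          have "k \<cdot> (u \<cdot> (n \<cdot> z)) = (q \<cdot> p) \<cdot> (n \<cdot> z)"
            by (rule Comp_eq_Comp[OF u(4)]) (use u k' z z' ne(3) n in simp_all)
          moreover have "null (k \<cdot> (u \<cdot> (n \<cdot> z)))" using z z' u(1-3) k' ne(3) n by simp
          ultimately have "null (q \<cdot> (p \<cdot> (n \<cdot> z)))" using q' p' z z' ne(3) n by simp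
          then obtain s where s: "s \<in> Arr C" "Dom C s = Dom C z" "Cod C s = Dom C \<gamma>" "\<gamma> \<cdot> s = p \<cdot> (n \<cdot> z)"
            using mono_cokernel_factor[OF \<gamma>(1) q(1), of "p \<cdot> (n \<cdot> z)"] \<gamma> p' z z' ne(3) n by auto
          have "p \<cdot> (l \<cdot> s) = \<gamma> \<cdot> s" by (rule Comp_eq_Comp[OF l(4)]) (use s l p' in simp_all)
          then have "p \<cdot> (l \<cdot> s) = p \<cdot> (n \<cdot> z)" using s by simp
          then have ls: "l \<cdot> s = n \<cdot> z" by (rule mono_cancel[OF _ p'(4)]) (use s l z z' ne(3) n in simp_all)
          have "g \<cdot> (l \<cdot> s) = j \<cdot> s" by (rule Comp_eq_Comp[OF g(4)]) (use s l g in simp_all)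
          moreover have "null (g \<cdot> (n \<cdot> z))" by (rule null_comp3[OF gn]) (use g z z' ne(3) n in simp_all)
          ultimately have "null (j \<cdot> s)" using ls by simp
          then have "null s" using mono_null_iff[OF j(1), of s] s j l by simp
          then have "null (l \<cdot> s)" using s l by simp
          then show "null z" using ls mono_null_iff[OF ne(1), of z] z z' by simp
        qed (use u ne(3) n in simp)
        ultimately show False using no ne(1) n by blast
      qed
    qed
    then have "ASupp C (Dom C p) \<subseteq> U" using ASupp_mono[of g] g j by auto
    then have "sub_le C p \<gamma>" by (rule \<gamma>(5)[OF p'(4,2)])
    then obtain s where s: "s \<in> Arr C" "Dom C s = Dom C p" "Cod C s = Dom C \<gamma>" "\<gamma> \<cdot> s = p" by (auto simp: sub_le_def)
    have "null (q \<cdot> (\<gamma> \<cdot> s))" by (rule null_comp3) (use q' \<gamma> s in simp_all)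
    then have qp: "null (q \<cdot> p)" using s by simp
    \<comment> \<open>With \<open>q \<cdot> p\<close> zero, \<open>c \<cdot> q\<close> kills no more
      than \<open>q\<close> does, so \<open>c\<close> is monic; as it kills \<open>k\<close>, the
      nonzero \<open>k\<close> would vanish.\<close>
    have "mono_arr C c"
      using q'(4) c'(4,2)
    proof (rule cokernel_comp_mono)
      fix x assume x: "x \<in> Arr C" "Cod C x = Dom C q" "null (c \<cdot> (q \<cdot> x))"
      then obtain v where v: "v \<in> Arr C" "Cod C v = Dom C p" "p \<cdot> v = x" using p_factor[of x] q' by auto
      have "null (q \<cdot> (p \<cdot> v))" by (rule null_comp3[OF qp]) (use q' p' v in simp_all)
      then show "null (q \<cdot> x)" using v by simp
    qed
    then show False using mono_null_iff[of c k] c' k k' nk by simp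
  qed
  then obtain n where n: "mono_arr C n" "Cod C n = Dom C p" "\<not> null n" "mono_arr C (u \<cdot> n)" by blast
  note n' = mono_arrD[OF n(1)]
  have "\<not> null (u \<cdot> n)"
    using nonzero_mono_iff[OF n(1)] nonzero_mono_iff[OF n(4)] n n' u by simp
  \<comment> \<open>The same object embeds in the monoform object by \<open>u \<cdot> n\<close>,
    which puts it in \<open>\<alpha>\<close>, and in \<open>M\<close> by
    \<open>p \<cdot> n\<close>.\<close>
  then have "Dom C n \<in> \<alpha>" using atom_subobject[OF \<alpha> n(4)] n n' u by simp
  moreover have "subobj C (p \<cdot> n) M" "Dom C (p \<cdot> n) = Dom C n"
    using mono_comp[OF n(1) p'(4)] n n' p' by (simp_all add: subobj_def)
  ultimately show "\<alpha> \<in> AAss C M" using \<alpha> by (auto simp: AAss_def)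
qed

end

theorem proposition3p20:
  fixes \<kappa> :: "'u rel" and C :: "('o, 'm) precat" and U :: "'o set set" and M :: 'o
  assumes "inaccessible \<kappa>"
    and "locally_noetherian_grothendieck_category \<kappa> C"
    and "atom_open C U"
    and "section_preserves_injectives C U"
    and "M \<in> Ob C"
  shows "AAss C (quotient_object C (section_inclusion C U M)) \<subseteq> AAss C M"
proof -
  interpret locally_noetherian_grothendieck_category \<kappa> C by fact
  interpret accessible_locally_noetherian_category \<kappa> C by unfold_locales fact
  show ?thesis using assms(4,5) by (rule AAss_quotient_section)
qed

end
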